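(* Let $(\mathcal X,d,\mu)$ be a space of homogeneous type with $\mu(\mathcal X)=\infty$, $\beta,\gamma\in(0,\eta)$ and $s\in(-(\beta\wedge\gamma),\beta\wedge\gamma)$. (i) If $0<q_0\le q_1\le\infty$ and $p\in(p(s,\beta\wedge\gamma),\infty]$, then $\dot B^s_{p,q_0}(\mathcal X)\subset\dot B^s_{p,q_1}(\mathcal X)$; if $p(s,\beta\wedge\gamma)<q_0\le q_1\le\infty$ and $p\in(p(s,\beta\wedge\gamma),\infty)$, then $\dot F^s_{p,q_0}(\mathcal X)\subset\dot F^s_{p,q_1}(\mathcal X)$. (ii) If $p\in(p(s,\beta\wedge\gamma),\infty)$ and $q\in(p(s,\beta\wedge\gamma),\infty]$, then $\dot B^s_{p,p\wedge q}(\mathcal X)\subset\dot F^s_{p,q}(\mathcal X)\subset\dot B^s_{p,p\vee q}(\mathcal X)$. (iii) If $\widetilde\beta\in(s_+,\eta)$ and $\widetilde\gamma\in\big(\max\{-s+\omega(\tfrac1p-1)_+,\ \omega(\tfrac1p-1)_+\},\eta\big)$, then $\mathring{\mathcal G}(\widetilde\beta,\widetilde\gamma)\subset\dot B^s_{p,q}(\mathcal X)$ for any $q\in(0,\infty]$ and $p\in(p(s,\beta\wedge\gamma),\infty]$, and $\mathring{\mathcal G}(\widetilde\beta,\widetilde\gamma)\subset\dot F^s_{p,q}(\mathcal X)$ for any $q\in(p(s,\beta\wedge\gamma),\infty]$ and $p\in(p(s,\beta\wedge\gamma),\infty)$.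
   Context: Space. $d$ is a quasi-metric on $\mathcal X$: $d\ge0$, $d(x,y)=0$ iff $x=y$, $d$ symmetric, $d(x,z)\le A_0[d(x,y)+d(y,z)]$ for some $A_0\in[1,\infty)$. $B(x,r):=\{y:d(x,y)<r\}$. $(\mathcal X,d,\mu)$ is a space of homogeneous type: $\mu$ is a measure for which balls are measurable with $0<\mu(B)<\infty$, and $\mu(2B)\le C_{(\mu)}\mu(B)$ for every ball $B$; $\omega:=\log_2C_{(\mu)}$. $V_r(x):=\mu(B(x,r))$, $V(x,y):=\mu(B(x,d(x,y)))$ ($=0$ if $x=y$). $a\wedge b:=\min\{a,b\}$, $a\vee b:=\max\{a,b\}$, $r_+:=\max\{r,0\}$. Reference points. Fix $0<c_0\le C_0<\infty$, a small $\delta\in(0,1)$ (e.g. $\delta\le(2A_0)^{-10}$) with $12A_0^3C_0\delta\le c_0$, and points $\{z^k_\alpha:k\in\mathbb Z,\alpha\in\mathcal A_k\}$, nested ($\mathcal A_k\subset\mathcal A_{k+1}$ and $z^{k+1}_\alpha=z^k_\alpha$ for $\alpha\in\mathcal A_k$), with $d(z^k_\alpha,z^k_\beta)\ge c_0\delta^k$ if $\alpha\ne\beta$ and $\min_{\alpha\in\mathcal A_k}d(x,z^k_\alpha)<C_0\delta^k$ for all $x$. $\mathcal Y^k:=\{z^{k+1}_\alpha:\alpha\in\mathcal A_{k+1}\setminus\mathcal A_k\}$, $d(x,\mathcal Y^k):=\inf_{y\in\mathcal Y^k}d(x,y)$. exp-ATI. $\eta\in(0,1)$ is a fixed exponent for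 which exp-ATIs exist on $\mathcal X$. An exp-ATI is a sequence $\{Q_k\}_{k\in\mathbb Z}$ of bounded linear integral operators on $L^2(\mathcal X)$, with kernels $Q_k(x,y)$, such that for some constants $C,\nu\in(0,\infty)$, $a\in(0,1]$, writing $$E_k(x,y):=\frac{1}{\sqrt{V_{\delta^k}(x)V_{\delta^k}(y)}}\exp\Big\{-\nu\Big[\frac{d(x,y)}{\delta^k}\Big]^a\Big\}\exp\Big\{-\nu\Big[\frac{\max\{d(x,\mathcal Y^k),d(y,\mathcal Y^k)\}}{\delta^k}\Big]^a\Big\},$$ one has: (i) $\sum_{k\in\mathbb Z}Q_k=I$ in $L^2(\mathcal X)$; and for all $k$ and all points: (ii) $|Q_k(x,y)|\le CE_k(x,y)$; (iii) if $d(x,x')\le\delta^k$, then $|Q_k(x,y)-Q_k(x',y)|+|Q_k(y,x)-Q_k(y,x')|\le C[d(x,x')/\delta^k]^\eta E_k(x,y)$; (iv) if $d(x,x')\le\delta^k$ and $d(y,y')\le\delta^k$, then $|[Q_k(x,y)-Q_k(x',y)]-[Q_k(x,y')-Q_k(x',y')]|\le C[d(x,x')/\delta^k]^\eta[d(y,y')/\delta^k]^\eta E_k(x,y)$; (v) $\int_{\mathcal X}Q_k(x,y')\,d\mu(y')=0=\int_{\mathcal X}Q_k(x',y)\,d\mu(x')$. Test functions and distributions. Fix $x_0\in\mathcal X$. For $\beta\in(0,1]$, $\gamma\in(0,\infty)$, $\mathcal G(\beta,\gamma)$ is the set of functions $f$ for which there is $C>0$ such that, with $D_\gamma(x):=\frac{1}{V_1(x_0)+V(x_0,x)}[1+d(x_0,x)]^{-\gamma}$: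 $|f(x)|\le CD_\gamma(x)$ for all $x$, and $|f(x)-f(y)|\le C[\frac{d(x,y)}{1+d(x_0,x)}]^\beta D_\gamma(x)$ whenever $d(x,y)\le(2A_0)^{-1}[1+d(x_0,x)]$; its norm is the infimum of such $C$. $\mathring{\mathcal G}(\beta,\gamma):=\{f\in\mathcal G(\beta,\gamma):\int_{\mathcal X}f\,d\mu=0\}$. For $\beta,\gamma\in(0,\eta]$, $\mathring{\mathcal G}^\eta_0(\beta,\gamma)$ is the completion of $\mathring{\mathcal G}(\eta,\eta)$ in $\mathring{\mathcal G}(\beta,\gamma)$, and $(\mathring{\mathcal G}^\eta_0(\beta,\gamma))'$ is its dual. For $f$ in this dual, $Q_k(f)(x):=\langle f,Q_k(x,\cdot)\rangle$; functions act as distributions by integration. Index and spaces. For $|s|<t$, $p(s,t):=\max\{\frac{\omega}{\omega+t},\frac{\omega}{\omega+t+s}\}$. Fix an exp-ATI $\{Q_k\}_{k\in\mathbb Z}$. For $p\in(p(s,\beta\wedge\gamma),\infty]$, $q\in(0,\infty]$, $\dot B^s_{p,q}(\mathcal X)$ is the set of $f\in(\mathring{\mathcal G}^\eta_0(\beta,\gamma))'$ with $\|f\|_{\dot B^s_{p,q}(\mathcal X)}:=[\sum_{k\in\mathbb Z}\delta^{-ksq}\|Q_k(f)\|_{L^p(\mathcal X)}^q]^{1/q}<\infty$. For $p\in(p(s,\beta\wedge\gamma),\infty)$, $q\in(p(s,\beta\wedge\gamma),\infty]$, $\dot F^s_{p,q}(\mathcal X)$ is the set of $f\in(\mathring{\mathcal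 G}^\eta_0(\beta,\gamma))'$ with $\|f\|_{\dot F^s_{p,q}(\mathcal X)}:=\|[\sum_{k\in\mathbb Z}\delta^{-ksq}|Q_k(f)|^q]^{1/q}\|_{L^p(\mathcal X)}<\infty$ (usual modifications for $p=\infty$ or $q=\infty$). *)

theory Defs
  imports "HOL-Analysis.Analysis" "HOL-Probability.Essential_Supremum"
begin

section \<open>Spaces of homogeneous type\<close>

definition qball :: "('a \<Rightarrow> 'a \<Rightarrow> real) \<Rightarrow> 'a \<Rightarrow> real \<Rightarrow> 'a set" where
  "qball d x r = {y. d x y < r}"

text \<open>The underlying set is the whole type \<open>'a\<close>.\<close>

locale quasi_metric_space =
  fixes d :: "'a \<Rightarrow> 'a \<Rightarrow> real" and A0 :: real
  assumes d_nonneg: "0 \<le> d x y"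
    and d_zero_iff: "d x y = 0 \<longleftrightarrow> x = y"
    and d_sym: "d x y = d y x"
    and A0_ge_1: "1 \<le> A0"
    and d_triangle: "d x z \<le> A0 * (d x y + d y z)"

text \<open>The sigma-algebra of \<open>M\<close> is only required to contain the balls; since a doubling space is
  separable, it then contains all sets that are open in the topology of \<open>d\<close>.\<close>

locale homogeneous_type_space = quasi_metric_space d A0
  for d :: "'a \<Rightarrow> 'a \<Rightarrow> real" and A0 :: real +
  fixes M :: "'a measure" and Cmu :: real
  assumes space_UNIV: "space M = UNIV"
    and ball_measurable: "0 < r \<Longrightarrow> qball d x r \<in> sets M"
    and ball_pos: "0 < r \<Longrightarrow> 0 < emeasure M (qball d x r)"
    and ball_finite: "0 < r \<Longrightarrow> emeasure M (qball d x r) < \<infinity>"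
    and doubling: "0 < r \<Longrightarrow> measure M (qball d x (2 * r)) \<le> Cmu * measure M (qball d x r)"

definition upper_dim :: "real \<Rightarrow> real" where
  "upper_dim Cmu = log 2 Cmu"

text \<open>\<open>vol\<close> is $V_r(x)$ and \<open>vol_between\<close> is $V(x,y)$.\<close>

definition vol :: "'a measure \<Rightarrow> ('a \<Rightarrow> 'a \<Rightarrow> real) \<Rightarrow> real \<Rightarrow> 'a \<Rightarrow> real" where
  "vol M d r x = measure M (qball d x r)"

definition vol_between :: "'a measure \<Rightarrow> ('a \<Rightarrow> 'a \<Rightarrow> real) \<Rightarrow> 'a \<Rightarrow> 'a \<Rightarrow> real" where
  "vol_between M d x y = measure M (qball d x (d x y))"


section \<open>Reference points\<close>

locale reference_points = quasi_metric_space d A0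
  for d :: "'a \<Rightarrow> 'a \<Rightarrow> real" and A0 :: real +
  fixes c0 C0 \<delta> :: real and A :: "int \<Rightarrow> 'i set" and z :: "int \<Rightarrow> 'i \<Rightarrow> 'a"
  assumes c0_pos: "0 < c0"
    and c0_le_C0: "c0 \<le> C0"
    and delta_pos: "0 < \<delta>"
    and delta_less_1: "\<delta> < 1"
    and delta_small: "12 * A0 ^ 3 * C0 * \<delta> \<le> c0"
    and index_nested: "A k \<subseteq> A (k + 1)"
    and points_nested: "\<alpha> \<in> A k \<Longrightarrow> z (k + 1) \<alpha> = z k \<alpha>"
    and points_separated:
      "\<alpha> \<in> A k \<Longrightarrow> \<beta> \<in> A k \<Longrightarrow> \<alpha> \<noteq> \<beta> \<Longrightarrow> c0 * \<delta> powi k \<le> d (z k \<alpha>) (z k \<beta>)"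
    and points_dense: "\<exists>\<alpha>\<in>A k. d x (z k \<alpha>) < C0 * \<delta> powi k"

definition new_points :: "(int \<Rightarrow> 'i set) \<Rightarrow> (int \<Rightarrow> 'i \<Rightarrow> 'a) \<Rightarrow> int \<Rightarrow> 'a set" where
  "new_points A z k = z (k + 1) ` (A (k + 1) - A k)"

text \<open>Only used for nonempty \<open>S\<close>, because \<open>Inf {}\<close> is an unspecified real.\<close>

definition dist_to :: "('a \<Rightarrow> 'a \<Rightarrow> real) \<Rightarrow> 'a \<Rightarrow> 'a set \<Rightarrow> real" where
  "dist_to d x S = (INF y\<in>S. d x y)"


section \<open>Lebesgue and weighted sequence (quasi-)norms with values in \<open>[0, \<infinity>]\<close>\<close>

text \<open>Only used for exponents \<open>a > 0\<close>.\<close>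

definition ennreal_powr :: "ennreal \<Rightarrow> real \<Rightarrow> ennreal" where
  "ennreal_powr t a = (if t = \<infinity> then \<infinity> else ennreal (enn2real t powr a))"

definition Lp_norm :: "'a measure \<Rightarrow> ennreal \<Rightarrow> ('a \<Rightarrow> ennreal) \<Rightarrow> ennreal" where
  "Lp_norm M p f =
    (if p = \<infinity> then esssup M f
     else ennreal_powr (\<integral>\<^sup>+x. ennreal_powr (f x) (enn2real p) \<partial>M) (1 / enn2real p))"

definition weighted_lq_norm :: "real \<Rightarrow> real \<Rightarrow> ennreal \<Rightarrow> (int \<Rightarrow> ennreal) \<Rightarrow> ennreal" where
  "weighted_lq_norm \<delta> s q a =
    (if q = \<infinity> then (SUP k. ennreal (\<delta> powr (- (of_int k * s))) * a k)
     else ennreal_powr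
       (\<Sum>\<^sub>\<infinity>k\<in>UNIV. ennreal (\<delta> powr (- (of_int k * s * enn2real q))) * ennreal_powr (a k) (enn2real q))
       (1 / enn2real q))"

definition L2_funs :: "'a measure \<Rightarrow> ('a \<Rightarrow> complex) set" where
  "L2_funs M = {f \<in> borel_measurable M. Lp_norm M 2 (\<lambda>x. ennreal (norm (f x))) < \<infinity>}"


section \<open>Approximations of the identity with exponential decay\<close>

definition integral_op :: "'a measure \<Rightarrow> ('a \<Rightarrow> 'a \<Rightarrow> complex) \<Rightarrow> ('a \<Rightarrow> complex) \<Rightarrow> 'a \<Rightarrow> complex" where
  "integral_op M K f x = (\<integral>y. K x y * f y \<partial>M)"

definition bounded_L2_kernel :: "'a measure \<Rightarrow> ('a \<Rightarrow> 'a \<Rightarrow> complex) \<Rightarrow> bool" where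
  "bounded_L2_kernel M K \<longleftrightarrow>
    (\<exists>B\<ge>0. \<forall>f\<in>L2_funs M.
      (AE x in M. integrable M (\<lambda>y. K x y * f y)) \<and>
      integral_op M K f \<in> L2_funs M \<and>
      Lp_norm M 2 (\<lambda>x. ennreal (norm (integral_op M K f x)))
        \<le> ennreal B * Lp_norm M 2 (\<lambda>x. ennreal (norm (f x))))"

text \<open>If \<open>Y k\<close> is empty then, by the convention $\inf\emptyset=\infty$, the distance to it is infinite
  and the last exponential factor vanishes.\<close>

definition ATI_bound ::
  "'a measure \<Rightarrow> ('a \<Rightarrow> 'a \<Rightarrow> real) \<Rightarrow> real \<Rightarrow> (int \<Rightarrow> 'a set) \<Rightarrow> real \<Rightarrow> real \<Rightarrow> int \<Rightarrow> 'a \<Rightarrow> 'a \<Rightarrow> real" where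
  "ATI_bound M d \<delta> Y \<nu> a k x y =
    (if Y k = {} then 0
     else 1 / sqrt (vol M d (\<delta> powi k) x * vol M d (\<delta> powi k) y)
       * exp (- \<nu> * (d x y / \<delta> powi k) powr a)
       * exp (- \<nu> * (max (dist_to d x (Y k)) (dist_to d y (Y k)) / \<delta> powi k) powr a))"

definition exp_ATI ::
  "'a measure \<Rightarrow> ('a \<Rightarrow> 'a \<Rightarrow> real) \<Rightarrow> real \<Rightarrow> (int \<Rightarrow> 'a set) \<Rightarrow> real \<Rightarrow> (int \<Rightarrow> 'a \<Rightarrow> 'a \<Rightarrow> complex) \<Rightarrow> bool" where
  "exp_ATI M d \<delta> Y \<eta> Q \<longleftrightarrow>
    (\<forall>k. bounded_L2_kernel M (Q k)) \<and>
    (\<forall>f\<in>L2_funs M.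
      ((\<lambda>(m, n). Lp_norm M 2 (\<lambda>x. ennreal (norm ((\<Sum>k\<in>{-m..n}. integral_op M (Q k) f x) - f x))))
        \<longlongrightarrow> 0) (at_top \<times>\<^sub>F at_top)) \<and>
    (\<exists>C \<nu> a. 0 < C \<and> 0 < \<nu> \<and> 0 < a \<and> a \<le> 1 \<and>
      (let E = ATI_bound M d \<delta> Y \<nu> a in
        (\<forall>k x y. norm (Q k x y) \<le> C * E k x y) \<and>
        (\<forall>k x x' y. d x x' \<le> \<delta> powi k \<longrightarrow>
          norm (Q k x y - Q k x' y) + norm (Q k y x - Q k y x')
            \<le> C * (d x x' / \<delta> powi k) powr \<eta> * E k x y) \<and>
        (\<forall>k x x' y y'. d x x' \<le> \<delta> powi k \<longrightarrow> d y y' \<le> \<delta> powi k \<longrightarrow>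
          norm ((Q k x y - Q k x' y) - (Q k x y' - Q k x' y'))
            \<le> C * (d x x' / \<delta> powi k) powr \<eta> * (d y y' / \<delta> powi k) powr \<eta> * E k x y))) \<and>
    (\<forall>k x. (\<integral>y'. Q k x y' \<partial>M) = 0) \<and>
    (\<forall>k y. (\<integral>x'. Q k x' y \<partial>M) = 0)"


section \<open>Test functions and distributions\<close>

definition test_decay ::
  "'a measure \<Rightarrow> ('a \<Rightarrow> 'a \<Rightarrow> real) \<Rightarrow> 'a \<Rightarrow> real \<Rightarrow> 'a \<Rightarrow> real" where
  "test_decay M d x0 \<gamma> x =
    1 / (vol M d 1 x0 + vol_between M d x0 x) * (1 + d x0 x) powr (- \<gamma>)"

definition test_bound ::
  "'a measure \<Rightarrow> ('a \<Rightarrow> 'a \<Rightarrow> real) \<Rightarrow> real \<Rightarrow> 'a \<Rightarrow> real \<Rightarrow> real \<Rightarrow> real \<Rightarrow> ('a \<Rightarrow> complex) \<Rightarrow> bool" where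
  "test_bound M d A0 x0 \<beta> \<gamma> C f \<longleftrightarrow>
    (\<forall>x. norm (f x) \<le> C * test_decay M d x0 \<gamma> x) \<and>
    (\<forall>x y. d x y \<le> inverse (2 * A0) * (1 + d x0 x) \<longrightarrow>
      norm (f x - f y) \<le> C * (d x y / (1 + d x0 x)) powr \<beta> * test_decay M d x0 \<gamma> x)"

definition test_funs ::
  "'a measure \<Rightarrow> ('a \<Rightarrow> 'a \<Rightarrow> real) \<Rightarrow> real \<Rightarrow> 'a \<Rightarrow> real \<Rightarrow> real \<Rightarrow> ('a \<Rightarrow> complex) set" where
  "test_funs M d A0 x0 \<beta> \<gamma> = {f. \<exists>C>0. test_bound M d A0 x0 \<beta> \<gamma> C f}"

definition test_norm ::
  "'a measure \<Rightarrow> ('a \<Rightarrow> 'a \<Rightarrow> real) \<Rightarrow> real \<Rightarrow> 'a \<Rightarrow> real \<Rightarrow> real \<Rightarrow> ('a \<Rightarrow> complex) \<Rightarrow> real" where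
  "test_norm M d A0 x0 \<beta> \<gamma> f = Inf {C. 0 < C \<and> test_bound M d A0 x0 \<beta> \<gamma> C f}"

definition test_funs_mean0 ::
  "'a measure \<Rightarrow> ('a \<Rightarrow> 'a \<Rightarrow> real) \<Rightarrow> real \<Rightarrow> 'a \<Rightarrow> real \<Rightarrow> real \<Rightarrow> ('a \<Rightarrow> complex) set" where
  "test_funs_mean0 M d A0 x0 \<beta> \<gamma> = {f \<in> test_funs M d A0 x0 \<beta> \<gamma>. (\<integral>x. f x \<partial>M) = 0}"

text \<open>The completion of the mean-zero test functions of exponents \<open>\<eta>, \<eta>\<close> inside the Banach space of
  those of exponents \<open>\<beta>, \<gamma>\<close> is their closure there; it carries the norm of the latter space.\<close>

definition test_closure ::
  "'a measure \<Rightarrow> ('a \<Rightarrow> 'a \<Rightarrow> real) \<Rightarrow> real \<Rightarrow> 'a \<Rightarrow> real \<Rightarrow> real \<Rightarrow> real \<Rightarrow> ('a \<Rightarrow> complex) set" where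
  "test_closure M d A0 x0 \<eta> \<beta> \<gamma> =
    {f \<in> test_funs_mean0 M d A0 x0 \<beta> \<gamma>.
      \<forall>\<epsilon>>0. \<exists>g\<in>test_funs_mean0 M d A0 x0 \<eta> \<eta>. test_norm M d A0 x0 \<beta> \<gamma> (\<lambda>x. f x - g x) < \<epsilon>}"

text \<open>Functionals are \<open>extensional\<close>, so that each of them is represented by exactly one HOL function.\<close>

definition distributions ::
  "'a measure \<Rightarrow> ('a \<Rightarrow> 'a \<Rightarrow> real) \<Rightarrow> real \<Rightarrow> 'a \<Rightarrow> real \<Rightarrow> real \<Rightarrow> real \<Rightarrow> (('a \<Rightarrow> complex) \<Rightarrow> complex) set" where
  "distributions M d A0 x0 \<eta> \<beta> \<gamma> =
    {\<phi> \<in> extensional (test_closure M d A0 x0 \<eta> \<beta> \<gamma>).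
      (\<forall>f\<in>test_closure M d A0 x0 \<eta> \<beta> \<gamma>. \<forall>g\<in>test_closure M d A0 x0 \<eta> \<beta> \<gamma>.
        \<phi> (\<lambda>x. f x + g x) = \<phi> f + \<phi> g) \<and>
      (\<forall>c. \<forall>f\<in>test_closure M d A0 x0 \<eta> \<beta> \<gamma>. \<phi> (\<lambda>x. c * f x) = c * \<phi> f) \<and>
      (\<exists>K. \<forall>f\<in>test_closure M d A0 x0 \<eta> \<beta> \<gamma>. norm (\<phi> f) \<le> K * test_norm M d A0 x0 \<beta> \<gamma> f)}"

text \<open>The distribution induced by a function (the pairing is bilinear, without conjugation).\<close>

definition induced_distribution ::
  "'a measure \<Rightarrow> ('a \<Rightarrow> 'a \<Rightarrow> real) \<Rightarrow> real \<Rightarrow> 'a \<Rightarrow> real \<Rightarrow> real \<Rightarrow> real \<Rightarrow> ('a \<Rightarrow> complex) \<Rightarrow>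
    ('a \<Rightarrow> complex) \<Rightarrow> complex" where
  "induced_distribution M d A0 x0 \<eta> \<beta> \<gamma> f =
    restrict (\<lambda>g. \<integral>x. f x * g x \<partial>M) (test_closure M d A0 x0 \<eta> \<beta> \<gamma>)"

definition apply_kernel :: "('a \<Rightarrow> 'a \<Rightarrow> complex) \<Rightarrow> (('a \<Rightarrow> complex) \<Rightarrow> complex) \<Rightarrow> 'a \<Rightarrow> complex" where
  "apply_kernel K \<phi> x = \<phi> (\<lambda>y. K x y)"


section \<open>Homogeneous Besov and Triebel--Lizorkin spaces\<close>

definition index_bound :: "real \<Rightarrow> real \<Rightarrow> real \<Rightarrow> real" where
  "index_bound \<omega> s t = max (\<omega> / (\<omega> + t)) (\<omega> / (\<omega> + t + s))"

definition besov_norm ::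
  "'a measure \<Rightarrow> real \<Rightarrow> (int \<Rightarrow> 'a \<Rightarrow> 'a \<Rightarrow> complex) \<Rightarrow> real \<Rightarrow> ennreal \<Rightarrow> ennreal \<Rightarrow>
    (('a \<Rightarrow> complex) \<Rightarrow> complex) \<Rightarrow> ennreal" where
  "besov_norm M \<delta> Q s p q \<phi> =
    weighted_lq_norm \<delta> s q (\<lambda>k. Lp_norm M p (\<lambda>x. ennreal (norm (apply_kernel (Q k) \<phi> x))))"

definition triebel_norm ::
  "'a measure \<Rightarrow> real \<Rightarrow> (int \<Rightarrow> 'a \<Rightarrow> 'a \<Rightarrow> complex) \<Rightarrow> real \<Rightarrow> ennreal \<Rightarrow> ennreal \<Rightarrow>
    (('a \<Rightarrow> complex) \<Rightarrow> complex) \<Rightarrow> ennreal" where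
  "triebel_norm M \<delta> Q s p q \<phi> =
    Lp_norm M p (\<lambda>x. weighted_lq_norm \<delta> s q (\<lambda>k. ennreal (norm (apply_kernel (Q k) \<phi> x))))"

definition besov_space ::
  "'a measure \<Rightarrow> ('a \<Rightarrow> 'a \<Rightarrow> real) \<Rightarrow> real \<Rightarrow> 'a \<Rightarrow> real \<Rightarrow> real \<Rightarrow> (int \<Rightarrow> 'a \<Rightarrow> 'a \<Rightarrow> complex) \<Rightarrow>
    real \<Rightarrow> real \<Rightarrow> real \<Rightarrow> ennreal \<Rightarrow> ennreal \<Rightarrow> (('a \<Rightarrow> complex) \<Rightarrow> complex) set" where
  "besov_space M d A0 x0 \<delta> \<eta> Q \<beta> \<gamma> s p q =
    {\<phi> \<in> distributions M d A0 x0 \<eta> \<beta> \<gamma>. besov_norm M \<delta> Q s p q \<phi> < \<infinity>}"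

definition triebel_space ::
  "'a measure \<Rightarrow> ('a \<Rightarrow> 'a \<Rightarrow> real) \<Rightarrow> real \<Rightarrow> 'a \<Rightarrow> real \<Rightarrow> real \<Rightarrow> (int \<Rightarrow> 'a \<Rightarrow> 'a \<Rightarrow> complex) \<Rightarrow>
    real \<Rightarrow> real \<Rightarrow> real \<Rightarrow> ennreal \<Rightarrow> ennreal \<Rightarrow> (('a \<Rightarrow> complex) \<Rightarrow> complex) set" where
  "triebel_space M d A0 x0 \<delta> \<eta> Q \<beta> \<gamma> s p q =
    {\<phi> \<in> distributions M d A0 x0 \<eta> \<beta> \<gamma>. triebel_norm M \<delta> Q s p q \<phi> < \<infinity>}"

end

theory Submission
  imports Defs
begin

text \<open>Parts (i) and (ii) are statements about mixed norms \<open>L^p(l^q)\<close> and \<open>l^q(L^p)\<close>: sequence norms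
  decrease in \<open>q\<close>, and Minkowski's inequality allows the two norms to be exchanged in one direction,
  depending on the order of \<open>p\<close> and \<open>q\<close>. Measurability of \<open>Q k (\<phi>)\<close> comes from the second-order
  regularity of the kernels, which makes \<open>x \<mapsto> Q k x\<close> continuous into the test functions.

  For (iii), write \<open>t = \<delta> powi k\<close>. If \<open>t \<le> 1\<close>, the cancellation of the kernel and the regularity of \<open>f\<close> bound
  \<open>Q k (f)\<close> by \<open>t powr b\<close> times the decay function of \<open>f\<close>. If \<open>t \<ge> 1\<close>, the cancellation of \<open>f\<close> and the regularity of
  the kernel bound it by \<open>t powr (- h)\<close> times a decay function at scale \<open>t\<close>, for any \<open>h\<close> below the
  decay exponent of \<open>f\<close>. The \<open>L^p\<close> norm of a decay function at scale \<open>t\<close> is at most a constant times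
  \<open>V t x0 powr (1 / p - 1)\<close>, so the weighted norms decay geometrically as \<open>k\<close> tends to infinity in either
  direction. The Triebel--Lizorkin case follows through \<open>B p (min p q) \<subseteq> F p q\<close>.\<close>

section \<open>Lebesgue quasi-norms\<close>

text \<open>Exponents below 1 are allowed, so the mixed quasi-norms need not be norms. Raising
  everything to the smaller of \<open>p\<close> and \<open>q\<close> leaves a comparison with ratio
  exponent at least 1, where Minkowski's inequality is available. Only finiteness has to be
  transferred, so inexact weights may be used. The thresholds in (iii) have separate origins. For
  \<open>p < 1\<close> the volumes of dyadic balls enter the L^p norm of a decay function with a
  positive power, so its decay exponent must exceed
  \<open>kappa = omega * max (1 / p - 1) 0\<close>. On coarse scales the volume costs
  \<open>t^kappa\<close> and the weight \<open>t^(- s)\<close> against a gain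
  \<open>t^(- h)\<close>, hence \<open>h > kappa - s\<close>; on fine scales the gain
  \<open>t^b\<close> must beat \<open>t^(- s)\<close>, hence \<open>b > s\<close>. Producing
  \<open>t^(- h)\<close> consumes \<open>h\<close> of the decay exponent of \<open>f\<close>, and
  \<open>h\<close> stays strictly below it so that an integrable function remains. The sigma-algebra
  is only known to contain the balls, so measurability of a continuous function rests on a countable
  dense set, supplied by the reference points.\<close>

lemma ennreal_powr_top [simp]: "ennreal_powr top a = top"
  by (simp add: ennreal_powr_def)

lemma ennreal_powr_ennreal: "0 \<le> r \<Longrightarrow> ennreal_powr (ennreal r) a = ennreal (r powr a)"
  by (simp add: ennreal_powr_def)

lemma ennreal_powr_0 [simp]: "ennreal_powr 0 a = 0"
  by (simp add: ennreal_powr_def)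

lemma ennreal_powr_mono:
  assumes "x \<le> y" "0 \<le> a"
  shows "ennreal_powr x a \<le> ennreal_powr y a"
proof (cases "y = \<infinity>")
  case False
  with assms obtain r s where "0 \<le> r" "0 \<le> s" "x = ennreal r" "y = ennreal s"
    by (metis ennreal_cases infinity_ennreal_def top.extremum_uniqueI)
  with assms show ?thesis
    by (auto simp: ennreal_powr_ennreal ennreal_le_iff intro!: powr_mono2 ennreal_leI)
qed simp

lemma ennreal_powr_mult:
  assumes "0 < a"
  shows "ennreal_powr (x * y) a = ennreal_powr x a * ennreal_powr y a"
proof (cases x; cases y)
  fix r s assume "0 \<le> r" "0 \<le> s" "x = ennreal r" "y = ennreal s"
  then show ?thesis
    by (simp add: ennreal_powr_ennreal powr_mult flip: ennreal_mult)
next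
  fix r assume *: "0 \<le> r" "x = ennreal r" "y = top"
  then show ?thesis
    by (cases "r = 0") (simp_all add: ennreal_powr_ennreal ennreal_mult_top)
next
  fix r assume *: "0 \<le> r" "y = ennreal r" "x = top"
  then show ?thesis
    by (cases "r = 0") (simp_all add: ennreal_powr_ennreal ennreal_top_mult)
next
  assume "x = top" "y = top"
  then show ?thesis
    by simp
qed

lemma ennreal_powr_powr:
  assumes "0 < a"
  shows "ennreal_powr (ennreal_powr x a) b = ennreal_powr x (a * b)"
  by (cases x) (use assms in \<open>simp_all add: ennreal_powr_ennreal powr_powr\<close>)

lemma ennreal_powr_1 [simp]: "ennreal_powr x 1 = x"
  by (cases x) (simp_all add: ennreal_powr_ennreal)

lemma ennreal_powr_inverse [simp]:
  assumes "0 < a"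
  shows "ennreal_powr (ennreal_powr x a) (1 / a) = x" "ennreal_powr (ennreal_powr x (1 / a)) a = x"
  using assms by (simp_all add: ennreal_powr_powr)

lemma ennreal_powr_add:
  assumes "0 < a" "0 < b"
  shows "ennreal_powr x (a + b) = ennreal_powr x a * ennreal_powr x b"
  by (cases x) (simp_all add: ennreal_powr_ennreal powr_add ennreal_mult)

lemma ennreal_powr_eq_top_iff [simp]: "ennreal_powr x a = top \<longleftrightarrow> x = top"
  by (auto simp: ennreal_powr_def)

lemma ennreal_powr_less_top_iff [simp]: "ennreal_powr x a < top \<longleftrightarrow> x < top"
  by (simp add: less_top[symmetric])

lemma ennreal_powr_eq_0_iff [simp]: "ennreal_powr x a = 0 \<longleftrightarrow> x = 0"
  by (cases x) (simp_all add: ennreal_powr_ennreal)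

lemma ennreal_powr_measurable [measurable]:
  assumes [measurable]: "f \<in> borel_measurable M"
  shows "(\<lambda>x. ennreal_powr (f x) a) \<in> borel_measurable M"
  unfolding ennreal_powr_def by measurable

section \<open>Sums over the integers as integrals, and sequence norms as Lebesgue norms\<close>

lemma nn_integral_count_space_int:
  fixes f :: "int \<Rightarrow> ennreal"
  shows "(\<integral>\<^sup>+k. f k \<partial>count_space UNIV) = (\<Sum>n. f (int_decode n))"
  by (subst nn_integral_bij_count_space[OF bij_int_decode, symmetric]) (rule nn_integral_count_space_nat)

lemma borel_measurable_nn_integral_count_space_int [measurable]:
  fixes g :: "int \<Rightarrow> 'a \<Rightarrow> ennreal"
  assumes [measurable]: "\<And>k. g k \<in> borel_measurable M"
  shows "(\<lambda>x. \<integral>\<^sup>+k. g k x \<partial>count_space UNIV) \<in> borel_measurable M"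
  unfolding nn_integral_count_space_int by measurable

text \<open>Passing from the unordered sums in \<open>weighted_lq_norm\<close> to the counting
  measure makes the integral versions of Hoelder and Tonelli apply to sums as well.\<close>

lemma infsum_eq_nn_integral_count_space:
  fixes f :: "int \<Rightarrow> ennreal"
  shows "infsum f UNIV = (\<integral>\<^sup>+k. f k \<partial>count_space UNIV)"
proof -
  have "(\<integral>\<^sup>+k. f k \<partial>count_space UNIV) = (\<Sum>n. f (int_decode n))"
    by (rule nn_integral_count_space_int)
  also have "\<dots> = infsum (\<lambda>n. f (int_decode n)) UNIV"
    by (intro sums_unique[symmetric] has_sum_imp_sums has_sum_infsum nonneg_summable_on_complete) simp
  also have "\<dots> = infsum f UNIV"
    by (rule infsum_reindex_bij_betw[OF bij_int_decode])
  finally show ?thesis by simp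
qed

text \<open>Only the empty set is null for the counting measure, so an essential supremum is a
  supremum.\<close>

lemma Lp_norm_count_space_infinity:
  "Lp_norm (count_space UNIV) \<infinity> f = (SUP k. f k)"
proof (rule antisym)
  show "Lp_norm (count_space UNIV) \<infinity> f \<le> (SUP k. f k)"
    unfolding Lp_norm_def by (auto intro!: esssup_I SUP_upper)
  show "(SUP k. f k) \<le> Lp_norm (count_space UNIV) \<infinity> f"
    using esssup_AE[of f "count_space UNIV"]
    by (auto simp: Lp_norm_def AE_count_space intro!: SUP_least)
qed

lemma Lp_norm_finite:
  assumes "0 < p"
  shows "Lp_norm M (ennreal p) f = ennreal_powr (\<integral>\<^sup>+x. ennreal_powr (f x) p \<partial>M) (1 / p)"
  using assms by (simp add: Lp_norm_def)

lemma Lp_norm_mono: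
  assumes "p \<noteq> \<infinity>" "\<And>x. f x \<le> g x"
  shows "Lp_norm M p f \<le> Lp_norm M p g"
  using assms by (auto simp: Lp_norm_def intro!: ennreal_powr_mono nn_integral_mono)

lemma Lp_norm_cmult:
  assumes "0 < p" "f \<in> borel_measurable M"
  shows "Lp_norm M (ennreal p) (\<lambda>x. c * f x) = c * Lp_norm M (ennreal p) f"
  using assms by (simp add: Lp_norm_finite ennreal_powr_mult nn_integral_cmult)

text \<open>Absorbing the weight into the sequence removes the parameters \<open>\<delta>\<close>
  and \<open>s\<close> from all later comparisons of norms.\<close>

lemma weighted_lq_norm_eq_Lp_norm:
  assumes "0 < q"
  shows "weighted_lq_norm \<delta> s q a =
    Lp_norm (count_space UNIV) q (\<lambda>k. ennreal (\<delta> powr (- (of_int k * s))) * a k)"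
proof (cases q)
  case (real r)
  with assms have "0 < r" by simp
  with real show ?thesis
    by (simp add: weighted_lq_norm_def Lp_norm_def infsum_eq_nn_integral_count_space ennreal_powr_mult
        ennreal_powr_ennreal powr_powr mult.assoc)
next
  case top
  then show ?thesis
    by (simp add: weighted_lq_norm_def Lp_norm_count_space_infinity[unfolded infinity_ennreal_def])
qed

text \<open>With \<open>S\<close> the sum of the \<open>a\<close>-th powers, every single term
  satisfies \<open>f^a <= S\<close>. Hence
  \<open>f^b = (f^a)^(b/a - 1) * f^a <= S^(b/a - 1) * f^a\<close>, and summation gives
  \<open>S^(b/a)\<close>. In \<open>ennreal\<close> the values 0 and infinity of \<open>S\<close>
  need no separate treatment.\<close>

lemma Lp_norm_count_space_antimono:
  fixes f :: "'k \<Rightarrow> ennreal"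
  assumes "0 < q" "q \<le> r"
  shows "Lp_norm (count_space UNIV) r f \<le> Lp_norm (count_space UNIV) q f"
proof (cases q)
  case top
  with assms show ?thesis by (simp add: top_unique)
next
  case (real a)
  with assms have a: "0 < a" by simp
  define S where "S = (\<integral>\<^sup>+k. ennreal_powr (f k) a \<partial>count_space UNIV)"
  have le_S: "ennreal_powr (f k) a \<le> S" for k
  proof -
    have "ennreal_powr (f k) a = (\<integral>\<^sup>+j. ennreal_powr (f j) a * indicator {k} j \<partial>count_space UNIV)"
      by (subst nn_integral_count_space'[of "{k}"]) (auto simp: indicator_def)
    also have "\<dots> \<le> S"
      unfolding S_def by (intro nn_integral_mono) (auto simp: indicator_def)
    finally show ?thesis .
  qed
  have norm_q: "Lp_norm (count_space UNIV) q f = ennreal_powr S (1 / a)"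
    using real a by (simp add: Lp_norm_finite S_def)
  show ?thesis
  proof (cases r)
    case top
    have "f k \<le> ennreal_powr S (1 / a)" for k
      using ennreal_powr_mono[OF le_S[of k], of "1 / a"] a by simp
    then show ?thesis
      using top Lp_norm_count_space_infinity[of f] by (auto simp: norm_q intro!: SUP_least)
  next
    case (real b)
    with \<open>q = ennreal a\<close> assms a have b: "a \<le> b" "0 < b"
      by (simp_all add: ennreal_le_iff2)
    show ?thesis
    proof (cases "a = b")
      case False
      with b have ab: "a < b" by simp
      have "ennreal_powr (f k) b \<le> ennreal_powr S (b / a - 1) * ennreal_powr (f k) a" for k
      proof -
        have "ennreal_powr (f k) b = ennreal_powr (f k) ((b - a) + a)" by simp
        also have "\<dots> = ennreal_powr (f k) (b - a) * ennreal_powr (f k) a"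
          using ab a by (intro ennreal_powr_add) auto
        also have "ennreal_powr (f k) (b - a) = ennreal_powr (ennreal_powr (f k) a) (b / a - 1)"
          using a by (simp add: ennreal_powr_powr right_diff_distrib)
        also have "\<dots> \<le> ennreal_powr S (b / a - 1)"
          using le_S a ab by (intro ennreal_powr_mono) (auto simp: field_simps)
        finally show ?thesis by (simp add: mult_right_mono)
      qed
      then have "(\<integral>\<^sup>+k. ennreal_powr (f k) b \<partial>count_space UNIV)
          \<le> (\<integral>\<^sup>+k. ennreal_powr S (b / a - 1) * ennreal_powr (f k) a \<partial>count_space UNIV)"
        by (intro nn_integral_mono)
      also have "\<dots> = ennreal_powr S (b / a - 1) * ennreal_powr S 1"
        by (simp add: nn_integral_cmult S_def)
      also have "\<dots> = ennreal_powr S (b / a)"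
        using a ab by (subst ennreal_powr_add[symmetric]) auto
      finally have "ennreal_powr (\<integral>\<^sup>+k. ennreal_powr (f k) b \<partial>count_space UNIV) (1 / b)
          \<le> ennreal_powr (ennreal_powr S (b / a)) (1 / b)"
        using b by (intro ennreal_powr_mono) auto
      also have "\<dots> = ennreal_powr S (1 / a)"
        using a b by (simp add: ennreal_powr_powr)
      finally show ?thesis
        using real b by (simp add: norm_q Lp_norm_finite)
    qed (use real \<open>q = ennreal a\<close> in simp)
  qed
qed

section \<open>Hoelder's inequality for nonnegative extended functions\<close>

text \<open>Young's inequality for \<open>f / x\<close> and \<open>g / y\<close>. The parameters
  will be the norms of the two factors, so that after integration the bracket becomes
  \<open>1 / a + 1 / b = 1\<close>.\<close>

lemma Youngs_inequality_ennreal: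
  assumes "1 < a" "1 < b" "1 / a + 1 / b = 1" "0 < x" "0 < y"
  shows "f * g \<le> ennreal (x * y) *
    (ennreal (1 / (a * x powr a)) * ennreal_powr f a + ennreal (1 / (b * y powr b)) * ennreal_powr g b)"
proof (cases "f = \<infinity> \<or> g = \<infinity>")
  case True
  have "ennreal (x * y) * (ennreal (1 / (a * x powr a)) * ennreal_powr f a
      + ennreal (1 / (b * y powr b)) * ennreal_powr g b) = top"
    using True assms by (auto simp: ennreal_mult_eq_top_iff)
  then show ?thesis by simp
next
  case False
  then obtain u v where uv: "0 \<le> u" "0 \<le> v" "f = ennreal u" "g = ennreal v"
    by (metis ennreal_cases infinity_ennreal_def)
  have "u / x * (v / y) \<le> (u / x) powr a / a + (v / y) powr b / b"
    using assms uv by (intro Youngs_inequality) auto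
  then have "u * v \<le> x * y * (1 / (a * x powr a) * u powr a + 1 / (b * y powr b) * v powr b)"
    using assms uv by (simp add: powr_divide divide_simps mult_ac split: if_splits)
  moreover have "ennreal (x * y) * (ennreal (1 / (a * x powr a)) * ennreal_powr f a
      + ennreal (1 / (b * y powr b)) * ennreal_powr g b) =
      ennreal (x * y * (1 / (a * x powr a) * u powr a + 1 / (b * y powr b) * v powr b))"
    using assms uv by (simp add: ennreal_powr_ennreal ennreal_mult[symmetric] ennreal_plus[symmetric] del: ennreal_plus)
  moreover have "f * g = ennreal (u * v)"
    using uv by (simp add: ennreal_mult)
  ultimately show ?thesis
    by (simp only: ennreal_leI)
qed

text \<open>One can divide by the norms only if both are positive and finite. If one vanishes, the
  product is zero almost everywhere; if neither vanishes and one is infinite, the right-hand side is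
  infinite.\<close>

lemma Holder_inequality_nn_integral:
  assumes ab: "1 < a" "1 < b" "1 / a + 1 / b = 1"
    and [measurable]: "f \<in> borel_measurable N" "g \<in> borel_measurable N"
  shows "(\<integral>\<^sup>+x. f x * g x \<partial>N) \<le>
    ennreal_powr (\<integral>\<^sup>+x. ennreal_powr (f x) a \<partial>N) (1 / a) *
    ennreal_powr (\<integral>\<^sup>+x. ennreal_powr (g x) b \<partial>N) (1 / b)"
proof -
  define X where "X = (\<integral>\<^sup>+x. ennreal_powr (f x) a \<partial>N)"
  define Y where "Y = (\<integral>\<^sup>+x. ennreal_powr (g x) b \<partial>N)"
  consider "X = 0 \<or> Y = 0" | "X \<noteq> 0" "Y \<noteq> 0" "X = \<infinity> \<or> Y = \<infinity>"
    | "X \<noteq> 0" "Y \<noteq> 0" "X \<noteq> \<infinity>" "Y \<noteq> \<infinity>" by blast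
  then show ?thesis
  proof cases
    case 1
    then have "AE x in N. f x * g x = 0"
      by (auto simp: X_def Y_def nn_integral_0_iff_AE)
    then have "(\<integral>\<^sup>+x. f x * g x \<partial>N) = 0"
      by (subst nn_integral_0_iff_AE) auto
    then show ?thesis by simp
  next
    case 2
    then have "ennreal_powr X (1 / a) * ennreal_powr Y (1 / b) = top"
      by (auto simp: ennreal_mult_eq_top_iff)
    then show ?thesis by (simp add: X_def Y_def)
  next
    case 3
    then obtain x y where xy: "0 < x" "0 < y" "X = ennreal x" "Y = ennreal y"
      by (metis ennreal_cases ennreal_0 infinity_ennreal_def less_eq_real_def)
    define x' y' where "x' = x powr (1 / a)" and "y' = y powr (1 / b)"
    have x'y': "0 < x'" "0 < y'" "x' powr a = x" "y' powr b = y"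
      using xy ab by (auto simp: x'_def y'_def powr_powr)
    have "(\<integral>\<^sup>+t. f t * g t \<partial>N) \<le> (\<integral>\<^sup>+t. ennreal (x' * y') *
        (ennreal (1 / (a * x' powr a)) * ennreal_powr (f t) a
          + ennreal (1 / (b * y' powr b)) * ennreal_powr (g t) b) \<partial>N)"
      by (intro nn_integral_mono Youngs_inequality_ennreal ab x'y')
    also have "\<dots> = ennreal (x' * y') * (ennreal (1 / (a * x)) * X + ennreal (1 / (b * y)) * Y)"
      by (simp add: nn_integral_cmult nn_integral_add X_def Y_def x'y')
    also have "ennreal (1 / (a * x)) * X + ennreal (1 / (b * y)) * Y = ennreal (1 / a + 1 / b)"
      using xy ab by (simp add: ennreal_mult[symmetric] ennreal_plus[symmetric] del: ennreal_plus)
    also have "ennreal (x' * y') * ennreal (1 / a + 1 / b) = ennreal_powr X (1 / a) * ennreal_powr Y (1 / b)"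
      using xy ab by (simp add: x'_def y'_def ennreal_powr_ennreal ennreal_mult)
    finally show ?thesis by (simp add: X_def Y_def)
  qed
qed

section \<open>Exchange of the Lebesgue and the sequence norm\<close>

text \<open>The integers are covered by two copies of the naturals; zero is counted twice, which is
  harmless for an upper bound.\<close>

lemma nn_integral_powr_abs_int_finite: "(\<integral>\<^sup>+k. ennreal (r powr \<bar>real_of_int k\<bar>) \<partial>count_space UNIV) < \<infinity>"
  if "0 < r" "r < 1"
proof -
  have "(\<integral>\<^sup>+k. ennreal (r powr \<bar>real_of_int k\<bar>) \<partial>count_space UNIV)
      \<le> (\<integral>\<^sup>+k. ennreal (r powr \<bar>real_of_int k\<bar>) * indicator (range int) k
          + ennreal (r powr \<bar>real_of_int k\<bar>) * indicator (range (\<lambda>n. - int n)) k \<partial>count_space UNIV)"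
  proof (intro nn_integral_mono)
    fix k :: int
    show "ennreal (r powr \<bar>real_of_int k\<bar>) \<le> ennreal (r powr \<bar>real_of_int k\<bar>) * indicator (range int) k
        + ennreal (r powr \<bar>real_of_int k\<bar>) * indicator (range (\<lambda>n. - int n)) k"
    proof (cases "0 \<le> k")
      case True
      then have "k \<in> range int" by (metis nonneg_int_cases rangeI)
      then show ?thesis by simp
    next
      case False
      then have "k \<in> range (\<lambda>n. - int n)"
        by (metis le_cases nonpos_int_cases rangeI)
      then show ?thesis by simp
    qed
  qed
  also have "\<dots> = (\<integral>\<^sup>+k\<in>range int. ennreal (r powr \<bar>real_of_int k\<bar>) \<partial>count_space UNIV)
      + (\<integral>\<^sup>+k\<in>range (\<lambda>n. - int n). ennreal (r powr \<bar>real_of_int k\<bar>) \<partial>count_space UNIV)"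
    by (rule nn_integral_add) auto
  also have "(\<integral>\<^sup>+k\<in>range int. ennreal (r powr \<bar>real_of_int k\<bar>) \<partial>count_space UNIV)
      = (\<integral>\<^sup>+n. ennreal (r powr \<bar>real_of_int (int n)\<bar>) \<partial>count_space UNIV)"
    by (subst nn_integral_bij_count_space[where g = int and B = "range int"])
       (auto simp: nn_integral_count_space_indicator bij_betw_def inj_on_def)
  also have "(\<integral>\<^sup>+k\<in>range (\<lambda>n. - int n). ennreal (r powr \<bar>real_of_int k\<bar>) \<partial>count_space UNIV)
      = (\<integral>\<^sup>+n. ennreal (r powr \<bar>real_of_int (- int n)\<bar>) \<partial>count_space UNIV)"
    by (subst nn_integral_bij_count_space[where g = "\<lambda>n. - int n" and B = "range (\<lambda>n. - int n)"])
       (auto simp: nn_integral_count_space_indicator bij_betw_def inj_on_def)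
  also have "(\<integral>\<^sup>+n. ennreal (r powr \<bar>real_of_int (int n)\<bar>) \<partial>count_space UNIV)
      + (\<integral>\<^sup>+n. ennreal (r powr \<bar>real_of_int (- int n)\<bar>) \<partial>count_space UNIV) =
      (\<Sum>n. ennreal (r ^ n)) + (\<Sum>n. ennreal (r ^ n))"
    using that by (simp add: nn_integral_count_space_nat powr_realpow)
  also have "(\<Sum>n. ennreal (r ^ n)) = ennreal (\<Sum>n. r ^ n)"
    using that by (intro suminf_ennreal2) (auto intro!: summable_geometric)
  finally show ?thesis
    by (metis ennreal_add_less_top ennreal_less_top infinity_ennreal_def order_le_less_trans)
qed

text \<open>The weights \<open>c k\<close> majorise the norms of the \<open>g k\<close> and are positive, so that one can divide by them.\<close>

lemma nn_integral_sum_powr_finite: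
  fixes g :: "int \<Rightarrow> 'a \<Rightarrow> ennreal"
  assumes a: "1 < a" and [measurable]: "\<And>k. g k \<in> borel_measurable M"
    and fin: "(\<integral>\<^sup>+k. ennreal_powr (\<integral>\<^sup>+x. ennreal_powr (g k x) a \<partial>M) (1 / a) \<partial>count_space UNIV) < \<infinity>"
  shows "(\<integral>\<^sup>+x. ennreal_powr (\<integral>\<^sup>+k. g k x \<partial>count_space UNIV) a \<partial>M) < \<infinity>"
proof -
  define n where "n = (\<lambda>k. ennreal_powr (\<integral>\<^sup>+x. ennreal_powr (g k x) a \<partial>M) (1 / a))"
  \<comment> \<open>The added term is positive and summable, so the weights become positive without
    losing the finiteness of their sum.\<close>
  define c where "c k = enn2real (n k) + (1 / 2) powr \<bar>real_of_int k\<bar>" for k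
  define b where "b = a / (a - 1)"
  have b: "1 < b" "1 / a + 1 / b = 1" "a / b = a - 1"
    using a by (auto simp: b_def field_simps)
  have "n k < \<infinity>" for k
  proof -
    have "n k = (\<integral>\<^sup>+j. n j * indicator {k} j \<partial>count_space UNIV)"
      by (subst nn_integral_count_space'[of "{k}"]) (auto simp: indicator_def)
    also have "\<dots> \<le> (\<integral>\<^sup>+j. n j \<partial>count_space UNIV)"
      by (intro nn_integral_mono) (auto simp: indicator_def)
    also have "\<dots> < \<infinity>"
      using fin by (simp add: n_def)
    finally show ?thesis .
  qed
  then have nk: "n k = ennreal (enn2real (n k))" for k
    by (simp add: less_top)
  have c: "0 < c k" for k
    by (auto simp: c_def intro!: add_nonneg_pos)
  have n_le_c: "n k \<le> ennreal (c k)" for k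
    by (subst nk) (auto simp: c_def intro!: ennreal_leI)
  define S where "S = (\<integral>\<^sup>+k. ennreal (c k) \<partial>count_space UNIV)"
  have "S = (\<integral>\<^sup>+k. n k + ennreal ((1 / 2) powr \<bar>real_of_int k\<bar>) \<partial>count_space UNIV)"
    unfolding S_def by (intro nn_integral_cong, subst nk) (simp add: c_def)
  also have "\<dots> < \<infinity>"
    using fin nn_integral_powr_abs_int_finite[of "1 / 2"]
    by (subst nn_integral_add) (auto simp: n_def)
  finally have S: "S < \<infinity>" .
  have int_g: "(\<integral>\<^sup>+x. ennreal_powr (g k x) a \<partial>M) \<le> ennreal (c k powr a)" for k
  proof -
    have "ennreal_powr (n k) a \<le> ennreal_powr (ennreal (c k)) a"
      using a by (intro ennreal_powr_mono n_le_c) auto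
    then show ?thesis
      using a c[of k] by (simp add: n_def ennreal_powr_ennreal)
  qed
  have "ennreal_powr (\<integral>\<^sup>+k. g k x \<partial>count_space UNIV) a \<le>
      ennreal_powr S (a - 1) * (\<integral>\<^sup>+k. ennreal (c k powr (1 - a)) * ennreal_powr (g k x) a \<partial>count_space UNIV)" for x
  proof -
    \<comment> \<open>With this splitting the first factor in Hoelder's inequality is
      \<open>S^(1/b)\<close>, which becomes \<open>S^(a - 1)\<close> after raising to the power
      \<open>a\<close>.\<close>
    have "g k x = ennreal (c k powr (1 / b)) * (ennreal (c k powr (- (1 / b))) * g k x)" for k
      using c[of k] by (simp add: mult.assoc[symmetric] ennreal_mult[symmetric] powr_add[symmetric])
    then have "(\<integral>\<^sup>+k. g k x \<partial>count_space UNIV) =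
        (\<integral>\<^sup>+k. ennreal (c k powr (1 / b)) * (ennreal (c k powr (- (1 / b))) * g k x) \<partial>count_space UNIV)"
      by presburger
    also have "\<dots> \<le> ennreal_powr S (1 / b) *
        ennreal_powr (\<integral>\<^sup>+k. ennreal_powr (ennreal (c k powr (- (1 / b))) * g k x) a \<partial>count_space UNIV) (1 / a)"
      using Holder_inequality_nn_integral[of b a "\<lambda>k. ennreal (c k powr (1 / b))" "count_space UNIV"
          "\<lambda>k. ennreal (c k powr (- (1 / b))) * g k x"] a b c
      by (simp add: S_def ennreal_powr_ennreal powr_powr less_imp_le add.commute)
    finally have "ennreal_powr (\<integral>\<^sup>+k. g k x \<partial>count_space UNIV) a \<le> ennreal_powr (ennreal_powr S (1 / b) *
        ennreal_powr (\<integral>\<^sup>+k. ennreal_powr (ennreal (c k powr (- (1 / b))) * g k x) a \<partial>count_space UNIV) (1 / a)) a"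
      using a by (intro ennreal_powr_mono) auto
    also have "\<dots> = ennreal_powr S (a - 1) *
        (\<integral>\<^sup>+k. ennreal (c k powr (1 - a)) * ennreal_powr (g k x) a \<partial>count_space UNIV)"
      using a b c by (simp add: ennreal_powr_mult ennreal_powr_powr ennreal_powr_ennreal powr_powr)
    finally show ?thesis .
  qed
  then have "(\<integral>\<^sup>+x. ennreal_powr (\<integral>\<^sup>+k. g k x \<partial>count_space UNIV) a \<partial>M) \<le> (\<integral>\<^sup>+x. ennreal_powr S (a - 1) *
      (\<integral>\<^sup>+k. ennreal (c k powr (1 - a)) * ennreal_powr (g k x) a \<partial>count_space UNIV) \<partial>M)"
    by (intro nn_integral_mono)
  also have "\<dots> = (\<integral>\<^sup>+x. (\<integral>\<^sup>+k. ennreal_powr S (a - 1) *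
      (ennreal (c k powr (1 - a)) * ennreal_powr (g k x) a) \<partial>count_space UNIV) \<partial>M)"
    by (simp add: nn_integral_cmult)
  also have "\<dots> = (\<integral>\<^sup>+k. (\<integral>\<^sup>+x. ennreal_powr S (a - 1) *
      (ennreal (c k powr (1 - a)) * ennreal_powr (g k x) a) \<partial>M) \<partial>count_space UNIV)"
    by (rule nn_integral_count_space_nn_integral) auto
  also have "\<dots> = (\<integral>\<^sup>+k. ennreal_powr S (a - 1) * (ennreal (c k powr (1 - a)) *
      (\<integral>\<^sup>+x. ennreal_powr (g k x) a \<partial>M)) \<partial>count_space UNIV)"
    by (simp add: nn_integral_cmult)
  also have "\<dots> \<le> (\<integral>\<^sup>+k. ennreal_powr S (a - 1) * ennreal (c k) \<partial>count_space UNIV)"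
  proof (intro nn_integral_mono mult_left_mono)
    fix k
    \<comment> \<open>The weight left over from Hoelder meets the bound \<open>c k powr a\<close> of
      the integral, and the two combine to \<open>c k\<close>, whose sum is
      \<open>S\<close>.\<close>
    have "ennreal (c k powr (1 - a)) * (\<integral>\<^sup>+x. ennreal_powr (g k x) a \<partial>M)
        \<le> ennreal (c k powr (1 - a)) * ennreal (c k powr a)"
      by (intro mult_left_mono int_g) auto
    also have "\<dots> = ennreal (c k)"
      using c[of k] by (simp add: ennreal_mult[symmetric] powr_add[symmetric])
    finally show "ennreal (c k powr (1 - a)) * (\<integral>\<^sup>+x. ennreal_powr (g k x) a \<partial>M) \<le> ennreal (c k)" .
  qed auto
  also have "\<dots> = ennreal_powr S (a - 1) * S"
    by (simp add: nn_integral_cmult S_def)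
  also have "\<dots> < \<infinity>"
    using S by (simp add: ennreal_mult_less_top)
  finally show ?thesis .
qed

text \<open>Duality, on finite sets of indices so that the left-hand side is known to be finite.\<close>

lemma sum_powr_nn_integral_finite:
  fixes g :: "int \<Rightarrow> 'a \<Rightarrow> ennreal"
  assumes a: "1 < a" and [measurable]: "\<And>k. g k \<in> borel_measurable M"
    and fin: "(\<integral>\<^sup>+x. ennreal_powr (\<integral>\<^sup>+k. ennreal_powr (g k x) a \<partial>count_space UNIV) (1 / a) \<partial>M) < \<infinity>"
  shows "(\<integral>\<^sup>+k. ennreal_powr (\<integral>\<^sup>+x. g k x \<partial>M) a \<partial>count_space UNIV) < \<infinity>"
proof -
  define m where "m k = (\<integral>\<^sup>+x. g k x \<partial>M)" for k
  define b where "b = a / (a - 1)"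
  have b: "1 < b" "1 / a + 1 / b = 1" "(a - 1) * b = a" "1 - 1 / b = 1 / a"
    using a by (auto simp: b_def field_simps)
  define H where "H x = ennreal_powr (\<integral>\<^sup>+k. ennreal_powr (g k x) a \<partial>count_space UNIV) (1 / a)" for x
  have g_le_H: "g k x \<le> H x" for k x
  proof -
    have "ennreal_powr (g k x) a = (\<integral>\<^sup>+j. ennreal_powr (g j x) a * indicator {k} j \<partial>count_space UNIV)"
      by (subst nn_integral_count_space'[of "{k}"]) (auto simp: indicator_def)
    also have "\<dots> \<le> (\<integral>\<^sup>+j. ennreal_powr (g j x) a \<partial>count_space UNIV)"
      by (intro nn_integral_mono) (auto simp: indicator_def)
    finally have "ennreal_powr (ennreal_powr (g k x) a) (1 / a) \<le> H x"
      unfolding H_def using a by (intro ennreal_powr_mono) auto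
    then show ?thesis using a by simp
  qed
  define I where "I = (\<integral>\<^sup>+x. H x \<partial>M)"
  have I: "I < \<infinity>" using fin by (simp add: I_def H_def)
  have m: "m k < \<infinity>" for k
    using le_less_trans[OF nn_integral_mono[of M "g k" H] I[unfolded I_def]] g_le_H
    by (auto simp: m_def)
  have "(\<Sum>k\<in>F. ennreal_powr (m k) a) \<le> ennreal_powr I a" if F: "finite F" for F
  proof -
    define S where "S = (\<Sum>k\<in>F. ennreal_powr (m k) a)"
    have S: "S < \<infinity>"
      using m F by (simp add: S_def less_top[symmetric])
    \<comment> \<open>The numbers \<open>m k\<close> to the power \<open>a - 1\<close> are the
      extremal dual sequence: since \<open>(a - 1) * b = a\<close>, its norm with exponent
      \<open>b\<close> is \<open>S^(1/b)\<close>.\<close>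
    have "S = (\<Sum>k\<in>F. ennreal_powr (m k) (a - 1) * m k)"
      using ennreal_powr_add[of "a - 1" 1] a by (simp add: S_def)
    also have "\<dots> = (\<integral>\<^sup>+x. (\<Sum>k\<in>F. ennreal_powr (m k) (a - 1) * g k x) \<partial>M)"
      by (subst nn_integral_sum) (auto simp: m_def nn_integral_cmult)
    also have "\<dots> \<le> (\<integral>\<^sup>+x. ennreal_powr S (1 / b) * H x \<partial>M)"
    proof (intro nn_integral_mono)
      fix x
      have "(\<Sum>k\<in>F. ennreal_powr (m k) (a - 1) * g k x) =
          (\<integral>\<^sup>+k. ennreal_powr (m k) (a - 1) * g k x \<partial>count_space F)"
        using F by (simp add: nn_integral_count_space_finite)
      also have "\<dots> \<le> ennreal_powr (\<integral>\<^sup>+k. ennreal_powr (ennreal_powr (m k) (a - 1)) b \<partial>count_space F) (1 / b) *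
          ennreal_powr (\<integral>\<^sup>+k. ennreal_powr (g k x) a \<partial>count_space F) (1 / a)"
        using a b by (intro Holder_inequality_nn_integral) auto
      also have "(\<integral>\<^sup>+k. ennreal_powr (ennreal_powr (m k) (a - 1)) b \<partial>count_space F) = S"
        using a b F by (simp add: ennreal_powr_powr nn_integral_count_space_finite S_def)
      also have "ennreal_powr S (1 / b) * ennreal_powr (\<integral>\<^sup>+k. ennreal_powr (g k x) a \<partial>count_space F) (1 / a)
          \<le> ennreal_powr S (1 / b) * H x"
        unfolding H_def using a
        by (intro mult_left_mono ennreal_powr_mono)
           (auto simp: nn_integral_count_space_indicator[of F] intro!: nn_integral_mono split: split_indicator)
      finally show "(\<Sum>k\<in>F. ennreal_powr (m k) (a - 1) * g k x) \<le> ennreal_powr S (1 / b) * H x" .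
    qed
    also have "\<dots> = ennreal_powr S (1 / b) * I"
      unfolding I_def H_def by (rule nn_integral_cmult) measurable
    finally have le: "S \<le> ennreal_powr S (1 / b) * I" .
    obtain r i where r: "0 \<le> r" "S = ennreal r" and i: "0 \<le> i" "I = ennreal i"
      using S I by (metis ennreal_cases infinity_ennreal_def less_irrefl)
    \<comment> \<open>Here the finiteness of \<open>S\<close> pays off: a positive \<open>r\<close>
      allows division by \<open>r powr (1 / b)\<close>, which leaves
      \<open>r powr (1 / a) <= i\<close>.\<close>
    have "r \<le> i powr a"
    proof (cases "r = 0")
      case False
      have "r \<le> r powr (1 / b) * i"
        using le r i by (simp add: ennreal_powr_ennreal ennreal_mult[symmetric] ennreal_le_iff)
      moreover have "r = r powr (1 / b) * r powr (1 / a)"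
        using False r by (simp add: powr_add[symmetric] b(2) add.commute[of "1 / b"])
      ultimately have "r powr (1 / b) * r powr (1 / a) \<le> r powr (1 / b) * i"
        by linarith
      then have "r powr (1 / a) \<le> i"
        using False r by simp
      then have "(r powr (1 / a)) powr a \<le> i powr a"
        using a by (intro powr_mono2) auto
      then show ?thesis
        using False r a by (simp add: powr_powr)
    qed simp
    then show ?thesis
      using r i by (simp add: S_def[symmetric] ennreal_powr_ennreal ennreal_leI)
  qed
  \<comment> \<open>A sum of nonnegative terms is the supremum of its finite partial sums, and the
    bound does not depend on \<open>F\<close>.\<close>
  then have "infsum (\<lambda>k. ennreal_powr (m k) a) UNIV \<le> ennreal_powr I a"
    by (subst nonneg_infsum_complete) (auto intro!: SUP_least)
  then show ?thesis
    using I le_less_trans[of _ "ennreal_powr I a" top]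
    by (simp add: infsum_eq_nn_integral_count_space m_def[symmetric])
qed

text \<open>For \<open>q < p\<close> the first integral estimate is applied to \<open>u^q\<close>
  with exponent \<open>p / q\<close>, for \<open>p < q\<close> the second one to \<open>u^p\<close>
  with exponent \<open>q / p\<close>; both exponents exceed 1. Equality of \<open>p\<close> and
  \<open>q\<close> is Tonelli's theorem, and for infinite \<open>q\<close> each \<open>u k x\<close>
  is at most the supremum over \<open>k\<close>.\<close>

lemma mixed_norm_finite_swap:
  fixes u :: "int \<Rightarrow> 'a \<Rightarrow> ennreal"
  assumes p: "0 < p" "p < \<infinity>" and q: "0 < q" and u[measurable]: "\<And>k. u k \<in> borel_measurable M"
  shows "q \<le> p \<Longrightarrow> Lp_norm (count_space UNIV) q (\<lambda>k. Lp_norm M p (u k)) < \<infinity> \<Longrightarrow>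
      Lp_norm M p (\<lambda>x. Lp_norm (count_space UNIV) q (\<lambda>k. u k x)) < \<infinity>"
    and "p \<le> q \<Longrightarrow> Lp_norm M p (\<lambda>x. Lp_norm (count_space UNIV) q (\<lambda>k. u k x)) < \<infinity> \<Longrightarrow>
      Lp_norm (count_space UNIV) q (\<lambda>k. Lp_norm M p (u k)) < \<infinity>"
proof -
  obtain a where a: "p = ennreal a" "0 < a"
    using p by (cases p) auto
  have eq: "(\<integral>\<^sup>+k. \<integral>\<^sup>+x. ennreal_powr (u k x) a \<partial>M \<partial>count_space UNIV) =
      (\<integral>\<^sup>+x. \<integral>\<^sup>+k. ennreal_powr (u k x) a \<partial>count_space UNIV \<partial>M)"
    by (rule nn_integral_count_space_nn_integral[symmetric]) auto
  {
    assume qp: "q \<le> p" and fin: "Lp_norm (count_space UNIV) q (\<lambda>k. Lp_norm M p (u k)) < \<infinity>"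
    obtain b where b: "q = ennreal b" "0 < b" "b \<le> a"
      using q qp a by (cases q) (auto simp: ennreal_le_iff top_unique)
    show "Lp_norm M p (\<lambda>x. Lp_norm (count_space UNIV) q (\<lambda>k. u k x)) < \<infinity>"
    proof (cases "a = b")
      case True
      have "Lp_norm (count_space UNIV) q (\<lambda>k. Lp_norm M p (u k)) =
          Lp_norm M p (\<lambda>x. Lp_norm (count_space UNIV) q (\<lambda>k. u k x))"
        unfolding a(1) b(1) True[symmetric] Lp_norm_finite[OF a(2)] ennreal_powr_inverse(2)[OF a(2)] eq ..
      with fin show ?thesis by simp
    next
      case False
      with b a have "1 < a / b" by simp
      from nn_integral_sum_powr_finite[OF this, of "\<lambda>k x. ennreal_powr (u k x) b" M] fin
      show ?thesis
        using a b by (simp add: Lp_norm_finite ennreal_powr_powr)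
    qed
  next
    assume pq: "p \<le> q" and fin: "Lp_norm M p (\<lambda>x. Lp_norm (count_space UNIV) q (\<lambda>k. u k x)) < \<infinity>"
    show "Lp_norm (count_space UNIV) q (\<lambda>k. Lp_norm M p (u k)) < \<infinity>"
    proof (cases q)
      case top
      have "Lp_norm M p (u k) \<le> Lp_norm M p (\<lambda>x. Lp_norm (count_space UNIV) q (\<lambda>k. u k x))" for k
        using p top by (intro Lp_norm_mono) (auto simp: Lp_norm_count_space_infinity[unfolded infinity_ennreal_def] intro: SUP_upper)
      then show ?thesis
        unfolding top Lp_norm_count_space_infinity[unfolded infinity_ennreal_def]
        by (rule le_less_trans[OF SUP_least fin[unfolded top Lp_norm_count_space_infinity[unfolded infinity_ennreal_def]]])
    next
      case (real b)
      with pq a have b: "0 < b" "a \<le> b" by (auto simp: ennreal_le_iff2)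
      show ?thesis
      proof (cases "a = b")
        case True
        have "Lp_norm (count_space UNIV) q (\<lambda>k. Lp_norm M p (u k)) =
            Lp_norm M p (\<lambda>x. Lp_norm (count_space UNIV) q (\<lambda>k. u k x))"
          unfolding a(1) real True[symmetric] Lp_norm_finite[OF a(2)] ennreal_powr_inverse(2)[OF a(2)] eq ..
        with fin show ?thesis by simp
      next
        case False
        with b a have "1 < b / a" by simp
        from sum_powr_nn_integral_finite[OF this, of "\<lambda>k x. ennreal_powr (u k x) a" M] fin
        show ?thesis
          using a b real by (simp add: Lp_norm_finite ennreal_powr_powr)
      qed
    qed
  }
qed

section \<open>Volumes of balls and the decay functions\<close>

context homogeneous_type_space
begin

abbreviation V :: "real \<Rightarrow> 'a \<Rightarrow> real" where
  "V \<equiv> vol M d"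

abbreviation \<omega> :: real where
  "\<omega> \<equiv> upper_dim Cmu"

lemma d_self [simp]: "d x x = 0"
  by (simp add: d_zero_iff)

lemma A0_pos: "0 < A0"
  using A0_ge_1 by simp

lemma qball_empty: "r \<le> 0 \<Longrightarrow> qball d x r = {}"
  by (auto simp: qball_def not_less intro: order_trans[OF _ d_nonneg])

lemma qball_sets [measurable]: "qball d x r \<in> sets M"
  using ball_measurable[of r x] qball_empty[of r x] by (cases "0 < r") auto

lemma qball_fmeasurable: "qball d x r \<in> fmeasurable M"
  using ball_finite[of r x] qball_empty[of r x] by (cases "0 < r") (auto intro!: fmeasurableI)

lemma emeasure_qball: "emeasure M (qball d x r) = ennreal (V r x)"
  using qball_fmeasurable[of x r]
  by (auto simp: vol_def fmeasurable_def intro!: emeasure_eq_ennreal_measure)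

lemma V_pos: "0 < r \<Longrightarrow> 0 < V r x"
  using ball_pos[of r x] unfolding emeasure_qball by simp

lemma V_nonneg [simp]: "0 \<le> V r x"
  by (simp add: vol_def)

lemma V_mono_ball: "qball d x r \<subseteq> qball d y R \<Longrightarrow> V r x \<le> V R y"
  unfolding vol_def by (intro measure_mono_fmeasurable qball_sets qball_fmeasurable)

lemma V_mono: "r \<le> R \<Longrightarrow> V r x \<le> V R x"
  by (intro V_mono_ball) (auto simp: qball_def)

lemma V_shift:
  assumes "A0 * (r + d x y) \<le> R"
  shows "V r x \<le> V R y"
proof (intro V_mono_ball subsetI)
  fix w assume "w \<in> qball d x r"
  then have "A0 * (d y x + d x w) < A0 * (r + d x y)"
    using A0_pos by (simp add: qball_def d_sym[of y x])
  then show "w \<in> qball d y R"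
    using assms d_triangle[of y w x] by (simp add: qball_def)
qed

lemma Cmu_ge_1: "1 \<le> Cmu"
proof -
  fix x :: 'a
  have "V 1 x \<le> V 2 x" by (rule V_mono) simp
  also have "\<dots> \<le> Cmu * V 1 x" using doubling[of 1 x] by (simp add: vol_def)
  finally show ?thesis using V_pos[of 1 x] by simp
qed

lemma dim_nonneg: "0 \<le> \<omega>"
  using Cmu_ge_1 by (simp add: upper_dim_def)

lemma Cmu_eq: "Cmu = 2 powr \<omega>"
  using Cmu_ge_1 by (simp add: upper_dim_def)

lemma V_doubling_iterated:
  assumes "0 < r"
  shows "V (2 ^ n * r) x \<le> Cmu ^ n * V r x"
proof (induction n)
  case (Suc n)
  have "V (2 ^ Suc n * r) x \<le> Cmu * V (2 ^ n * r) x"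
    using doubling[of "2 ^ n * r" x] assms by (simp add: vol_def mult.assoc)
  also have "\<dots> \<le> Cmu * (Cmu ^ n * V r x)"
    using Suc Cmu_ge_1 by (intro mult_left_mono) auto
  finally show ?case by (simp add: mult.assoc)
qed simp

text \<open>Doubling is iterated \<open>n\<close> times, where \<open>n\<close> is the binary
  logarithm of \<open>R / r\<close> rounded up. The rounding costs at most one extra doubling, hence
  the factor \<open>Cmu\<close>.\<close>

lemma V_growth:
  assumes "0 < r" "r \<le> R"
  shows "V R x \<le> Cmu * (R / r) powr \<omega> * V r x"
proof -
  define l where "l = log 2 (R / r)"
  define n where "n = nat \<lceil>l\<rceil>"
  have l: "0 \<le> l" "2 powr l = R / r"
    using assms by (auto simp: l_def)
  have n: "l \<le> real n" "real n \<le> l + 1"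
    using l(1) unfolding n_def by linarith+
  have "R / r \<le> 2 ^ n"
    using n(1) l(2)[symmetric] by (simp add: powr_realpow[symmetric])
  then have "V R x \<le> V (2 ^ n * r) x"
    using assms by (intro V_mono) (simp add: field_simps)
  also have "\<dots> \<le> Cmu ^ n * V r x"
    by (rule V_doubling_iterated) fact
  also have "Cmu ^ n = 2 powr (\<omega> * real n)"
    by (subst Cmu_eq) (simp add: powr_powr[symmetric] powr_realpow)
  also have "\<dots> \<le> 2 powr (\<omega> * (l + 1))"
    using n(2) dim_nonneg by (intro powr_mono mult_left_mono) auto
  also have "\<dots> = 2 powr \<omega> * (2 powr l) powr \<omega>"
    by (simp add: powr_powr algebra_simps powr_add)
  also have "\<dots> = Cmu * (R / r) powr \<omega>"
    by (simp only: Cmu_eq[symmetric] l(2))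
  finally show ?thesis by (simp add: mult_right_mono)
qed

section \<open>Decay functions and their comparison\<close>

text \<open>Comparable to the volume of the ball around \<open>x\<close> of radius
  \<open>t + d x y\<close>; the sum of two volumes is the form used in the test function
  norms.\<close>

definition mass :: "real \<Rightarrow> 'a \<Rightarrow> 'a \<Rightarrow> real" where
  "mass t x y = V t x + vol_between M d x y"

text \<open>The weight of the test function norms with the scale 1 replaced by \<open>t\<close> and
  the centre \<open>x0\<close> by \<open>x\<close>. Kernels of level \<open>k\<close> are measured
  with \<open>t = \<delta> powi k\<close>.\<close>

definition decay :: "real \<Rightarrow> 'a \<Rightarrow> real \<Rightarrow> 'a \<Rightarrow> real" where
  "decay t x \<gamma> y = 1 / mass t x y * (1 + d x y / t) powr (- \<gamma>)"

lemma test_decay_eq: "test_decay M d x0 \<gamma> y = decay 1 x0 \<gamma> y"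
  by (simp add: test_decay_def decay_def mass_def)

lemma vol_between_eq: "vol_between M d x y = V (d x y) x"
  by (simp add: vol_between_def vol_def)

lemma mass_ge_V: "V t x \<le> mass t x y" "V (d x y) x \<le> mass t x y"
  by (simp_all add: mass_def vol_between_eq)

lemma mass_pos: "0 < t \<Longrightarrow> 0 < mass t x y"
  using mass_ge_V(1)[of t x y] V_pos[of t x] by linarith

lemma decay_pos: "0 < t \<Longrightarrow> 0 < decay t x \<gamma> y"
  using mass_pos[of t x y] add_pos_nonneg[of 1 "d x y / t"] d_nonneg[of x y] by (simp add: decay_def)

lemma decay_nonneg [simp]: "0 < t \<Longrightarrow> 0 \<le> decay t x \<gamma> y"
  using decay_pos by (rule less_imp_le)

lemma decay_le_inverse_V:
  assumes "0 < t" "0 \<le> \<gamma>"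
  shows "decay t x \<gamma> y \<le> 1 / V t x"
proof -
  have "decay t x \<gamma> y \<le> 1 / V t x * 1"
    unfolding decay_def using assms mass_ge_V(1)[of t x y] V_pos[of t x] d_nonneg[of x y]
    by (intro mult_mono frac_le) (auto simp: powr_minus inverse_le_1_iff ge_one_powr_ge_zero)
  then show ?thesis by simp
qed

lemma decay_antimono:
  assumes "0 < t" "\<gamma> \<le> \<gamma>'"
  shows "decay t x \<gamma>' y \<le> decay t x \<gamma> y"
  unfolding decay_def using assms mass_pos[of t x y] d_nonneg[of x y]
  by (intro mult_left_mono powr_mono) auto

lemma decay_absorb_powr:
  assumes "0 < t" "0 \<le> b"
  shows "(d x y / t) powr b * decay t x \<gamma> y \<le> decay t x (\<gamma> - b) y"
proof -
  have "(d x y / t) powr b * decay t x \<gamma> y \<le> (1 + d x y / t) powr b * decay t x \<gamma> y"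
    using assms d_nonneg[of x y] by (intro mult_right_mono powr_mono2) auto
  also have "\<dots> = decay t x (\<gamma> - b) y"
    by (simp add: decay_def powr_add[symmetric])
  finally show ?thesis .
qed

text \<open>The leading 2 counts the two volumes in \<open>mass\<close>. In the dilation factor,
  \<open>A0\<close> is the price of moving the centre and 2 that of replacing
  \<open>t + d x y\<close> by the larger summand; \<open>Cmu\<close> comes from the rounding in
  \<open>V_growth\<close>.\<close>

definition mass_const :: "real \<Rightarrow> real" where
  "mass_const \<Lambda> = 2 * Cmu * (2 * A0 * \<Lambda>) powr \<omega>"

text \<open>Both masses behave like the volume of one ball. The hypothesis bounds the radius at
  \<open>x'\<close>, plus the distance of the centres, by a multiple of the radius at
  \<open>x\<close>, so after a shift of the centre a dilated ball at \<open>x\<close> contains the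
  other.\<close>

lemma mass_compare:
  assumes t: "0 < t" "0 < t'" and L: "1 \<le> \<Lambda>" and le: "t' + d x' y' + d x x' \<le> \<Lambda> * (t + d x y)"
  shows "mass t' x' y' \<le> mass_const \<Lambda> * mass t x y"
proof -
  \<comment> \<open>The maximum, rather than the sum, makes \<open>V m x\<close> literally one of
    the two summands of \<open>mass t x y\<close>.\<close>
  define m where "m = max t (d x y)"
  have m: "0 < m" "t + d x y \<le> 2 * m"
    using t by (auto simp: m_def)
  have "1 \<le> A0 * \<Lambda>"
    using A0_ge_1 L mult_mono[of 1 A0 1 \<Lambda>] by simp
  have "A0 * ((t' + d x' y') + d x' x) \<le> A0 * (\<Lambda> * (2 * m))"
    using le m L A0_ge_1 d_sym[of x x'] by (intro mult_left_mono order_trans[OF _ mult_left_mono[OF m(2)]]) auto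
  then have shift: "A0 * ((t' + d x' y') + d x' x) \<le> 2 * A0 * \<Lambda> * m"
    by (simp add: mult_ac)
  have "mass t' x' y' \<le> 2 * V (t' + d x' y') x'"
    using V_mono[of t' "t' + d x' y'" x'] V_mono[of "d x' y'" "t' + d x' y'" x'] t d_nonneg[of x' y']
    by (simp add: mass_def vol_between_eq)
  also have "\<dots> \<le> 2 * V (2 * A0 * \<Lambda> * m) x"
    using V_shift[OF shift] by simp
  also have "\<dots> \<le> 2 * (Cmu * (2 * A0 * \<Lambda> * m / m) powr \<omega> * V m x)"
    using m \<open>1 \<le> A0 * \<Lambda>\<close> by (intro mult_left_mono V_growth) auto
  also have "\<dots> = mass_const \<Lambda> * V m x"
    using m by (simp add: mass_const_def)
  also have "\<dots> \<le> mass_const \<Lambda> * mass t x y"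
    using mass_ge_V[where t=t and x=x and y=y] Cmu_ge_1
    by (intro mult_left_mono) (auto simp: m_def max_def mass_const_def)
  finally show ?thesis .
qed

lemma mass_const_pos: "1 \<le> \<Lambda> \<Longrightarrow> 0 < mass_const \<Lambda>"
  using Cmu_ge_1 A0_ge_1 by (simp add: mass_const_def)

lemma inverse_mass_compare:
  assumes "0 < t" "0 < t'" "1 \<le> \<Lambda>" "t' + d x' y' + d x x' \<le> \<Lambda> * (t + d x y)"
  shows "1 / mass t x y \<le> mass_const \<Lambda> * (1 / mass t' x' y')"
  using mass_compare[OF assms] assms mass_pos[of t x y] mass_pos[of t' x' y']
  by (simp add: field_simps)

text \<open>Two constants are kept apart because the two factors are compared differently:
  \<open>\<Lambda>\<close> compares absolute radii, for the volumes, while \<open>B\<close> compares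
  distances relative to the scales \<open>t\<close> and \<open>t'\<close>, for the powers.\<close>

lemma decay_compare:
  assumes t: "0 < t" "0 < t'" and L: "1 \<le> \<Lambda>" and le: "t' + d x' y' + d x x' \<le> \<Lambda> * (t + d x y)"
    and g: "0 \<le> \<gamma>" and B: "0 < B" "1 + d x' y' / t' \<le> B * (1 + d x y / t)"
  shows "decay t x \<gamma> y \<le> mass_const \<Lambda> * B powr \<gamma> * decay t' x' \<gamma> y'"
proof -
  have pos: "0 < 1 + d x y / t" "0 < 1 + d x' y' / t'"
    using t d_nonneg by (auto intro!: add_pos_nonneg)
  have "(1 + d x y / t) powr (- \<gamma>) = B powr \<gamma> * (B * (1 + d x y / t)) powr (- \<gamma>)"
    using B pos by (simp add: powr_mult powr_minus)
  also have "\<dots> \<le> B powr \<gamma> * (1 + d x' y' / t') powr (- \<gamma>)"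
    using B pos g by (intro mult_left_mono powr_mono2') auto
  finally have "1 / mass t x y * (1 + d x y / t) powr (- \<gamma>) \<le>
      (mass_const \<Lambda> * (1 / mass t' x' y')) * (B powr \<gamma> * (1 + d x' y' / t') powr (- \<gamma>))"
    using inverse_mass_compare[OF t L le] mass_pos[of t x y] mass_pos[of t' x' y'] t mass_const_pos[OF L]
    by (intro mult_mono) auto
  then show ?thesis
    by (simp add: decay_def mult_ac)
qed

text \<open>Take the least \<open>j\<close> whose ball contains \<open>y\<close>. If
  \<open>j > 0\<close>, the previous ball misses \<open>y\<close>, so \<open>d x y\<close> is at
  least half the radius: the volume loses one doubling and the power a factor
  \<open>2 powr \<gamma>\<close>. If \<open>j = 0\<close>, the bound by the inverse volume
  suffices.\<close>

lemma decay_dyadic: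
  assumes t: "0 < t" and g: "0 \<le> \<gamma>"
  obtains j :: nat where "y \<in> qball d x (2 ^ j * t)"
    "decay t x \<gamma> y \<le> Cmu * 2 powr \<gamma> / V (2 ^ j * t) x * 2 powr (- (\<gamma> * j))"
proof -
  have "\<exists>j. d x y < 2 ^ j * t"
    using real_arch_pow[of 2 "d x y / t"] t by (simp add: field_simps)
  then obtain j where j: "d x y < 2 ^ j * t" "\<And>i. i < j \<Longrightarrow> \<not> d x y < 2 ^ i * t"
    using exists_least_iff[of "\<lambda>j. d x y < 2 ^ j * t"] by blast
  have "decay t x \<gamma> y \<le> Cmu * 2 powr \<gamma> / V (2 ^ j * t) x * 2 powr (- (\<gamma> * j))"
  proof (cases j)
    case 0
    have "1 * 1 \<le> Cmu * 2 powr \<gamma>"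
      using Cmu_ge_1 g by (intro mult_mono ge_one_powr_ge_zero) auto
    then show ?thesis
      using 0 decay_le_inverse_V[OF t g, of x y] V_pos[OF t, of x]
      by (auto intro: order_trans simp: divide_right_mono)
  next
    case (Suc i)
    have ge: "2 ^ i * t \<le> d x y"
      using j(2)[of i] Suc by simp
    have "V (2 ^ j * t) x \<le> Cmu * V (2 ^ i * t) x"
      using doubling[of "2 ^ i * t" x] t Suc by (simp add: vol_def mult.assoc)
    also have "V (2 ^ i * t) x \<le> mass t x y"
      using V_mono[OF ge, of x] mass_ge_V(2)[where t=t and x=x and y=y] by linarith
    finally have "V (2 ^ j * t) x \<le> Cmu * mass t x y"
      using Cmu_ge_1 by simp
    then have "1 / mass t x y \<le> Cmu / V (2 ^ j * t) x"
      using mass_pos[OF t, of x y] V_pos[of "2 ^ j * t" x] t by (simp add: field_simps)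
    moreover have "(1 + d x y / t) powr (- \<gamma>) \<le> (2 ^ i) powr (- \<gamma>)"
      using ge t g by (intro powr_mono2') (auto simp: field_simps)
    ultimately have "decay t x \<gamma> y \<le> Cmu / V (2 ^ j * t) x * (2 ^ i) powr (- \<gamma>)"
      unfolding decay_def using Cmu_ge_1 by (intro mult_mono) auto
    also have "(2 ^ i) powr (- \<gamma>) = 2 powr \<gamma> * 2 powr (- (\<gamma> * j))"
      using Suc by (simp add: powr_realpow[symmetric] powr_powr powr_add[symmetric] algebra_simps)
    finally show ?thesis by simp
  qed
  with j(1) show ?thesis
    by (intro that[of j]) (auto simp: qball_def)
qed

section \<open>Integrals and Lebesgue norms of decay functions\<close>

text \<open>The dyadic ball of index \<open>j\<close> contributes about
  \<open>2^(- \<gamma> p j)\<close> times its volume to the power \<open>1 - p\<close>. For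
  \<open>p <= 1\<close> doubling bounds the latter by \<open>2^(\<omega> (1 - p) j)\<close> times
  the power at scale \<open>t\<close>; for \<open>p > 1\<close> monotonicity of the volume suffices.
  The series is then geometric, uniformly in centre and scale.\<close>

lemma nn_integral_decay_powr:
  assumes p: "0 < p" and g: "\<omega> * max (1 / p - 1) 0 < \<gamma>"
  shows "\<exists>C\<ge>0. \<forall>t>0. \<forall>x. (\<integral>\<^sup>+y. ennreal (decay t x \<gamma> y powr p) \<partial>M) \<le> ennreal (C * V t x powr (1 - p))"
proof -
  have g0: "0 < \<gamma>"
    using g dim_nonneg by (smt (verit) mult_nonneg_nonneg)
  \<comment> \<open>The logarithm of the ratio of the geometric series; its negativity is the
    hypothesis on \<open>\<gamma>\<close> multiplied by \<open>p\<close>.\<close>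
  define e where "e = \<omega> * max (1 - p) 0 - \<gamma> * p"
  have "p * (\<omega> * max (1 / p - 1) 0) < p * \<gamma>"
    using g p by simp
  moreover have "p * max (1 / p - 1) 0 = max (1 - p) 0"
    using p by (auto simp: max_def field_simps)
  ultimately have e: "e < 0"
    unfolding e_def mult.left_commute[of p \<omega>] by (simp add: mult.commute)
  define r where "r = 2 powr e"
  have "2 powr e < 2 powr (0::real)"
    using e by (intro powr_less_mono) auto
  then have r: "0 < r" "r < 1"
    by (auto simp: r_def)
  define K where "K = (Cmu * 2 powr \<gamma>) powr p"
  have "(\<integral>\<^sup>+y. ennreal (decay t x \<gamma> y powr p) \<partial>M) \<le> ennreal (K / (1 - r) * V t x powr (1 - p))"
    if t: "0 < t" for t x
  proof -
    define a where "a j = V (2 ^ j * t) x" for j :: nat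
    have a: "0 < a j" for j
      using t by (auto simp: a_def intro!: V_pos)
    define b where "b j = (Cmu * 2 powr \<gamma> / a j * 2 powr (- (\<gamma> * j))) powr p" for j :: nat
    have term_le: "b j * a j \<le> K * V t x powr (1 - p) * r ^ j" for j
    proof -
      have "b j * a j = K * 2 powr (- (\<gamma> * j) * p) * a j powr (1 - p)"
        using a[of j] Cmu_ge_1
        by (simp add: b_def K_def powr_mult powr_divide powr_powr powr_diff field_simps)
      also have "a j powr (1 - p) \<le> V t x powr (1 - p) * 2 powr (\<omega> * max (1 - p) 0 * j)"
      proof (cases "p \<le> 1")
        case True
        have "a j \<le> V t x * 2 powr (\<omega> * j)"
          using V_doubling_iterated[OF t, of j x] Cmu_ge_1
          by (simp add: a_def mult.commute powr_powr[symmetric] powr_realpow Cmu_eq[symmetric])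
        then have "a j powr (1 - p) \<le> (V t x * 2 powr (\<omega> * j)) powr (1 - p)"
          using True a[of j] by (intro powr_mono2) auto
        then show ?thesis
          using True by (simp add: powr_mult powr_powr mult_ac)
      next
        case False
        have "V t x \<le> a j"
          using t by (auto simp: a_def intro!: V_mono)
        then have "a j powr (1 - p) \<le> V t x powr (1 - p)"
          using False V_pos[OF t] by (intro powr_mono2') auto
        then show ?thesis
          using False by simp
      qed
      finally have "b j * a j \<le> K * 2 powr (- (\<gamma> * j) * p) * (V t x powr (1 - p) * 2 powr (\<omega> * max (1 - p) 0 * j))"
        by (simp add: K_def mult_left_mono)
      also have "\<dots> = K * V t x powr (1 - p) * r ^ j"
        by (simp add: r_def e_def powr_realpow[symmetric] powr_powr powr_add[symmetric] algebra_simps)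
      finally show ?thesis .
    qed
    have "ennreal (decay t x \<gamma> y powr p) \<le> (\<Sum>j. ennreal (b j) * indicator (qball d x (2 ^ j * t)) y)" for y
    proof -
      obtain j :: nat where j: "y \<in> qball d x (2 ^ j * t)"
        "decay t x \<gamma> y \<le> Cmu * 2 powr \<gamma> / V (2 ^ j * t) x * 2 powr (- (\<gamma> * j))"
        using decay_dyadic[OF t less_imp_le[OF g0], of y x] by metis
      then have "decay t x \<gamma> y powr p \<le> b j"
        using p t unfolding b_def a_def by (intro powr_mono2) auto
      then have "ennreal (decay t x \<gamma> y powr p) \<le> ennreal (b j) * indicator (qball d x (2 ^ j * t)) y"
        using j(1) by (simp add: ennreal_leI)
      also have "\<dots> \<le> (\<Sum>j. ennreal (b j) * indicator (qball d x (2 ^ j * t)) y)"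
        using ennreal_suminf_lessD[of "\<lambda>j. ennreal (b j) * indicator (qball d x (2 ^ j * t)) y" _ j]
        by (meson linorder_not_less order_less_irrefl)
      finally show ?thesis .
    qed
    then have "(\<integral>\<^sup>+y. ennreal (decay t x \<gamma> y powr p) \<partial>M) \<le>
        (\<integral>\<^sup>+y. (\<Sum>j. ennreal (b j) * indicator (qball d x (2 ^ j * t)) y) \<partial>M)"
      by (intro nn_integral_mono)
    also have "\<dots> = (\<Sum>j. ennreal (b j * a j))"
      by (subst nn_integral_suminf)
         (auto simp: nn_integral_cmult emeasure_qball a_def ennreal_mult b_def)
    also have "\<dots> \<le> (\<Sum>j. ennreal (K * V t x powr (1 - p) * r ^ j))"
      by (intro suminf_le ennreal_leI term_le) auto
    also have "\<dots> = ennreal (\<Sum>j. K * V t x powr (1 - p) * r ^ j)"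
      using r by (intro suminf_ennreal2) (auto simp: K_def intro!: summable_mult summable_geometric)
    also have "(\<Sum>j. K * V t x powr (1 - p) * r ^ j) = K / (1 - r) * V t x powr (1 - p)"
      using r by (simp add: suminf_mult suminf_geometric summable_geometric)
    finally show ?thesis .
  qed
  moreover have "0 \<le> K / (1 - r)"
    using r by (simp add: K_def)
  ultimately show ?thesis by blast
qed

lemma d_measurable [measurable]: "d x \<in> borel_measurable M"
proof (rule borel_measurableI_less)
  fix r
  have "{y \<in> space M. d x y < r} = qball d x r"
    by (simp add: qball_def space_UNIV)
  then show "{y \<in> space M. d x y < r} \<in> sets M"
    by simp
qed

text \<open>A function of the distance alone: the volume is monotone in the radius, hence
  Borel.\<close>

lemma decay_measurable [measurable]: "decay t x \<gamma> \<in> borel_measurable M"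
proof -
  have [measurable]: "(\<lambda>r. V r x) \<in> borel_measurable borel"
    by (intro borel_measurable_mono monoI V_mono)
  show ?thesis
    unfolding decay_def mass_def vol_between_eq by measurable
qed

lemma decay_integrable:
  assumes "0 < \<gamma>" "0 < t"
  shows "integrable M (decay t x \<gamma>)"
proof -
  obtain C where "\<And>t x. 0 < t \<Longrightarrow> (\<integral>\<^sup>+y. ennreal (decay t x \<gamma> y powr 1) \<partial>M) \<le> ennreal (C * V t x powr (1 - 1))"
    using nn_integral_decay_powr[of 1 \<gamma>] assms by auto
  from this[of t x] have "(\<integral>\<^sup>+y. ennreal (decay t x \<gamma> y) \<partial>M) < \<infinity>"
    using assms by (auto intro: le_less_trans)
  then show ?thesis
    using assms by (intro integrableI_nonneg) auto
qed

lemma decay_integral_bounded: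
  assumes "0 < \<gamma>"
  shows "\<exists>C\<ge>0. \<forall>t>0. \<forall>x. (\<integral>y. decay t x \<gamma> y \<partial>M) \<le> C"
proof -
  obtain C where C: "0 \<le> C" "\<And>t x. 0 < t \<Longrightarrow> (\<integral>\<^sup>+y. ennreal (decay t x \<gamma> y powr 1) \<partial>M) \<le> ennreal (C * V t x powr (1 - 1))"
    using nn_integral_decay_powr[of 1 \<gamma>] assms by auto
  have "(\<integral>y. decay t x \<gamma> y \<partial>M) \<le> C" if t: "0 < t" for t x
  proof -
    have "ennreal (\<integral>y. decay t x \<gamma> y \<partial>M) \<le> ennreal C"
      using C(2)[OF t, of x] t V_pos[OF t, of x] decay_integrable[OF assms t, of x]
      by (subst nn_integral_eq_integral[symmetric]) auto
    then show ?thesis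
      using C(1) by (simp add: ennreal_le_iff)
  qed
  with C(1) show ?thesis by blast
qed

text \<open>Writing the exponent as \<open>enn2real (1 / p)\<close> covers infinite
  \<open>p\<close>, since \<open>1 / p\<close> is then 0: the required decay is
  \<open>0 < \<gamma>\<close> and the volume enters with power -1, which is the pointwise bound by
  the inverse volume.\<close>

lemma Lp_norm_decay:
  assumes p: "0 < p" and g: "\<omega> * max (enn2real (1 / p) - 1) 0 < \<gamma>"
  shows "\<exists>C\<ge>0. \<forall>t>0. \<forall>x. \<forall>c\<ge>0. \<forall>f\<in>borel_measurable M. (\<forall>y. f y \<le> ennreal (c * decay t x \<gamma> y)) \<longrightarrow>
    Lp_norm M p f \<le> ennreal (C * c * V t x powr (enn2real (1 / p) - 1))"
proof (cases p)
  case top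
  have "0 \<le> \<gamma>"
    using g dim_nonneg by (smt (verit) mult_nonneg_nonneg)
  have "Lp_norm M p f \<le> ennreal (1 * c * V t x powr (enn2real (1 / p) - 1))"
    if "0 < t" "0 \<le> c" "f \<in> borel_measurable M" and f: "\<And>y. f y \<le> ennreal (c * decay t x \<gamma> y)" for t x c f
  proof -
    have "f y \<le> ennreal (c * (1 / V t x))" for y
      using decay_le_inverse_V[of t \<gamma> x y] that(1,2) \<open>0 \<le> \<gamma>\<close>
      by (intro order_trans[OF f] ennreal_leI mult_left_mono)
    then have "Lp_norm M p f \<le> ennreal (c * (1 / V t x))"
      using that(3) top by (auto simp: Lp_norm_def intro!: esssup_I)
    then show ?thesis
      using V_pos[OF that(1), of x] top by (simp add: powr_minus divide_inverse)
  qed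
  then show ?thesis
    by (intro exI[of _ 1]) auto
next
  case (real r)
  with p have r: "0 < r" by simp
  have inv: "enn2real (1 / p) = 1 / r"
    using r real by (simp add: divide_ennreal[symmetric] ennreal_1[symmetric] del: ennreal_1)
  obtain C where C: "0 \<le> C" "\<And>t x. 0 < t \<Longrightarrow> (\<integral>\<^sup>+y. ennreal (decay t x \<gamma> y powr r) \<partial>M) \<le> ennreal (C * V t x powr (1 - r))"
    using nn_integral_decay_powr[OF r] g unfolding inv by blast
  have "Lp_norm M p f \<le> ennreal (C powr (1 / r) * c * V t x powr (enn2real (1 / p) - 1))"
    if t: "0 < t" and c: "0 \<le> c" and f: "\<And>y. f y \<le> ennreal (c * decay t x \<gamma> y)" for t x c f
  proof -
    have "(\<integral>\<^sup>+y. ennreal_powr (f y) r \<partial>M) \<le> (\<integral>\<^sup>+y. ennreal (c powr r) * ennreal (decay t x \<gamma> y powr r) \<partial>M)"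
    proof (intro nn_integral_mono)
      fix y
      have "ennreal_powr (f y) r \<le> ennreal_powr (ennreal (c * decay t x \<gamma> y)) r"
        using r by (intro ennreal_powr_mono f) auto
      also have "\<dots> = ennreal (c powr r) * ennreal (decay t x \<gamma> y powr r)"
        using c t by (simp add: ennreal_powr_ennreal powr_mult flip: ennreal_mult)
      finally show "ennreal_powr (f y) r \<le> ennreal (c powr r) * ennreal (decay t x \<gamma> y powr r)" .
    qed
    also have "\<dots> \<le> ennreal (c powr r) * ennreal (C * V t x powr (1 - r))"
      by (subst nn_integral_cmult) (auto intro!: mult_left_mono C(2) t)
    also have "\<dots> = ennreal (c powr r * (C * V t x powr (1 - r)))"
      using C(1) by (simp add: ennreal_mult)
    finally have "Lp_norm M p f \<le> ennreal_powr (ennreal (c powr r * (C * V t x powr (1 - r)))) (1 / r)"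
      unfolding real Lp_norm_finite[OF r] using r by (intro ennreal_powr_mono) auto
    also have "\<dots> = ennreal (C powr (1 / r) * c * V t x powr (1 / r - 1))"
      using r c C(1) V_pos[OF t, of x]
      by (simp add: ennreal_powr_ennreal powr_mult powr_powr diff_divide_distrib)
    finally show ?thesis
      unfolding inv .
  qed
  then show ?thesis
    by (intro exI[of _ "C powr (1 / r)"]) auto
qed

end

locale homogeneous_space_with_points =
  homogeneous_type_space d A0 M Cmu + reference_points d A0 c0 C0 \<delta> A z
  for d :: "'a \<Rightarrow> 'a \<Rightarrow> real" and A0 :: real and M :: "'a measure" and Cmu c0 C0 \<delta> :: real
    and A :: "int \<Rightarrow> 'i set" and z :: "int \<Rightarrow> 'i \<Rightarrow> 'a"
begin

section \<open>Separability and measurability of continuous functions\<close>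

lemma scale_pos [simp]: "0 < \<delta> powi k"
  using delta_pos by simp

text \<open>Half the separation, divided by \<open>A0\<close>, is a radius for which the balls
  around the points of one level are disjoint. Inside a fixed ball of finite measure only countably
  many of them can have positive measure, and each of these balls lies inside some ball around
  \<open>x0\<close> of integer radius.\<close>

lemma countable_index: "countable (A k)"
proof -
  fix x0 :: 'a
  define r where "r = c0 * \<delta> powi k / (2 * A0)"
  have r: "0 < r"
    using c0_pos delta_pos A0_pos by (simp add: r_def)
  define U where "U n \<alpha> = qball d (z k \<alpha>) r \<inter> qball d x0 (real n)" for n \<alpha>
  have [measurable]: "U n \<alpha> \<in> sets M" for n \<alpha>
    by (simp add: U_def)
  have disj: "U n \<alpha> \<inter> U n \<beta> = {}" if "\<alpha> \<in> A k" "\<beta> \<in> A k" "\<alpha> \<noteq> \<beta>" for n \<alpha> \<beta>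
  proof (rule ccontr)
    assume "U n \<alpha> \<inter> U n \<beta> \<noteq> {}"
    then obtain y where y: "d (z k \<alpha>) y < r" "d (z k \<beta>) y < r"
      by (auto simp: U_def qball_def)
    then have "A0 * (d (z k \<alpha>) y + d y (z k \<beta>)) < A0 * (2 * r)"
      using A0_pos d_sym[of y "z k \<beta>"] by (intro mult_strict_left_mono) auto
    also have "\<dots> = c0 * \<delta> powi k"
      using A0_pos by (simp add: r_def)
    also have "\<dots> \<le> d (z k \<alpha>) (z k \<beta>)"
      by (rule points_separated) fact+
    finally show False
      using d_triangle[of "z k \<alpha>" "z k \<beta>" y] by simp
  qed
  have "countable {\<alpha> \<in> A k. measure M (U n \<alpha>) \<noteq> 0}" for n
  proof (rule summable_countable_real, rule nonneg_bdd_above_summable_on)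
    show "bdd_above (sum (\<lambda>\<alpha>. measure M (U n \<alpha>)) ` {F. F \<subseteq> A k \<and> finite F})"
    proof (rule bdd_aboveI2)
      fix F assume F: "F \<in> {F. F \<subseteq> A k \<and> finite F}"
      have fm: "U n \<alpha> \<in> fmeasurable M" for \<alpha>
        unfolding U_def by (intro fmeasurable_Int_fmeasurable qball_fmeasurable qball_sets)
      have "(\<Sum>\<alpha>\<in>F. measure M (U n \<alpha>)) = measure M (\<Union>\<alpha>\<in>F. U n \<alpha>)"
        using F disj fm
        by (intro measure_finite_Union[symmetric]) (auto simp: disjoint_family_on_def fmeasurable_def less_top, blast)
      also have "\<dots> \<le> V (real n) x0"
        unfolding vol_def using F
        by (intro measure_mono_fmeasurable qball_fmeasurable sets.finite_UN) (auto simp: U_def)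
      finally show "(\<Sum>\<alpha>\<in>F. measure M (U n \<alpha>)) \<le> V (real n) x0" .
    qed
  qed simp
  then have "countable (\<Union>n. {\<alpha> \<in> A k. measure M (U n \<alpha>) \<noteq> 0})"
    by (intro countable_UN) auto
  moreover have "A k \<subseteq> (\<Union>n. {\<alpha> \<in> A k. measure M (U n \<alpha>) \<noteq> 0})"
  proof
    fix \<alpha> assume \<alpha>: "\<alpha> \<in> A k"
    obtain n where n: "A0 * (d x0 (z k \<alpha>) + r) < real n"
      using reals_Archimedean2 by blast
    have "qball d (z k \<alpha>) r \<subseteq> qball d x0 (real n)"
    proof
      fix y assume "y \<in> qball d (z k \<alpha>) r"
      then have "A0 * (d x0 (z k \<alpha>) + d (z k \<alpha>) y) < A0 * (d x0 (z k \<alpha>) + r)"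
        using A0_pos by (simp add: qball_def)
      then show "y \<in> qball d x0 (real n)"
        using n d_triangle[of x0 y "z k \<alpha>"] by (simp add: qball_def)
    qed
    then have "measure M (U n \<alpha>) = V r (z k \<alpha>)"
      by (simp add: U_def vol_def Int_absorb2)
    then show "\<alpha> \<in> (\<Union>n. {\<alpha> \<in> A k. measure M (U n \<alpha>) \<noteq> 0})"
      using \<alpha> V_pos[OF r, of "z k \<alpha>"] by (auto intro!: exI[of _ n])
  qed
  ultimately show ?thesis
    by (rule countable_subset[rotated])
qed

lemma countable_dense: "\<exists>D. countable D \<and> (\<forall>x. \<forall>e>0. \<exists>y\<in>D. d x y < e)"
proof (intro exI conjI allI impI)
  show "countable (\<Union>k. z k ` A k)"
    by (intro countable_UN countable_image countable_index) auto
  fix x and e :: real assume e: "0 < e"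
  have C0: "0 < C0" using c0_pos c0_le_C0 by linarith
  obtain n where n: "\<delta> ^ n < e / C0"
    using real_arch_pow_inv[of "e / C0" \<delta>] e C0 delta_less_1 by auto
  obtain \<alpha> where "\<alpha> \<in> A (int n)" "d x (z (int n) \<alpha>) < C0 * \<delta> powi (int n)"
    using points_dense by blast
  moreover have "C0 * \<delta> powi (int n) < e"
    using n C0 by (simp add: field_simps)
  ultimately show "\<exists>y\<in>(\<Union>k. z k ` A k). d x y < e"
    by (intro bexI[of _ "z (int n) \<alpha>"]) auto
qed

text \<open>An open preimage is the union of the balls it contains that have centre in the dense set
  and radius \<open>1 / Suc n\<close>, a countable family. The radius is taken below
  \<open>r / (2 * A0)\<close>, since a point of such a ball is reached from \<open>x\<close> through
  its centre, by two short distances and one use of the quasi-triangle inequality.\<close>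

lemma continuous_imp_borel_measurable:
  fixes f :: "'a \<Rightarrow> 'b::metric_space"
  assumes cont: "\<And>x e. 0 < e \<Longrightarrow> \<exists>r>0. \<forall>y. d x y < r \<longrightarrow> dist (f y) (f x) < e"
  shows "f \<in> borel_measurable M"
proof (rule borel_measurableI)
  fix S :: "'b set" assume S: "open S"
  obtain D where D: "countable D" "\<And>x e. 0 < e \<Longrightarrow> \<exists>y\<in>D. d x y < e"
    using countable_dense by auto
  define I where "I = {(q, n). q \<in> D \<and> qball d q (1 / real (Suc n)) \<subseteq> f -` S}"
  have "I \<subseteq> D \<times> UNIV" by (auto simp: I_def)
  then have "countable I"
    by (rule countable_subset) (intro countable_SIGMA D(1) countableI_type)
  have "f -` S = (\<Union>(q, n)\<in>I. qball d q (1 / real (Suc n)))"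
  proof (intro equalityI subsetI)
    fix x assume x: "x \<in> f -` S"
    then obtain e where e: "0 < e" "\<And>w. dist w (f x) < e \<Longrightarrow> w \<in> S"
      using S by (auto simp: open_dist)
    obtain r where r: "0 < r" "\<And>y. d x y < r \<Longrightarrow> dist (f y) (f x) < e"
      using cont[OF e(1)] by blast
    obtain n where n: "1 / real (Suc n) < r / (2 * A0)"
      using r(1) A0_pos by (metis divide_pos_pos nat_approx_posE zero_less_mult_iff zero_less_numeral)
    obtain q where q: "q \<in> D" "d x q < 1 / real (Suc n)"
      using D(2)[of "1 / real (Suc n)"] by auto
    have "qball d q (1 / real (Suc n)) \<subseteq> f -` S"
    proof
      fix y assume "y \<in> qball d q (1 / real (Suc n))"
      then have "d x q + d q y < 2 * (r / (2 * A0))"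
        using q(2) n unfolding qball_def by (simp del: of_nat_Suc)
      then have "d x y < r"
        using d_triangle[of x y q] A0_pos by (simp add: field_simps)
      then show "y \<in> f -` S"
        using r(2) e(2) by auto
    qed
    with q(1) have "(q, n) \<in> I" by (simp add: I_def)
    moreover have "x \<in> qball d q (1 / real (Suc n))"
      using q(2) by (simp add: qball_def d_sym[of q])
    ultimately show "x \<in> (\<Union>(q, n)\<in>I. qball d q (1 / real (Suc n)))"
      by blast
  qed (auto simp: I_def)
  also have "\<dots> \<in> sets M"
    using \<open>countable I\<close> by (intro sets.countable_UN') auto
  finally show "f -` S \<inter> space M \<in> sets M"
    by (simp add: space_UNIV)
qed

end

section \<open>Test functions and kernels\<close>

text \<open>Raising \<open>w / n <= exp (w / n)\<close> to the power \<open>n\<close>, with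
  \<open>w = \<nu> * u powr a\<close>, bounds \<open>w^n * exp (- w)\<close> by \<open>n^n\<close>.
  Any \<open>n\<close> with \<open>a * n > N\<close> then dominates \<open>u powr N\<close> for
  \<open>u >= 1\<close>.\<close>

lemma exp_powr_decay:
  assumes "0 < \<nu>" "0 < a" "0 \<le> N"
  shows "\<exists>C>0. \<forall>u\<ge>0. exp (- \<nu> * u powr a) \<le> C * (1 + u) powr (- N :: real)"
proof -
  obtain n where n: "N / a < real n"
    using reals_Archimedean2 by blast
  have n0: "0 < n"
    using n assms by (cases n) (auto simp: divide_less_0_iff)
  \<comment> \<open>The factor \<open>2 powr N\<close> replaces \<open>1 + u\<close> by the larger
    of 1 and \<open>u\<close>; the two summands serve \<open>u <= 1\<close> and
    \<open>u > 1\<close>.\<close>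
  define C where "C = 2 powr N * (1 + (real n / \<nu>) ^ n)"
  have "(1 + u) powr N * exp (- \<nu> * u powr a) \<le> C" if u: "0 \<le> u" for u
  proof (cases "u \<le> 1")
    case True
    have "(1 + u) powr N * exp (- \<nu> * u powr a) \<le> 2 powr N * 1"
      using True u assms by (intro mult_mono powr_mono2) auto
    also have "\<dots> \<le> C"
      using assms unfolding C_def by (intro mult_left_mono) auto
    finally show ?thesis .
  next
    case False
    have "\<nu> * u powr a / n \<le> exp (\<nu> * u powr a / n)"
      using exp_ge_add_one_self[of "\<nu> * u powr a / n"] by linarith
    then have "(\<nu> * u powr a / n) ^ n \<le> exp (\<nu> * u powr a / n) ^ n"
      using assms by (intro power_mono) auto
    also have "\<dots> = exp (\<nu> * u powr a)"
      using n0 by (simp add: exp_of_nat_mult[symmetric])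
    finally have "(u powr a) ^ n * exp (- \<nu> * u powr a) \<le> (real n / \<nu>) ^ n"
      using assms n0 by (simp add: exp_minus power_mult_distrib power_divide field_simps)
    moreover have "u powr N \<le> (u powr a) ^ n"
    proof -
      have "u powr N \<le> u powr (a * n)"
        using False n assms by (intro powr_mono) (auto simp: field_simps)
      then show ?thesis
        using False by (simp add: powr_powr[symmetric] powr_realpow)
    qed
    ultimately have 1: "u powr N * exp (- \<nu> * u powr a) \<le> (real n / \<nu>) ^ n"
      by (meson exp_ge_zero mult_right_mono order_trans)
    have "(1 + u) powr N \<le> (2 * u) powr N"
      using False assms by (intro powr_mono2) auto
    then have "(1 + u) powr N * exp (- \<nu> * u powr a) \<le> 2 powr N * (u powr N * exp (- \<nu> * u powr a))"
      using False by (simp add: powr_mult)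
    also have "\<dots> \<le> 2 powr N * (real n / \<nu>) ^ n"
      using 1 by (intro mult_left_mono) auto
    also have "\<dots> \<le> C"
      unfolding C_def by (intro mult_left_mono) auto
    finally show ?thesis .
  qed
  then have "exp (- \<nu> * u powr a) \<le> C * (1 + u) powr (- N)" if "0 \<le> u" for u
    using that by (simp add: powr_minus divide_simps mult.commute[of _ "(1 + u) powr N"])
  moreover have "0 < C"
    using assms zero_le_power[of "real n / \<nu>" n] unfolding C_def
    by (intro mult_pos_pos add_pos_nonneg) auto
  ultimately show ?thesis by blast
qed

context homogeneous_space_with_points
begin

lemma locally_Holder_imp_borel_measurable:
  fixes f :: "'a \<Rightarrow> 'b::metric_space"
  assumes b: "0 < b"
    and H: "\<And>x. \<exists>\<rho>>0. \<exists>K. \<forall>y. d x y \<le> \<rho> \<longrightarrow> dist (f y) (f x) \<le> K * d x y powr b"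
  shows "f \<in> borel_measurable M"
proof (rule continuous_imp_borel_measurable)
  fix x and e :: real assume e: "0 < e"
  obtain \<rho> K where \<rho>: "0 < \<rho>" and K: "\<And>y. d x y \<le> \<rho> \<Longrightarrow> dist (f y) (f x) \<le> K * d x y powr b"
    using H[of x] by blast
  \<comment> \<open>Nothing is known about the sign of \<open>K\<close>;
    \<open>\<bar>K\<bar> + 1\<close> is a positive bound for it that may stand in a
    denominator.\<close>
  define r where "r = min \<rho> ((e / (\<bar>K\<bar> + 1)) powr (1 / b))"
  have "dist (f y) (f x) < e" if y: "d x y < r" for y
  proof -
    have "d x y powr b \<le> ((e / (\<bar>K\<bar> + 1)) powr (1 / b)) powr b"
      using y b d_nonneg[of x y] by (intro powr_mono2) (auto simp: r_def)
    also have "\<dots> = e / (\<bar>K\<bar> + 1)"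
      using b e by (simp add: powr_powr)
    finally have "\<bar>K\<bar> * d x y powr b \<le> \<bar>K\<bar> * (e / (\<bar>K\<bar> + 1))"
      by (rule mult_left_mono) simp
    also have "\<dots> < e"
      using e by (simp add: field_simps)
    finally have "\<bar>K\<bar> * d x y powr b < e" .
    moreover have "K * d x y powr b \<le> \<bar>K\<bar> * d x y powr b"
      by (intro mult_right_mono) auto
    ultimately show ?thesis
      using K[of y] y by (simp add: r_def)
  qed
  moreover have "0 < r"
    using \<rho> e by (simp add: r_def)
  ultimately show "\<exists>r>0. \<forall>y. d x y < r \<longrightarrow> dist (f y) (f x) < e"
    by blast
qed

section \<open>Algebra of test functions and of their closure\<close>

lemma inverse_mult_eq_divide: "inverse (2 * A0) * (1 + r) = (1 + r) / (2 * A0)"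
  unfolding divide_inverse by (rule mult.commute)

lemma test_bound_size:
  "test_bound M d A0 x0 b g C f \<Longrightarrow> norm (f x) \<le> C * decay 1 x0 g x"
  unfolding test_bound_def test_decay_eq by blast

lemma test_bound_regular:
  "test_bound M d A0 x0 b g C f \<Longrightarrow> d x y \<le> (1 + d x0 x) / (2 * A0) \<Longrightarrow>
    norm (f x - f y) \<le> C * (d x y / (1 + d x0 x)) powr b * decay 1 x0 g x"
  unfolding test_bound_def test_decay_eq inverse_mult_eq_divide by blast

lemma test_boundI:
  assumes "\<And>x. norm (f x) \<le> C * decay 1 x0 g x"
    and "\<And>x y. d x y \<le> (1 + d x0 x) / (2 * A0) \<Longrightarrow>
      norm (f x - f y) \<le> C * (d x y / (1 + d x0 x)) powr b * decay 1 x0 g x"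
  shows "test_bound M d A0 x0 b g C f"
  using assms unfolding test_bound_def test_decay_eq inverse_mult_eq_divide by blast

lemma test_bound_mono:
  assumes "test_bound M d A0 x0 b g C f" "C \<le> C'"
  shows "test_bound M d A0 x0 b g C' f"
proof (rule test_boundI)
  fix x y
  show "norm (f x) \<le> C' * decay 1 x0 g x"
    using test_bound_size[OF assms(1), of x] assms(2)
    by - (erule order_trans, intro mult_right_mono, auto)
  assume "d x y \<le> (1 + d x0 x) / (2 * A0)"
  from test_bound_regular[OF assms(1) this]
  show "norm (f x - f y) \<le> C' * (d x y / (1 + d x0 x)) powr b * decay 1 x0 g x"
    using assms(2) by - (erule order_trans, intro mult_right_mono, auto)
qed

lemma test_bound_mono_exponents:
  assumes "test_bound M d A0 x0 b g C f" "0 \<le> C" "b' \<le> b" "g' \<le> g"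
  shows "test_bound M d A0 x0 b' g' C f"
proof (rule test_boundI)
  fix x y
  show "norm (f x) \<le> C * decay 1 x0 g' x"
    using test_bound_size[OF assms(1), of x] assms(2,4)
    by - (erule order_trans, intro mult_left_mono decay_antimono, auto)
  assume *: "d x y \<le> (1 + d x0 x) / (2 * A0)"
  have "(1 + d x0 x) / (2 * A0) \<le> 1 + d x0 x"
    using A0_ge_1 d_nonneg[of x0 x] by (simp add: divide_le_eq mult_le_cancel_left1)
  then have le: "d x y / (1 + d x0 x) \<le> 1"
    using * d_nonneg[of x0 x] by simp
  have "norm (f x - f y) \<le> C * (d x y / (1 + d x0 x)) powr b * decay 1 x0 g x"
    by (rule test_bound_regular) fact+
  also have "\<dots> \<le> C * (d x y / (1 + d x0 x)) powr b' * decay 1 x0 g' x"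
    using assms(2-4) le d_nonneg by (intro mult_mono decay_antimono powr_mono') auto
  finally show "norm (f x - f y) \<le> C * (d x y / (1 + d x0 x)) powr b' * decay 1 x0 g' x" .
qed

lemma test_bound_add:
  assumes "test_bound M d A0 x0 b g C f" "test_bound M d A0 x0 b g C' f'"
  shows "test_bound M d A0 x0 b g (C + C') (\<lambda>x. f x + f' x)"
proof (rule test_boundI)
  fix x y
  show "norm (f x + f' x) \<le> (C + C') * decay 1 x0 g x"
    using norm_triangle_le[OF add_mono[OF assms[THEN test_bound_size]]] by (simp add: distrib_right)
  assume "d x y \<le> (1 + d x0 x) / (2 * A0)"
  note assms[THEN test_bound_regular, OF this]
  from norm_triangle_le[OF add_mono[OF this]]
  show "norm (f x + f' x - (f y + f' y)) \<le> (C + C') * (d x y / (1 + d x0 x)) powr b * decay 1 x0 g x"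
    by (simp add: distrib_right add_diff_add)
qed

lemma test_bound_cmult:
  assumes "test_bound M d A0 x0 b g C f"
  shows "test_bound M d A0 x0 b g (norm c * C) (\<lambda>x. c * f x)"
proof (rule test_boundI)
  fix x y
  show "norm (c * f x) \<le> norm c * C * decay 1 x0 g x"
    using test_bound_size[OF assms, of x] by (simp add: norm_mult mult.assoc mult_left_mono)
  assume "d x y \<le> (1 + d x0 x) / (2 * A0)"
  from test_bound_regular[OF assms this]
  show "norm (c * f x - c * f y) \<le> norm c * C * (d x y / (1 + d x0 x)) powr b * decay 1 x0 g x"
    by (simp add: norm_mult mult.assoc mult_left_mono flip: right_diff_distrib)
qed

lemma test_norm_le: "test_bound M d A0 x0 b g C f \<Longrightarrow> 0 < C \<Longrightarrow> test_norm M d A0 x0 b g f \<le> C"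
  unfolding test_norm_def by (intro cInf_lower bdd_belowI[of _ 0]) auto

text \<open>Membership in \<open>test_funs\<close> makes the set of admissible constants nonempty,
  so that its infimum has the expected meaning.\<close>

lemma test_norm_lessE:
  assumes "f \<in> test_funs M d A0 x0 b g" "test_norm M d A0 x0 b g f < e"
  obtains C where "0 < C" "C < e" "test_bound M d A0 x0 b g C f"
  using cInf_lessD[of "{C. 0 < C \<and> test_bound M d A0 x0 b g C f}" e] assms
  by (auto simp: test_norm_def test_funs_def)

lemma test_funs_add:
  "f \<in> test_funs M d A0 x0 b g \<Longrightarrow> f' \<in> test_funs M d A0 x0 b g \<Longrightarrow>
    (\<lambda>x. f x + f' x) \<in> test_funs M d A0 x0 b g"
  unfolding test_funs_def using test_bound_add add_pos_pos by blast

lemma test_funs_cmult: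
  assumes "f \<in> test_funs M d A0 x0 b g"
  shows "(\<lambda>x. c * f x) \<in> test_funs M d A0 x0 b g"
proof -
  obtain C where C: "0 < C" "test_bound M d A0 x0 b g C f"
    using assms by (auto simp: test_funs_def)
  \<comment> \<open>Admissible constants are positive, and adding 1 ensures this for
    \<open>c = 0\<close> too.\<close>
  have "test_bound M d A0 x0 b g (norm c * C + 1) (\<lambda>x. c * f x)"
    by (rule test_bound_mono[OF test_bound_cmult[OF C(2)]]) simp
  moreover have "0 < norm c * C + 1"
    using C(1) by (intro add_nonneg_pos) auto
  ultimately show ?thesis
    by (auto simp: test_funs_def)
qed

lemma test_funs_measurable:
  assumes "f \<in> test_funs M d A0 x0 b g" "0 < b"
  shows "f \<in> borel_measurable M"
proof (rule locally_Holder_imp_borel_measurable[OF assms(2)])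
  fix x
  obtain C where C: "0 < C" "test_bound M d A0 x0 b g C f"
    using assms by (auto simp: test_funs_def)
  have "dist (f y) (f x) \<le> (C * decay 1 x0 g x) * d x y powr b" if "d x y \<le> (1 + d x0 x) / (2 * A0)" for y
  proof -
    have "dist (f y) (f x) \<le> C * (d x y / (1 + d x0 x)) powr b * decay 1 x0 g x"
      using test_bound_regular[OF C(2) that] by (simp add: dist_norm norm_minus_commute)
    also have "\<dots> \<le> C * d x y powr b * decay 1 x0 g x"
      using C(1) assms(2) d_nonneg[of x0 x] d_nonneg[of x y]
      by (intro mult_right_mono mult_left_mono powr_mono2) (auto simp: divide_le_eq mult_le_cancel_left1)
    finally show ?thesis by (simp add: mult_ac)
  qed
  moreover have "0 < (1 + d x0 x) / (2 * A0)"
    using A0_pos d_nonneg[of x0 x] by simp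
  ultimately show "\<exists>\<rho>>0. \<exists>K. \<forall>y. d x y \<le> \<rho> \<longrightarrow> dist (f y) (f x) \<le> K * d x y powr b"
    by blast
qed

lemma integrable_decay_bound:
  fixes f :: "'a \<Rightarrow> complex"
  assumes "f \<in> borel_measurable M" "0 < t" "0 < g" "\<And>x. norm (f x) \<le> C * decay t x0 g x"
  shows "integrable M f"
  using assms by (intro Bochner_Integration.integrable_bound[OF integrable_mult_right[OF decay_integrable[OF assms(3,2)]]])
    (auto intro!: AE_I2 order_trans[OF assms(4) abs_ge_self])

lemma test_funs_integrable:
  assumes "f \<in> test_funs M d A0 x0 b g" "0 < b" "0 < g"
  shows "integrable M f"
  using assms by (auto simp: test_funs_def intro!: integrable_decay_bound[where t=1 and ?x0.0=x0 and g=g]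
      test_funs_measurable[OF assms(1,2)] dest: test_bound_size)

lemma test_funs_mean0_add:
  assumes "0 < b" "0 < g" "f \<in> test_funs_mean0 M d A0 x0 b g" "f' \<in> test_funs_mean0 M d A0 x0 b g"
  shows "(\<lambda>x. f x + f' x) \<in> test_funs_mean0 M d A0 x0 b g"
  using assms test_funs_integrable[of _ x0 b g] by (auto simp: test_funs_mean0_def test_funs_add)

lemma test_funs_mean0_cmult:
  "f \<in> test_funs_mean0 M d A0 x0 b g \<Longrightarrow> (\<lambda>x. c * f x) \<in> test_funs_mean0 M d A0 x0 b g"
  by (auto simp: test_funs_mean0_def test_funs_cmult)

lemma test_closure_add:
  assumes "0 < b" "0 < g" "0 < h"
    and f: "f \<in> test_closure M d A0 x0 h b g" "f' \<in> test_closure M d A0 x0 h b g"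
    and sub: "test_funs M d A0 x0 h h \<subseteq> test_funs M d A0 x0 b g"
  shows "(\<lambda>x. f x + f' x) \<in> test_closure M d A0 x0 h b g"
  unfolding test_closure_def
proof (intro CollectI conjI allI impI)
  have mem: "f \<in> test_funs_mean0 M d A0 x0 b g" "f' \<in> test_funs_mean0 M d A0 x0 b g"
    using f by (auto simp: test_closure_def)
  show "(\<lambda>x. f x + f' x) \<in> test_funs_mean0 M d A0 x0 b g"
    by (rule test_funs_mean0_add) fact+
  fix e :: real assume e: "0 < e"
  obtain u u' where u: "u \<in> test_funs_mean0 M d A0 x0 h h" "u' \<in> test_funs_mean0 M d A0 x0 h h"
    "test_norm M d A0 x0 b g (\<lambda>x. f x - u x) < e / 2" "test_norm M d A0 x0 b g (\<lambda>x. f' x - u' x) < e / 2"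
    using f e unfolding test_closure_def mem_Collect_eq by (meson half_gt_zero)
  \<comment> \<open>Writing the difference this way lets closure under sums and multiples do the
    work.\<close>
  have "(\<lambda>x. v x + (-1) * w x) \<in> test_funs M d A0 x0 b g"
    if "v \<in> test_funs_mean0 M d A0 x0 b g" "w \<in> test_funs_mean0 M d A0 x0 h h" for v w
    using that sub by (intro test_funs_add test_funs_cmult) (auto simp: test_funs_mean0_def)
  from this[OF mem(1) u(1)] this[OF mem(2) u(2)]
  have diff: "(\<lambda>x. f x - u x) \<in> test_funs M d A0 x0 b g" "(\<lambda>x. f' x - u' x) \<in> test_funs M d A0 x0 b g"
    by simp_all
  obtain C C' where C: "0 < C" "C < e / 2" "test_bound M d A0 x0 b g C (\<lambda>x. f x - u x)"
    "0 < C'" "C' < e / 2" "test_bound M d A0 x0 b g C' (\<lambda>x. f' x - u' x)"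
    by (rule test_norm_lessE[OF diff(1) u(3)], rule test_norm_lessE[OF diff(2) u(4)])
  have "test_bound M d A0 x0 b g (C + C') (\<lambda>x. f x + f' x - (u x + u' x))"
    using test_bound_add[OF C(3,6)] by (simp add: algebra_simps)
  then have "test_norm M d A0 x0 b g (\<lambda>x. f x + f' x - (u x + u' x)) < e"
    using test_norm_le[of x0 b g "C + C'"] C by fastforce
  moreover have "(\<lambda>x. u x + u' x) \<in> test_funs_mean0 M d A0 x0 h h"
    using u assms by (intro test_funs_mean0_add)
  ultimately show "\<exists>g'\<in>test_funs_mean0 M d A0 x0 h h. test_norm M d A0 x0 b g (\<lambda>x. f x + f' x - g' x) < e"
    by (intro bexI[of _ "\<lambda>x. u x + u' x"])
qed

lemma test_closure_cmult:
  assumes f: "f \<in> test_closure M d A0 x0 h b g"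
    and sub: "test_funs M d A0 x0 h h \<subseteq> test_funs M d A0 x0 b g"
  shows "(\<lambda>x. c * f x) \<in> test_closure M d A0 x0 h b g"
  unfolding test_closure_def
proof (intro CollectI conjI allI impI)
  have mem: "f \<in> test_funs_mean0 M d A0 x0 b g"
    using f by (auto simp: test_closure_def)
  show "(\<lambda>x. c * f x) \<in> test_funs_mean0 M d A0 x0 b g"
    by (rule test_funs_mean0_cmult) fact
  fix e :: real assume e: "0 < e"
  define e' where "e' = e / (norm c + 1)"
  have n: "0 < norm c + 1" by (simp add: add_nonneg_pos)
  then have "0 < e'" using e by (simp add: e'_def)
  then obtain u where u: "u \<in> test_funs_mean0 M d A0 x0 h h" "test_norm M d A0 x0 b g (\<lambda>x. f x - u x) < e'"
    using f unfolding test_closure_def by blast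
  have "(\<lambda>x. f x + (-1) * u x) \<in> test_funs M d A0 x0 b g"
    using mem u(1) sub by (intro test_funs_add test_funs_cmult) (auto simp: test_funs_mean0_def)
  then have "(\<lambda>x. f x - u x) \<in> test_funs M d A0 x0 b g"
    by simp
  then obtain C where C: "0 < C" "C < e'" "test_bound M d A0 x0 b g C (\<lambda>x. f x - u x)"
    by (rule test_norm_lessE[OF _ u(2)])
  have "test_bound M d A0 x0 b g ((norm c + 1) * C) (\<lambda>x. c * f x - c * u x)"
    using test_bound_mono[OF test_bound_cmult[OF C(3), of c], of "(norm c + 1) * C"] C(1)
    by (simp add: algebra_simps)
  then have "test_norm M d A0 x0 b g (\<lambda>x. c * f x - c * u x) \<le> (norm c + 1) * C"
    using C(1) n by (intro test_norm_le) auto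
  also have "\<dots> < e"
    using C(2) n by (simp add: e'_def field_simps)
  finally show "\<exists>g'\<in>test_funs_mean0 M d A0 x0 h h. test_norm M d A0 x0 b g (\<lambda>x. c * f x - g' x) < e"
    using test_funs_mean0_cmult[OF u(1), of c] by (intro bexI[of _ "\<lambda>x. c * u x"])
qed

text \<open>Each function approximates itself: every positive constant is admissible for the zero
  function, so its norm is below any \<open>e\<close>.\<close>

lemma test_funs_mean0_subset_closure:
  assumes "test_funs M d A0 x0 h h \<subseteq> test_funs M d A0 x0 b g"
  shows "test_funs_mean0 M d A0 x0 h h \<subseteq> test_closure M d A0 x0 h b g"
proof
  fix f assume f: "f \<in> test_funs_mean0 M d A0 x0 h h"
  have "test_norm M d A0 x0 b g (\<lambda>x. f x - f x) < e" if "0 < e" for e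
  proof -
    have "test_bound M d A0 x0 b g (e / 2) (\<lambda>x. f x - f x)"
      using that by (intro test_boundI) auto
    then show ?thesis
      using test_norm_le[of x0 b g "e / 2"] that by fastforce
  qed
  then show "f \<in> test_closure M d A0 x0 h b g"
    using f assms by (auto simp: test_closure_def test_funs_mean0_def)
qed

lemma test_funs_subset:
  assumes "b' \<le> b" "g' \<le> g"
  shows "test_funs M d A0 x0 b g \<subseteq> test_funs M d A0 x0 b' g'"
  using test_bound_mono_exponents[OF _ _ assms] by (fastforce simp: test_funs_def)

text \<open>Doubling the decay exponent pays for the factor \<open>(1 + d x0 y) powr (- h)\<close> that the
  regularity condition asks for.\<close>

lemma bump_test_bound:
  assumes t: "0 < t" and h: "0 < h"
  shows "\<exists>B>0. \<forall>f c. 0 \<le> c \<longrightarrow> (\<forall>y. norm (f y) \<le> c * decay t x (2 * h) y) \<longrightarrow>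
    (\<forall>y y'. d y y' \<le> t \<longrightarrow> norm (f y - f y') \<le> c * (d y y' / t) powr h * decay t x (2 * h) y) \<longrightarrow>
    test_bound M d A0 x0 h h (c * B) f"
proof -
  define D where "D = d x0 x"
  have D: "0 \<le> D" by (simp add: D_def d_nonneg)
  \<comment> \<open>\<open>L\<close> collects all that is needed to move from centre
    \<open>x\<close> and scale \<open>t\<close> to centre \<open>x0\<close> and scale 1. The result
    depends on \<open>x\<close> and \<open>t\<close>, which suffices for membership of one kernel
    and for continuity at one point.\<close>
  define L where "L = max (2 * A0) ((1 + (A0 + 1) * D) / t) + A0 * t"
  have L: "1 \<le> L" "A0 \<le> L" "A0 * t \<le> L" "1 + (A0 + 1) * D \<le> L * t"
  proof -
    have "0 \<le> A0 * t" using t A0_pos by simp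
    then show "1 \<le> L" "A0 \<le> L" "A0 * t \<le> L"
      using A0_ge_1 by (auto simp: L_def)
    have "(1 + (A0 + 1) * D) / t \<le> L"
      using \<open>0 \<le> A0 * t\<close> by (simp add: L_def)
    then show "1 + (A0 + 1) * D \<le> L * t"
      using t by (simp add: field_simps)
  qed
  define L' where "L' = max L (1 + A0 * D)"
  have L': "1 \<le> L'" "L \<le> L'" using L by (auto simp: L'_def)
  define B1 where "B1 = mass_const L * L' powr (2 * h)"
  have tri: "d x0 y \<le> A0 * (D + d x y)" for y
    unfolding D_def by (rule d_triangle)
  have comp: "decay t x (2 * h) y \<le> B1 * decay 1 x0 (2 * h) y" for y
    unfolding B1_def
  proof (rule decay_compare)
    have "1 + d x0 y + d x x0 \<le> (1 + (A0 + 1) * D) + A0 * d x y"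
      using tri[of y] by (simp add: D_def d_sym[of x x0] algebra_simps)
    also have "\<dots> \<le> L * t + L * d x y"
      using L d_nonneg by (intro add_mono mult_right_mono) auto
    finally show "1 + d x0 y + d x x0 \<le> L * (t + d x y)"
      by (simp add: distrib_left)
    have "1 + d x0 y / 1 \<le> (1 + A0 * D) + A0 * t * (d x y / t)"
      using tri[of y] t by (simp add: algebra_simps)
    also have "\<dots> \<le> L' * 1 + L' * (d x y / t)"
      using L L' d_nonneg[of x y] t by (intro add_mono mult_right_mono) (auto simp: L'_def)
    finally show "1 + d x0 y / 1 \<le> L' * (1 + d x y / t)"
      by (simp add: distrib_left)
  qed (use t L L' h in auto)
  define B2 where "B2 = mass_const (2 * A0 + 1) * (2 * A0) powr (2 * h)"
  have comp': "decay 1 x0 (2 * h) y' \<le> B2 * decay 1 x0 (2 * h) y"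
    if "d y y' \<le> (1 + d x0 y) / (2 * A0)" for y y'
    unfolding B2_def
  proof (rule decay_compare)
    \<comment> \<open>The radius in the regularity condition is such that, multiplied by
      \<open>A0\<close>, it is half of \<open>1 + d x0 y\<close>, which can be absorbed on the
      left.\<close>
    have "d x0 y \<le> A0 * (d x0 y' + d y y')"
      using d_triangle[of x0 y y'] by (simp add: d_sym[of y'])
    also have "\<dots> \<le> A0 * (d x0 y' + (1 + d x0 y) / (2 * A0))"
      using that A0_pos by (intro mult_left_mono) auto
    also have "\<dots> = A0 * d x0 y' + (1 + d x0 y) / 2"
      using A0_pos by (simp add: field_simps)
    finally have "d x0 y \<le> A0 * d x0 y' + (1 + d x0 y) / 2" .
    then have *: "d x0 y \<le> 1 + 2 * A0 * d x0 y'" by argo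
    have "0 \<le> d x0 y'" by (rule d_nonneg)
    with * show "1 + d x0 y / 1 \<le> 2 * A0 * (1 + d x0 y' / 1)"
      using A0_ge_1 by (simp add: algebra_simps)
    with \<open>0 \<le> d x0 y'\<close> show "1 + d x0 y + d x0 x0 \<le> (2 * A0 + 1) * (1 + d x0 y')"
      by (simp add: algebra_simps)
  qed (use A0_ge_1 h in auto)
  have Bpos: "0 < B1" "0 < B2"
    using mass_const_pos L L' A0_ge_1 by (auto simp: B1_def B2_def)
  have split: "decay 1 x0 (2 * h) y = (1 + d x0 y) powr (- h) * decay 1 x0 h y" for y
    by (simp add: decay_def powr_add[symmetric])
  define B where "B = B1 * (t powr (- h)) * (1 + B2) + B1"
  have B: "0 < B" "B1 \<le> B" "B1 * t powr (- h) * (1 + B2) \<le> B"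
    using Bpos t by (auto simp: B_def intro!: add_nonneg_pos)
  have "test_bound M d A0 x0 h h (c * B) f"
    if c: "0 \<le> c" and size: "\<And>y. norm (f y) \<le> c * decay t x (2 * h) y"
      and reg: "\<And>y y'. d y y' \<le> t \<Longrightarrow> norm (f y - f y') \<le> c * (d y y' / t) powr h * decay t x (2 * h) y"
    for f c
  proof (rule test_boundI)
    have size': "norm (f y) \<le> c * B1 * decay 1 x0 (2 * h) y" for y
      using size[of y] mult_left_mono[OF comp[of y] c] by (simp add: mult.assoc)
    fix y y'
    have "norm (f y) \<le> c * B1 * decay 1 x0 (2 * h) y"
      by (rule size')
    also have "\<dots> \<le> c * B * decay 1 x0 h y"
      using B c Bpos h by (intro mult_mono decay_antimono) auto
    finally show "norm (f y) \<le> c * B * decay 1 x0 h y" .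
    assume le: "d y y' \<le> (1 + d x0 y) / (2 * A0)"
    have "norm (f y - f y') \<le> c * (d y y' / t) powr h * (B1 * (1 + B2)) * decay 1 x0 (2 * h) y"
    \<comment> \<open>Beyond distance \<open>t\<close> no regularity of \<open>f\<close> is assumed;
      there the ratio \<open>d y y' / t\<close> exceeds 1 and the sizes at both points
      suffice.\<close>
    proof (cases "d y y' \<le> t")
      case True
      have "norm (f y - f y') \<le> c * (d y y' / t) powr h * (B1 * decay 1 x0 (2 * h) y)"
        using reg[OF True] mult_left_mono[OF comp[of y], of "c * (d y y' / t) powr h"] c by simp
      also have "\<dots> \<le> c * (d y y' / t) powr h * (B1 * (1 + B2) * decay 1 x0 (2 * h) y)"
        using c Bpos by (intro mult_left_mono mult_right_mono) auto
      finally show ?thesis by (simp add: mult.assoc)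
    next
      case False
      have "norm (f y - f y') \<le> norm (f y) + norm (f y')"
        by (rule norm_triangle_ineq4)
      also have "\<dots> \<le> c * B1 * decay 1 x0 (2 * h) y + c * B1 * (B2 * decay 1 x0 (2 * h) y)"
        using size'[of y] order_trans[OF size'[of y'] mult_left_mono[OF comp'[OF le]]] c Bpos by simp
      also have "\<dots> = 1 * (c * (B1 * (1 + B2)) * decay 1 x0 (2 * h) y)"
        by (simp add: algebra_simps)
      also have "\<dots> \<le> (d y y' / t) powr h * (c * (B1 * (1 + B2)) * decay 1 x0 (2 * h) y)"
        using False t h c Bpos by (intro mult_right_mono ge_one_powr_ge_zero mult_nonneg_nonneg) auto
      finally show ?thesis by (simp add: mult_ac)
    qed
    also have "\<dots> = c * (B1 * t powr (- h) * (1 + B2)) * (d y y' / (1 + d x0 y)) powr h * decay 1 x0 h y"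
      using t d_nonneg[of y y'] d_nonneg[of x0 y]
      unfolding split[of y] by (simp add: powr_divide powr_minus field_simps)
    also have "\<dots> \<le> c * B * (d y y' / (1 + d x0 y)) powr h * decay 1 x0 h y"
      using c B by (intro mult_right_mono mult_left_mono) auto
    finally show "norm (f y - f y') \<le> c * B * (d y y' / (1 + d x0 y)) powr h * decay 1 x0 h y" .
  qed
  with B(1) show ?thesis by blast
qed

section \<open>From exponential to polynomial decay of the kernels\<close>

lemma ATI_bound_sym: "ATI_bound M d \<delta> Y \<nu> a k x y = ATI_bound M d \<delta> Y \<nu> a k y x"
  by (simp add: ATI_bound_def d_sym[of x y] max.commute mult.commute)

text \<open>Let \<open>u\<close> be the distance divided by the scale. Replacing the geometric mean
  of the volumes by the volume at \<open>x\<close> costs \<open>(1 + u) powr \<omega>\<close>, and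
  passing from that volume to \<open>mass\<close> costs the same again. The exponential is therefore
  estimated with exponent \<open>N + 2 * \<omega>\<close>. The factor with the set
  \<open>Y k\<close> is at most 1.\<close>

lemma ATI_bound_le_decay:
  assumes "0 < \<nu>" "0 < a" "0 \<le> N"
  shows "\<exists>C>0. \<forall>k x y. ATI_bound M d \<delta> Y \<nu> a k x y \<le> C * decay (\<delta> powi k) x N y"
proof -
  obtain C where C: "0 < C" "\<And>u. 0 \<le> u \<Longrightarrow> exp (- \<nu> * u powr a) \<le> C * (1 + u) powr (- (N + 2 * \<omega>))"
    using exp_powr_decay[of \<nu> a "N + 2 * \<omega>"] assms dim_nonneg by auto
  define K where "K = 2 * Cmu * (Cmu * A0 powr \<omega>)"
  have K: "0 < K" using Cmu_ge_1 A0_ge_1 by (simp add: K_def)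
  have "ATI_bound M d \<delta> Y \<nu> a k x y \<le> K * C * decay (\<delta> powi k) x N y" for k x y
  proof -
    define t where "t = \<delta> powi k"
    have t: "0 < t" by (simp add: t_def)
    define u where "u = d x y / t"
    have u: "0 \<le> u" using t d_nonneg by (simp add: u_def)
    have A1: "1 \<le> A0 * (1 + u)" using A0_ge_1 u mult_mono[of 1 A0 1 "1 + u"] by simp
    have "V t x \<le> V (A0 * (t + d x y)) y" by (rule V_shift) simp
    also have "A0 * (t + d x y) = A0 * (1 + u) * t" using t by (simp add: u_def field_simps)
    also have "V \<dots> y \<le> Cmu * (A0 * (1 + u) * t / t) powr \<omega> * V t y"
      using t A1 by (intro V_growth) auto
    also have "\<dots> = (Cmu * A0 powr \<omega>) * (1 + u) powr \<omega> * V t y"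
      using t A0_pos u by (simp add: powr_mult)
    finally have Vxy: "V t x \<le> G * V t y" if "G = (Cmu * A0 powr \<omega>) * (1 + u) powr \<omega>" for G
      using that by simp
    define G where "G = (Cmu * A0 powr \<omega>) * (1 + u) powr \<omega>"
    have "1 * 1 \<le> Cmu * (A0 * (1 + u)) powr \<omega>"
      using Cmu_ge_1 A1 dim_nonneg by (intro mult_mono ge_one_powr_ge_zero) auto
    then have G: "1 \<le> G" using A0_pos u by (simp add: G_def powr_mult mult.assoc)
    have pos: "0 < V t x" "0 < V t y" using V_pos t by auto
    have "V t x * V t x \<le> G * V t x * V t y"
      using mult_left_mono[OF Vxy[OF G_def], of "V t x"] pos by (simp add: mult_ac)
    also have "\<dots> \<le> G * G * (V t x * V t y)"
      using G pos by (simp add: mult.assoc mult_le_cancel_left1)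
    finally have "(V t x)\<^sup>2 \<le> G\<^sup>2 * (V t x * V t y)"
      by (simp add: power2_eq_square)
    then have "sqrt ((V t x)\<^sup>2) \<le> sqrt (G\<^sup>2 * (V t x * V t y))"
      by (rule real_sqrt_le_mono)
    then have "V t x \<le> G * sqrt (V t x * V t y)"
      using pos G by (simp add: real_sqrt_mult)
    then have "1 / sqrt (V t x * V t y) \<le> G * (1 / V t x)"
      using pos by (simp add: field_simps)
    moreover have "1 / V t x \<le> 2 * Cmu * (1 + u) powr \<omega> * (1 / mass t x y)"
    proof -
      have "mass t x y \<le> 2 * V ((1 + u) * t) x"
        using V_mono[of t "(1 + u) * t" x] V_mono[of "d x y" "(1 + u) * t" x] t u
        by (simp add: mass_def vol_between_eq u_def field_simps)
      also have "V ((1 + u) * t) x \<le> Cmu * ((1 + u) * t / t) powr \<omega> * V t x"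
        using t u by (intro V_growth) auto
      also have "(1 + u) * t / t = 1 + u"
        using t by simp
      finally show ?thesis
        using pos mass_pos[OF t, of x y] by (simp add: field_simps)
    qed
    ultimately have "1 / sqrt (V t x * V t y) \<le> G * (2 * Cmu * (1 + u) powr \<omega> * (1 / mass t x y))"
      by (rule order_trans[OF _ mult_left_mono]) (use G in simp)
    also have "\<dots> = K * (1 + u) powr (2 * \<omega>) * (1 / mass t x y)"
      using powr_add[of "1 + u" \<omega> \<omega>] by (simp add: G_def K_def)
    finally have 1: "1 / sqrt (V t x * V t y) \<le> K * (1 + u) powr (2 * \<omega>) * (1 / mass t x y)" .
    have "ATI_bound M d \<delta> Y \<nu> a k x y \<le> 1 / sqrt (V t x * V t y) * exp (- \<nu> * u powr a) * 1"
    proof (cases "Y k = {}")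
      case False
      then show ?thesis
        unfolding ATI_bound_def t_def[symmetric] u_def[symmetric] if_not_P[OF False]
        using assms pos by (intro mult_left_mono) auto
    qed (use pos in \<open>simp add: ATI_bound_def\<close>)
    also have "\<dots> \<le> K * (1 + u) powr (2 * \<omega>) * (1 / mass t x y) * (C * (1 + u) powr (- (N + 2 * \<omega>))) * 1"
      using 1 C(1) C(2)[OF u] K mass_pos[OF t, of x y] by (intro mult_mono) auto
    also have "\<dots> = K * C * (1 / mass t x y) * ((1 + u) powr (2 * \<omega>) * (1 + u) powr (- (N + 2 * \<omega>)))"
      by simp
    also have "(1 + u) powr (2 * \<omega>) * (1 + u) powr (- (N + 2 * \<omega>)) = (1 + u) powr (- N)"
      by (simp add: powr_add[symmetric])
    finally show ?thesis
      by (simp add: decay_def t_def u_def)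
  qed
  with K C(1) show ?thesis
    by (intro exI[of _ "K * C"]) auto
qed

end

section \<open>Distributions and the action of the kernels on test functions\<close>

lemma norm_integral_le_integral:
  fixes f :: "'a \<Rightarrow> 'b::{banach, second_countable_topology}" and g :: "'a \<Rightarrow> real"
  assumes "integrable M f" "integrable M g" "\<And>x. norm (f x) \<le> g x"
  shows "norm (\<integral>x. f x \<partial>M) \<le> (\<integral>x. g x \<partial>M)"
  by (rule order_trans[OF integral_norm_bound integral_mono]) (use assms in auto)

locale ATI_space = homogeneous_space_with_points d A0 M Cmu c0 C0 \<delta> A z
  for d :: "'a \<Rightarrow> 'a \<Rightarrow> real" and A0 :: real and M :: "'a measure" and Cmu c0 C0 \<delta> :: real
    and A :: "int \<Rightarrow> 'i set" and z :: "int \<Rightarrow> 'i \<Rightarrow> 'a" +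
  fixes \<eta> \<beta> \<gamma> :: real and Q :: "int \<Rightarrow> 'a \<Rightarrow> 'a \<Rightarrow> complex" and x0 :: 'a
  assumes \<eta>_range: "0 < \<eta>" "\<eta> < 1"
    and ATI: "exp_ATI M d \<delta> (new_points A z) \<eta> Q"
    and \<beta>_range: "0 < \<beta>" "\<beta> < \<eta>" and \<gamma>_range: "0 < \<gamma>" "\<gamma> < \<eta>"
begin

abbreviation closure_space :: "('a \<Rightarrow> complex) set" where
  "closure_space \<equiv> test_closure M d A0 x0 \<eta> \<beta> \<gamma>"

abbreviation distrs :: "(('a \<Rightarrow> complex) \<Rightarrow> complex) set" where
  "distrs \<equiv> distributions M d A0 x0 \<eta> \<beta> \<gamma>"

abbreviation induced :: "('a \<Rightarrow> complex) \<Rightarrow> ('a \<Rightarrow> complex) \<Rightarrow> complex" where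
  "induced \<equiv> induced_distribution M d A0 x0 \<eta> \<beta> \<gamma>"

text \<open>The kernel estimates in the form in which they are applied, with polynomial decay of a
  prescribed order in place of the exponential. The function \<open>E\<close> is kept so that each
  application can decide afterwards which variable is the centre of the decay.\<close>

definition kernel_majorant :: "real \<Rightarrow> real \<Rightarrow> (int \<Rightarrow> 'a \<Rightarrow> 'a \<Rightarrow> real) \<Rightarrow> bool" where
  "kernel_majorant N C E \<longleftrightarrow> 0 < C \<and>
    (\<forall>k x y. E k x y \<le> C * decay (\<delta> powi k) x N y) \<and>
    (\<forall>k x y. E k x y \<le> C * decay (\<delta> powi k) y N x) \<and>
    (\<forall>k x y. norm (Q k x y) \<le> E k x y) \<and>
    (\<forall>k x x' y. d x x' \<le> \<delta> powi k \<longrightarrow> norm (Q k x y - Q k x' y) \<le> (d x x' / \<delta> powi k) powr \<eta> * E k x y) \<and>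
    (\<forall>k x x' y. d x x' \<le> \<delta> powi k \<longrightarrow> norm (Q k y x - Q k y x') \<le> (d x x' / \<delta> powi k) powr \<eta> * E k x y) \<and>
    (\<forall>k x x' y y'. d x x' \<le> \<delta> powi k \<longrightarrow> d y y' \<le> \<delta> powi k \<longrightarrow>
      norm ((Q k x y - Q k x' y) - (Q k x y' - Q k x' y'))
        \<le> (d x x' / \<delta> powi k) powr \<eta> * (d y y' / \<delta> powi k) powr \<eta> * E k x y)"

lemma kernel_majorantD:
  assumes "kernel_majorant N C E"
  shows "0 < C" "E k x y \<le> C * decay (\<delta> powi k) x N y" "E k x y \<le> C * decay (\<delta> powi k) y N x"
    "norm (Q k x y) \<le> E k x y"
    "d x x' \<le> \<delta> powi k \<Longrightarrow> norm (Q k x y - Q k x' y) \<le> (d x x' / \<delta> powi k) powr \<eta> * E k x y"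
    "d x x' \<le> \<delta> powi k \<Longrightarrow> norm (Q k y x - Q k y x') \<le> (d x x' / \<delta> powi k) powr \<eta> * E k x y"
    "d x x' \<le> \<delta> powi k \<Longrightarrow> d y y' \<le> \<delta> powi k \<Longrightarrow>
      norm ((Q k x y - Q k x' y) - (Q k x y' - Q k x' y'))
        \<le> (d x x' / \<delta> powi k) powr \<eta> * (d y y' / \<delta> powi k) powr \<eta> * E k x y"
  using assms unfolding kernel_majorant_def by simp_all

lemma ex_kernel_majorant:
  assumes "0 \<le> N"
  shows "\<exists>C E. kernel_majorant N C E"
proof -
  obtain C \<nu> a where C: "0 < C" "0 < \<nu>" "0 < a"
    and Q1: "\<forall>k x y. norm (Q k x y) \<le> C * ATI_bound M d \<delta> (new_points A z) \<nu> a k x y"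
    and Q2: "\<forall>k x x' y. d x x' \<le> \<delta> powi k \<longrightarrow> norm (Q k x y - Q k x' y) + norm (Q k y x - Q k y x')
            \<le> C * (d x x' / \<delta> powi k) powr \<eta> * ATI_bound M d \<delta> (new_points A z) \<nu> a k x y"
    and Q3: "\<forall>k x x' y y'. d x x' \<le> \<delta> powi k \<longrightarrow> d y y' \<le> \<delta> powi k \<longrightarrow>
          norm ((Q k x y - Q k x' y) - (Q k x y' - Q k x' y'))
            \<le> C * (d x x' / \<delta> powi k) powr \<eta> * (d y y' / \<delta> powi k) powr \<eta> *
              ATI_bound M d \<delta> (new_points A z) \<nu> a k x y"
    using ATI unfolding exp_ATI_def Let_def by (elim conjE exE) (rule that; assumption)
  note Q1 = Q1[rule_format] and Q2 = Q2[rule_format] and Q3 = Q3[rule_format]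
  obtain C' where C': "0 < C'" "\<And>k x y. ATI_bound M d \<delta> (new_points A z) \<nu> a k x y \<le> C' * decay (\<delta> powi k) x N y"
    using ATI_bound_le_decay[OF C(2,3) assms] by blast
  define E where "E k x y = C * ATI_bound M d \<delta> (new_points A z) \<nu> a k x y" for k x y
  have "kernel_majorant N (C * C') E"
    unfolding kernel_majorant_def
  proof (intro conjI allI impI)
    show "0 < C * C'" using C C' by simp
    show "E k x y \<le> C * C' * decay (\<delta> powi k) x N y" for k x y
      using C'(2)[of k x y] C by (simp add: E_def mult.assoc)
    show "E k x y \<le> C * C' * decay (\<delta> powi k) y N x" for k x y
      using C'(2)[of k y x] C by (simp add: E_def mult.assoc ATI_bound_sym[of _ _ _ _ x])
    show "norm (Q k x y) \<le> E k x y" for k x y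
      using Q1 by (simp add: E_def)
    show "norm (Q k x y - Q k x' y) \<le> (d x x' / \<delta> powi k) powr \<eta> * E k x y"
      "norm (Q k y x - Q k y x') \<le> (d x x' / \<delta> powi k) powr \<eta> * E k x y" if "d x x' \<le> \<delta> powi k" for k x x' y
      using Q2[OF that, of y] norm_ge_zero[of "Q k x y - Q k x' y"] norm_ge_zero[of "Q k y x - Q k y x'"]
      unfolding E_def by (simp_all add: mult_ac del: norm_ge_zero)
    show "norm ((Q k x y - Q k x' y) - (Q k x y' - Q k x' y'))
        \<le> (d x x' / \<delta> powi k) powr \<eta> * (d y y' / \<delta> powi k) powr \<eta> * E k x y"
      if "d x x' \<le> \<delta> powi k" "d y y' \<le> \<delta> powi k" for k x x' y y'
      using Q3[OF that] by (simp add: E_def mult_ac)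
  qed
  then show ?thesis by blast
qed

lemma integral_kernel: "(\<integral>y. Q k x y \<partial>M) = 0"
  using ATI by (simp add: exp_ATI_def)

text \<open>Both claims are instances of \<open>bump_test_bound\<close>, which asks for the doubled
  exponent \<open>2 * \<eta>\<close>. For the difference of two kernels, first-order regularity
  supplies the size and the mixed second-order estimate supplies the regularity, each with the small
  factor in front.\<close>

lemma kernel_test_bounds:
  "\<exists>B>0. test_bound M d A0 x0 \<eta> \<eta> B (Q k x) \<and>
    (\<forall>x'. d x x' \<le> \<delta> powi k \<longrightarrow>
      test_bound M d A0 x0 \<eta> \<eta> ((d x x' / \<delta> powi k) powr \<eta> * B) (\<lambda>y. Q k x y - Q k x' y))"
proof -
  have "0 \<le> 2 * \<eta>" using \<eta>_range by simp
  then obtain C E where "kernel_majorant (2 * \<eta>) C E"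
    using ex_kernel_majorant by blast
  note K = kernel_majorantD[OF this]
  define t where "t = \<delta> powi k"
  have t: "0 < t" by (simp add: t_def)
  note K = K(1) K(2-7)[where k = k, folded t_def]
  obtain B where "0 < B" and B: "\<forall>f c. 0 \<le> c \<longrightarrow> (\<forall>y. norm (f y) \<le> c * decay t x (2 * \<eta>) y) \<longrightarrow>
    (\<forall>y y'. d y y' \<le> t \<longrightarrow> norm (f y - f y') \<le> c * (d y y' / t) powr \<eta> * decay t x (2 * \<eta>) y) \<longrightarrow>
    test_bound M d A0 x0 \<eta> \<eta> (c * B) f"
    using bump_test_bound[OF t \<eta>_range(1), of x x0] by (elim exE conjE) (rule that)
  note B = \<open>0 < B\<close> B[rule_format]
  have "test_bound M d A0 x0 \<eta> \<eta> (C * B) (Q k x)"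
  proof (rule B(2))
    fix y y'
    show "norm (Q k x y) \<le> C * decay t x (2 * \<eta>) y"
      using K(4)[of x y] K(2)[of x y] by (rule order_trans)
    assume "d y y' \<le> t"
    from K(6)[OF this, of x] mult_left_mono[OF K(3)[of y x], of "(d y y' / t) powr \<eta>"]
    show "norm (Q k x y - Q k x y') \<le> C * (d y y' / t) powr \<eta> * decay t x (2 * \<eta>) y"
      by (simp add: mult_ac)
  qed (use K in simp)
  moreover have "test_bound M d A0 x0 \<eta> \<eta> ((d x x' / t) powr \<eta> * (C * B)) (\<lambda>y. Q k x y - Q k x' y)"
    if x': "d x x' \<le> t" for x'
  proof -
    have "test_bound M d A0 x0 \<eta> \<eta> ((d x x' / t) powr \<eta> * C * B) (\<lambda>y. Q k x y - Q k x' y)"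
    proof (rule B(2))
      fix y y'
      show "norm (Q k x y - Q k x' y) \<le> (d x x' / t) powr \<eta> * C * decay t x (2 * \<eta>) y"
        using K(5)[OF x', of y] mult_left_mono[OF K(2)[of x y], of "(d x x' / t) powr \<eta>"]
        by (simp add: mult_ac)
      assume "d y y' \<le> t"
      from K(7)[OF x' this] mult_left_mono[OF K(2)[of x y], of "(d x x' / t) powr \<eta> * (d y y' / t) powr \<eta>"]
      show "norm (Q k x y - Q k x' y - (Q k x y' - Q k x' y')) \<le>
          (d x x' / t) powr \<eta> * C * (d y y' / t) powr \<eta> * decay t x (2 * \<eta>) y"
        by (simp add: mult_ac)
    qed (use K in simp)
    then show ?thesis by (simp add: mult.assoc)
  qed
  ultimately show ?thesis
    unfolding t_def using B(1) K(1) by (intro exI[of _ "C * B"]) auto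
qed

lemma test_funs_eta_subset: "test_funs M d A0 x0 \<eta> \<eta> \<subseteq> test_funs M d A0 x0 \<beta> \<gamma>"
  using \<beta>_range \<gamma>_range by (intro test_funs_subset) auto

lemma kernel_test_fun: "Q k x \<in> test_funs_mean0 M d A0 x0 \<eta> \<eta>"
  using kernel_test_bounds[of k x] integral_kernel[of k x]
  by (auto simp: test_funs_mean0_def test_funs_def)

text \<open>This makes \<open>apply_kernel\<close> meaningful: distributions are
  \<open>extensional\<close>, so outside the closure they carry no information.\<close>

lemma kernel_closure: "Q k x \<in> closure_space"
  using kernel_test_fun test_funs_mean0_subset_closure[OF test_funs_eta_subset] by blast

lemma closure_space_add: "f \<in> closure_space \<Longrightarrow> f' \<in> closure_space \<Longrightarrow> (\<lambda>x. f x + f' x) \<in> closure_space"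
  using \<beta>_range \<gamma>_range by (intro test_closure_add test_funs_eta_subset) auto

lemma closure_space_cmult: "f \<in> closure_space \<Longrightarrow> (\<lambda>x. c * f x) \<in> closure_space"
  by (intro test_closure_cmult test_funs_eta_subset)

lemma kernel_integrable: "integrable M (Q k x)"
  using kernel_test_fun[of k x] \<eta>_range test_funs_integrable[of "Q k x" x0 \<eta> \<eta>]
  by (simp add: test_funs_mean0_def)

text \<open>The mixed regularity of the kernels makes \<open>x \<mapsto> Q k x\<close> continuous into the space of test functions.\<close>

lemma distribution_kernel_measurable:
  assumes "\<phi> \<in> distrs"
  shows "(\<lambda>x. apply_kernel (Q k) \<phi> x) \<in> borel_measurable M"
proof (rule locally_Holder_imp_borel_measurable[OF \<eta>_range(1)])
  fix x
  obtain B where B: "0 < B" "\<And>x'. d x x' \<le> \<delta> powi k \<Longrightarrow>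
      test_bound M d A0 x0 \<eta> \<eta> ((d x x' / \<delta> powi k) powr \<eta> * B) (\<lambda>y. Q k x y - Q k x' y)"
    using kernel_test_bounds[of k x] by blast
  obtain K where K: "\<And>f. f \<in> closure_space \<Longrightarrow> norm (\<phi> f) \<le> K * test_norm M d A0 x0 \<beta> \<gamma> f"
    and add: "\<And>f g. f \<in> closure_space \<Longrightarrow> g \<in> closure_space \<Longrightarrow> \<phi> (\<lambda>x. f x + g x) = \<phi> f + \<phi> g"
    and mult: "\<And>f c. f \<in> closure_space \<Longrightarrow> \<phi> (\<lambda>x. c * f x) = c * \<phi> f"
    using assms unfolding distributions_def by blast
  have "dist (apply_kernel (Q k) \<phi> x') (apply_kernel (Q k) \<phi> x)
      \<le> (\<bar>K\<bar> * B / (\<delta> powi k) powr \<eta>) * d x x' powr \<eta>" if le: "d x x' \<le> \<delta> powi k" for x'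
  proof (cases "x = x'")
    \<comment> \<open>Distinct points make the constant in the test bound positive, as
      \<open>test_norm_le\<close> requires.\<close>
    case False
    then have "0 < d x x'"
      using d_nonneg[of x x'] d_zero_iff[of x x'] by linarith
    define h where "h = (\<lambda>y. Q k x y + (-1) * Q k x' y)"
    have h: "h \<in> closure_space"
      unfolding h_def by (intro closure_space_add closure_space_cmult kernel_closure)
    have "\<phi> h = \<phi> (Q k x) - \<phi> (Q k x')"
      unfolding h_def
      using add[OF kernel_closure closure_space_cmult[OF kernel_closure], of k x "-1" k x']
        mult[OF kernel_closure, of "-1" k x'] by simp
    then have "dist (apply_kernel (Q k) \<phi> x') (apply_kernel (Q k) \<phi> x) = norm (\<phi> h)"
      by (simp add: apply_kernel_def dist_norm norm_minus_commute)
    also have "\<dots> \<le> K * test_norm M d A0 x0 \<beta> \<gamma> h"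
      by (rule K[OF h])
    \<comment> \<open>The bound \<open>K\<close> of the functional has no prescribed sign, so its
      absolute value is used together with the nonnegativity of the norm.\<close>
    also have "\<dots> \<le> \<bar>K\<bar> * ((d x x' / \<delta> powi k) powr \<eta> * B)"
    proof -
      have "test_bound M d A0 x0 \<beta> \<gamma> ((d x x' / \<delta> powi k) powr \<eta> * B) h"
        using test_bound_mono_exponents[OF B(2)[OF le]] B(1) \<beta>_range \<gamma>_range by (simp add: h_def)
      then have "test_norm M d A0 x0 \<beta> \<gamma> h \<le> (d x x' / \<delta> powi k) powr \<eta> * B"
        using B(1) \<open>0 < d x x'\<close> delta_pos by (intro test_norm_le mult_pos_pos) auto
      moreover have "0 \<le> test_norm M d A0 x0 \<beta> \<gamma> h"
        using h unfolding test_norm_def test_closure_def test_funs_mean0_def test_funs_def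
        by (intro cInf_greatest) auto
      ultimately show ?thesis
        by (intro mult_mono) auto
    qed
    also have "\<dots> = (\<bar>K\<bar> * B / (\<delta> powi k) powr \<eta>) * d x x' powr \<eta>"
      using scale_pos[of k] d_nonneg[of x x'] by (simp add: powr_divide)
    finally show ?thesis .
  qed simp
  then show "\<exists>\<rho>>0. \<exists>K. \<forall>y. d x y \<le> \<rho> \<longrightarrow>
      dist (apply_kernel (Q k) \<phi> y) (apply_kernel (Q k) \<phi> x) \<le> K * d x y powr \<eta>"
    using scale_pos[of k] by blast
qed

section \<open>Pairing of test functions, and the two scale estimates\<close>

text \<open>Only one factor needs to be integrable: \<open>h\<close> is bounded by a multiple of the
  inverse volume of the unit ball around \<open>x0\<close>.\<close>

lemma test_fun_mult_closure_integrable: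
  assumes "f \<in> test_funs M d A0 x0 b g" "0 < b" "0 < g" "h \<in> closure_space"
  shows "integrable M (\<lambda>x. f x * h x)"
proof -
  obtain C where C: "0 < C" "test_bound M d A0 x0 b g C f"
    using assms(1) by (auto simp: test_funs_def)
  obtain C' where C': "0 < C'" "test_bound M d A0 x0 \<beta> \<gamma> C' h" and "h \<in> test_funs M d A0 x0 \<beta> \<gamma>"
    using assms(4) by (auto simp: test_closure_def test_funs_mean0_def test_funs_def)
  then have [measurable]: "f \<in> borel_measurable M" "h \<in> borel_measurable M"
    using test_funs_measurable[OF assms(1,2)] test_funs_measurable[of h x0 \<beta> \<gamma>] \<beta>_range by auto
  have "norm (f x * h x) \<le> (C * (C' / V 1 x0)) * decay 1 x0 g x" for x
  proof -
    have "norm (h x) \<le> C' * decay 1 x0 \<gamma> x"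
      by (rule test_bound_size) fact
    also have "\<dots> \<le> C' * (1 / V 1 x0)"
      using C' \<gamma>_range by (intro mult_left_mono decay_le_inverse_V) auto
    finally have "norm (f x) * norm (h x) \<le> (C * decay 1 x0 g x) * (C' * (1 / V 1 x0))"
      using test_bound_size[OF C(2), of x] C(1) by (intro mult_mono) auto
    then show ?thesis by (simp add: norm_mult mult_ac)
  qed
  then show ?thesis
    by (intro integrable_decay_bound[where t=1 and g=g and ?x0.0=x0 and C="C * (C' / V 1 x0)"]) (use assms in auto)
qed

lemma induced_in_distributions:
  assumes f: "f \<in> test_funs M d A0 x0 b g" and bg: "0 < b" "0 < g"
  shows "induced f \<in> distrs"
proof -
  note int = test_fun_mult_closure_integrable[OF f bg]
  obtain C where C: "0 < C" "test_bound M d A0 x0 b g C f"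
    using f by (auto simp: test_funs_def)
  \<comment> \<open>The summand 1 makes \<open>K\<close> positive, so that one may divide by it
    before passing to the infimum.\<close>
  define K where "K = C * (\<integral>x. decay 1 x0 g x \<partial>M) / V 1 x0 + 1"
  have V1: "0 < V 1 x0" by (rule V_pos) simp
  have int_nonneg: "0 \<le> (\<integral>x. decay 1 x0 g x \<partial>M)"
    by (rule Bochner_Integration.integral_nonneg) simp
  then have K: "0 < K"
    unfolding K_def using C V1 by (intro add_nonneg_pos divide_nonneg_pos mult_nonneg_nonneg) auto
  have bound: "norm (\<integral>x. f x * h x \<partial>M) \<le> K * test_norm M d A0 x0 \<beta> \<gamma> h" if h: "h \<in> closure_space" for h
  proof -
    \<comment> \<open>The estimate is proved for every admissible constant of \<open>h\<close>; the
      norm is their infimum.\<close>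
    have "norm (\<integral>x. f x * h x \<partial>M) / K \<le> C'" if C': "0 < C'" "test_bound M d A0 x0 \<beta> \<gamma> C' h" for C'
    proof -
      have "norm (\<integral>x. f x * h x \<partial>M) \<le> (\<integral>x. (C * (C' / V 1 x0)) * decay 1 x0 g x \<partial>M)"
      proof (rule norm_integral_le_integral[OF int[OF h]])
        show "integrable M (\<lambda>x. C * (C' / V 1 x0) * decay 1 x0 g x)"
          using decay_integrable[OF bg(2)] by simp
        fix x
        have "norm (h x) \<le> C' * decay 1 x0 \<gamma> x"
          by (rule test_bound_size) fact
        also have "\<dots> \<le> C' * (1 / V 1 x0)"
          using C' \<gamma>_range by (intro mult_left_mono decay_le_inverse_V) auto
        finally have "norm (f x) * norm (h x) \<le> (C * decay 1 x0 g x) * (C' * (1 / V 1 x0))"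
          using test_bound_size[OF C(2), of x] C(1) by (intro mult_mono) auto
        then show "norm (f x * h x) \<le> C * (C' / V 1 x0) * decay 1 x0 g x"
          by (simp add: norm_mult mult_ac)
      qed
      also have "\<dots> = C' * (K - 1)"
        by (simp add: K_def)
      also have "\<dots> \<le> C' * K"
        using C'(1) by simp
      finally show ?thesis
        using K by (simp add: divide_le_eq)
    qed
    moreover have "{C. 0 < C \<and> test_bound M d A0 x0 \<beta> \<gamma> C h} \<noteq> {}"
      using h by (auto simp: test_closure_def test_funs_mean0_def test_funs_def)
    ultimately have "norm (\<integral>x. f x * h x \<partial>M) / K \<le> test_norm M d A0 x0 \<beta> \<gamma> h"
      unfolding test_norm_def by (intro cInf_greatest) auto
    then show ?thesis
      using K by (simp add: divide_le_eq mult.commute)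
  qed
  show ?thesis
    unfolding distributions_def induced_distribution_def
  proof (intro CollectI conjI ballI allI exI)
    fix h h' c assume h: "h \<in> closure_space"
    show "restrict (\<lambda>g. \<integral>x. f x * g x \<partial>M) closure_space (\<lambda>x. c * h x) =
        c * restrict (\<lambda>g. \<integral>x. f x * g x \<partial>M) closure_space h"
      using h closure_space_cmult[OF h, of c] by (simp add: mult.left_commute)
    show "norm (restrict (\<lambda>g. \<integral>x. f x * g x \<partial>M) closure_space h) \<le> K * test_norm M d A0 x0 \<beta> \<gamma> h"
      using bound[OF h] h by simp
    assume h': "h' \<in> closure_space"
    show "restrict (\<lambda>g. \<integral>x. f x * g x \<partial>M) closure_space (\<lambda>x. h x + h' x) =
        restrict (\<lambda>g. \<integral>x. f x * g x \<partial>M) closure_space h + restrict (\<lambda>g. \<integral>x. f x * g x \<partial>M) closure_space h'"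
      using h h' closure_space_add[OF h h'] int[OF h] int[OF h'] by (simp add: distrib_left)
  qed simp
qed

lemma apply_kernel_induced: "apply_kernel (Q k) (induced f) x = (\<integral>y. f y * Q k x y \<partial>M)"
  by (simp add: apply_kernel_def induced_distribution_def kernel_closure)

text \<open>Fine scales: the cancellation of the kernel is used, and \<open>f x\<close> is subtracted from \<open>f y\<close>.\<close>

lemma kernel_action_fine_scale:
  assumes f: "f \<in> test_funs M d A0 x0 b g" and bg: "0 < b" "0 < g"
  shows "\<exists>C\<ge>0. \<forall>k\<ge>0. \<forall>x. norm (apply_kernel (Q k) (induced f) x)
    \<le> C * (\<delta> powi k) powr b * decay 1 x0 g x"
proof -
  obtain Cf where Cf: "0 < Cf" "test_bound M d A0 x0 b g Cf f"
    using f by (auto simp: test_funs_def)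
  \<comment> \<open>The share \<open>b\<close> absorbs the power of the distance and
    \<open>g + 1\<close> remains for integrability. Far from \<open>x\<close>, \<open>N\<close> must
    also dominate both \<open>b\<close> and \<open>g\<close>.\<close>
  define N where "N = b + g + 1"
  have "0 \<le> N" using bg by (simp add: N_def)
  then obtain CK E where maj: "kernel_majorant N CK E"
    using ex_kernel_majorant by blast
  note CK = kernel_majorantD(1)[OF maj]
  have Q: "norm (Q k x y) \<le> CK * decay (\<delta> powi k) x N y" for k x y
    using kernel_majorantD(4)[OF maj] kernel_majorantD(2)[OF maj] by (rule order_trans)
  obtain I where I: "0 \<le> I" "\<And>t x. 0 < t \<Longrightarrow> (\<integral>y. decay t x (g + 1) y \<partial>M) \<le> I"
    using decay_integral_bounded[of "g + 1"] bg by auto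
  obtain I' where I': "0 \<le> I'" "\<And>t x. 0 < t \<Longrightarrow> (\<integral>y. decay t x g y \<partial>M) \<le> I'"
    using decay_integral_bounded[of g] bg by auto
  \<comment> \<open>\<open>k1\<close> belongs to the terms whose integration is carried by the
    kernel, \<open>k2\<close> to the far term, whose integration is carried by
    \<open>f\<close>.\<close>
  define k1 where "k1 = Cf * CK * (2 * A0) powr b"
  define k2 where "k2 = Cf * CK * mass_const (4 * A0\<^sup>2) * (2 * A0) powr N"
  have "1 \<le> 4 * A0\<^sup>2" using A0_ge_1 one_le_power[OF A0_ge_1, of 2] by linarith
  then have mc: "0 < mass_const (4 * A0\<^sup>2)" by (rule mass_const_pos)
  have k12: "0 \<le> k1" "0 \<le> k2" using Cf CK mc by (auto simp: k1_def k2_def)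
  have "norm (apply_kernel (Q k) (induced f) x) \<le> (k1 * I + k2 * I') * (\<delta> powi k) powr b * decay 1 x0 g x"
    if k: "0 \<le> k" for k x
  proof -
    define t where "t = \<delta> powi k"
    have t: "0 < t" "t \<le> 1"
      using k delta_pos delta_less_1 by (auto simp: t_def power_int_def power_le_one)
    define R where "R = 1 + d x0 x"
    have R: "1 \<le> R" by (simp add: R_def d_nonneg)
    define D where "D = decay 1 x0 g x"
    have D: "0 \<le> D" by (simp add: D_def)
    have absorb: "(d x y / t) powr b * decay t x N y \<le> decay t x (g + 1) y" for y
      using decay_absorb_powr[of t b x y N] t bg by (simp add: N_def add_ac)
    have pointwise: "norm ((f y - f x) * Q k x y) \<le>
        t powr b * D * (k1 * decay t x (g + 1) y + k2 * decay 1 x0 g y)" for y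
    proof -
      define u where "u = d x y / t"
      have u: "0 \<le> u" "d x y = t * u" using t d_nonneg by (auto simp: u_def)
      \<comment> \<open>Shared by two terms: the difference \<open>f y - f x\<close> near
        \<open>x\<close>, and \<open>f x\<close> alone far from \<open>x\<close>. Both are at most
        the stated multiple of \<open>d x y powr b\<close>.\<close>
      have main: "w * norm (Q k x y) \<le> t powr b * D * (k1 * decay t x (g + 1) y)"
        if w: "0 \<le> w" "w \<le> Cf * (2 * A0) powr b * (d x y powr b) * D" for w
      proof -
        have "w * norm (Q k x y) \<le> (Cf * (2 * A0) powr b * (t powr b * u powr b) * D) * (CK * decay t x N y)"
          using w Q[of k x y] CK t u by (intro mult_mono) (auto simp: powr_mult t_def)
        also have "\<dots> = (k1 * (t powr b * D)) * (u powr b * decay t x N y)"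
          by (simp add: k1_def mult_ac)
        also have "\<dots> \<le> (k1 * (t powr b * D)) * decay t x (g + 1) y"
          using absorb[of y] k12 D t by (intro mult_left_mono) (auto simp: u_def)
        finally show ?thesis by (simp add: mult_ac)
      qed
      show ?thesis
      proof (cases "d x y \<le> R / (2 * A0)")
        case True
        have "norm (f y - f x) \<le> Cf * (d x y / R) powr b * D"
          using test_bound_regular[OF Cf(2), of x y] True by (simp add: R_def D_def norm_minus_commute)
        also have "\<dots> \<le> Cf * ((2 * A0) powr b * d x y powr b) * D"
        proof (intro mult_right_mono mult_left_mono)
          have "(d x y / R) powr b \<le> 1 * d x y powr b"
            using R d_nonneg[of x y] bg by (simp add: powr_mono2 divide_le_eq mult_le_cancel_left1)
          also have "\<dots> \<le> (2 * A0) powr b * d x y powr b"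
            using A0_ge_1 bg by (intro mult_right_mono ge_one_powr_ge_zero) auto
          finally show "(d x y / R) powr b \<le> (2 * A0) powr b * d x y powr b" .
        qed (use Cf D in auto)
        finally have "norm ((f y - f x) * Q k x y) \<le> t powr b * D * (k1 * decay t x (g + 1) y)"
          unfolding norm_mult by (intro main) (auto simp: mult.assoc)
        also have "\<dots> \<le> t powr b * D * (k1 * decay t x (g + 1) y + k2 * decay 1 x0 g y)"
          using D k12 by (intro mult_left_mono) auto
        finally show ?thesis .
      next
        case False
        \<comment> \<open>Since \<open>R >= 1\<close>, this makes \<open>2 * A0 * d x y\<close> at
          least 1, so its power \<open>b\<close> can be inserted as a factor in the bound of
          \<open>f x\<close>.\<close>
        have far: "R \<le> 2 * A0 * d x y"
          using False A0_pos by (simp add: field_simps)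
        have "Cf * D * 1 \<le> Cf * D * (2 * A0 * d x y) powr b"
          using far R bg Cf D by (intro mult_left_mono ge_one_powr_ge_zero) auto
        then have "norm (f x) \<le> Cf * (2 * A0) powr b * (d x y powr b) * D"
          using test_bound_size[OF Cf(2), of x] A0_pos d_nonneg[of x y]
          by (simp add: D_def powr_mult mult_ac)
        then have 1: "norm (f x) * norm (Q k x y) \<le> t powr b * D * (k1 * decay t x (g + 1) y)"
          by (intro main) auto
        \<comment> \<open>Far away the kernel itself is as small as required: its decay yields
          \<open>(t / R)^N\<close>, which is at most \<open>t^b * R^(- g)\<close> because
          \<open>t <= 1 <= R\<close>.\<close>
        have "norm (Q k x y) \<le> CK * mass_const (4 * A0\<^sup>2) * (2 * A0) powr N * (t powr b * D)"
        proof -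
          have "1 / mass t x y \<le> mass_const (4 * A0\<^sup>2) * (1 / mass 1 x0 x)"
          proof (rule inverse_mass_compare)
            have "1 + d x0 x + d x x0 \<le> 2 * R" by (simp add: R_def d_sym[of x] d_nonneg)
            also have "\<dots> \<le> 2 * (2 * A0 * d x y)" using far by simp
            also have "\<dots> \<le> 4 * A0\<^sup>2 * d x y"
              using A0_ge_1 d_nonneg[of x y] self_le_power[OF A0_ge_1, of 2] by (simp add: mult_right_mono)
            also have "\<dots> \<le> 4 * A0\<^sup>2 * (t + d x y)" using t by (intro mult_left_mono) auto
            finally show "1 + d x0 x + d x x0 \<le> 4 * A0\<^sup>2 * (t + d x y)" .
          qed (use t \<open>1 \<le> 4 * A0\<^sup>2\<close> in auto)
          moreover have "(1 + d x y / t) powr (- N) \<le> (2 * A0) powr N * (t powr b * R powr (- g))"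
          proof -
            have N: "0 \<le> N" "b \<le> N" "g \<le> N" using bg by (auto simp: N_def)
            have "R / (2 * A0 * t) \<le> 1 + d x y / t"
            proof -
              have "R / (2 * A0 * t) \<le> (2 * A0 * d x y) / (2 * A0 * t)"
                using far A0_pos t by (intro divide_right_mono) auto
              also have "\<dots> \<le> 1 + d x y / t" using A0_pos by simp
              finally show ?thesis .
            qed
            then have "(1 + d x y / t) powr (- N) \<le> (R / (2 * A0 * t)) powr (- N)"
              using R A0_pos t N by (intro powr_mono2') auto
            also have "\<dots> = (2 * A0) powr N * (t powr N * R powr (- N))"
              using R A0_pos t by (simp add: powr_divide powr_mult powr_minus field_simps)
            also have "\<dots> \<le> (2 * A0) powr N * (t powr b * R powr (- g))"
              using R t N A0_pos by (intro mult_left_mono mult_mono powr_mono powr_mono') auto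
            finally show ?thesis .
          qed
          ultimately have "decay t x N y \<le> (mass_const (4 * A0\<^sup>2) * (1 / mass 1 x0 x)) *
              ((2 * A0) powr N * (t powr b * R powr (- g)))"
            unfolding decay_def using mc mass_pos[of 1 x0 x] by (intro mult_mono) auto
          also have "\<dots> = mass_const (4 * A0\<^sup>2) * (2 * A0) powr N * (t powr b * D)"
            by (simp add: D_def decay_def R_def)
          finally have "CK * decay t x N y \<le> CK * (mass_const (4 * A0\<^sup>2) * (2 * A0) powr N * (t powr b * D))"
            using CK by (intro mult_left_mono) auto
          then show ?thesis
            using Q[of k x y] by (simp add: t_def mult.assoc)
        qed
        then have "norm (f y) * norm (Q k x y) \<le> (Cf * decay 1 x0 g y) *
            (CK * mass_const (4 * A0\<^sup>2) * (2 * A0) powr N * (t powr b * D))"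
          using test_bound_size[OF Cf(2), of y] Cf by (intro mult_mono) auto
        also have "\<dots> = t powr b * D * (k2 * decay 1 x0 g y)"
          by (simp add: k2_def mult_ac)
        finally have 2: "norm (f y) * norm (Q k x y) \<le> t powr b * D * (k2 * decay 1 x0 g y)" .
        have "norm ((f y - f x) * Q k x y) \<le> (norm (f y) + norm (f x)) * norm (Q k x y)"
          unfolding norm_mult by (intro mult_right_mono norm_triangle_ineq4) auto
        then show ?thesis
          using 1 2 by (simp add: distrib_left distrib_right)
      qed
    qed
    have int1: "integrable M (\<lambda>y. f y * Q k x y)"
      by (rule test_fun_mult_closure_integrable[OF f bg kernel_closure])
    have int2: "integrable M (\<lambda>y. f x * Q k x y)"
      using kernel_integrable by simp
    \<comment> \<open>Subtracting \<open>f x\<close> is free, because the kernel has integral zero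
      in \<open>y\<close>.\<close>
    have "apply_kernel (Q k) (induced f) x = (\<integral>y. (f y - f x) * Q k x y \<partial>M)"
      using int1 int2 by (simp add: apply_kernel_induced left_diff_distrib integral_kernel)
    also have "norm \<dots> \<le> (\<integral>y. t powr b * D * (k1 * decay t x (g + 1) y + k2 * decay 1 x0 g y) \<partial>M)"
      using int1 int2 decay_integrable[of "g + 1" t x] decay_integrable[of g 1 x0] t bg
      by (intro norm_integral_le_integral pointwise) (auto simp: left_diff_distrib)
    also have "\<dots> = t powr b * D * (k1 * (\<integral>y. decay t x (g + 1) y \<partial>M) + k2 * (\<integral>y. decay 1 x0 g y \<partial>M))"
      using decay_integrable[of "g + 1" t x] decay_integrable[of g 1 x0] t bg by simp
    also have "\<dots> \<le> t powr b * D * (k1 * I + k2 * I')"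
      using I(2)[of t x] I'(2)[of 1 x0] t k12 D by (intro mult_left_mono add_mono) auto
    finally show ?thesis
      by (simp add: t_def D_def mult_ac)
  qed
  moreover have "0 \<le> k1 * I + k2 * I'"
    using k12 I I' by simp
  ultimately show ?thesis by blast
qed

text \<open>Coarse scales: the cancellation of \<open>f\<close> is used, and \<open>Q k x x0\<close> is subtracted from \<open>Q k x y\<close>.\<close>

lemma kernel_action_coarse_scale:
  assumes f: "f \<in> test_funs M d A0 x0 b g" and mean: "(\<integral>y. f y \<partial>M) = 0" and b: "0 < b"
    and h: "0 < h" "h < g" "h \<le> \<eta>"
  shows "\<exists>C\<ge>0. \<forall>k\<le>0. \<forall>x. norm (apply_kernel (Q k) (induced f) x)
    \<le> C * (\<delta> powi k) powr (- h) * decay (\<delta> powi k) x0 h x"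
proof -
  have g: "0 < g" using h by linarith
  obtain Cf where Cf: "0 < Cf" "test_bound M d A0 x0 b g Cf f"
    using f by (auto simp: test_funs_def)
  have f_int: "integrable M f" by (rule test_funs_integrable[OF f b g])
  \<comment> \<open>Large enough to allow decay of order \<open>h\<close> around \<open>x0\<close>,
    which is the target, as well as of order 1, which suffices for integration in
    \<open>y\<close>.\<close>
  define N where "N = h + 1"
  have "0 \<le> N" using h by (simp add: N_def)
  then obtain CK E where maj: "kernel_majorant N CK E"
    using ex_kernel_majorant by blast
  note CK = kernel_majorantD(1)[OF maj] and E = kernel_majorantD(2,3)[OF maj]
    and QE = kernel_majorantD(4)[OF maj] and reg = kernel_majorantD(6)[OF maj]
  obtain I where I: "0 \<le> I" "\<And>t x. 0 < t \<Longrightarrow> (\<integral>y. decay t x (g - h) y \<partial>M) \<le> I"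
    using decay_integral_bounded[of "g - h"] h by auto
  obtain I' where I': "0 \<le> I'" "\<And>t x. 0 < t \<Longrightarrow> (\<integral>y. decay t x 1 y \<partial>M) \<le> I'"
    using decay_integral_bounded[of 1] by auto
  \<comment> \<open>For \<open>t < r\<close> and \<open>d x0 x <= 2 * A0 * r\<close> the sum
    \<open>t + d x0 x\<close> is at most \<open>L * r\<close>.\<close>
  define L where "L = 1 + 2 * A0"
  have L: "1 \<le> L" using A0_ge_1 by (simp add: L_def)
  have "1 \<le> 4 * A0" using A0_ge_1 by simp
  define m1 where "m1 = mass_const (4 * A0) * (2 * A0) powr h"
  define m2 where "m2 = mass_const L * L powr h"
  have m: "0 < m1" "0 < m2"
    using mass_const_pos[OF L] mass_const_pos[OF \<open>1 \<le> 4 * A0\<close>] A0_pos L by (auto simp: m1_def m2_def)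
  define k1 where "k1 = Cf * CK * (2 + m1)"
  define k2 where "k2 = Cf * CK * m2"
  have k12: "0 \<le> k1" "0 \<le> k2" using Cf CK m by (auto simp: k1_def k2_def)
  have "norm (apply_kernel (Q k) (induced f) x) \<le> (k1 * I + k2 * I') * (\<delta> powi k) powr (- h) * decay (\<delta> powi k) x0 h x"
    if k: "k \<le> 0" for k x
  proof -
    define t where "t = \<delta> powi k"
    have "1 \<le> inverse \<delta> ^ nat (- k)"
      using delta_pos delta_less_1 by (intro one_le_power) (simp add: one_le_inverse)
    then have t: "1 \<le> t" "0 < t"
      using k delta_pos by (auto simp: t_def power_int_def)
    define D where "D = decay t x0 h x"
    have D: "0 \<le> D" using t by (simp add: D_def)
    have N_h: "decay t x' N y' \<le> decay t x' h y'" "decay t x' N y' \<le> decay t x' 1 y'" for x' y'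
      using t h by (auto simp: N_def intro!: decay_antimono)
    have Qx0: "norm (Q k x x0) \<le> CK * D"
      using order_trans[OF QE E(2), of k x x0] mult_left_mono[OF N_h(1)[of x0 x], of CK] CK
      unfolding t_def D_def by linarith
    have pointwise: "norm (f y * (Q k x y - Q k x x0)) \<le>
        t powr (- h) * D * (k1 * decay 1 x0 (g - h) y + k2 * decay t x 1 y)" for y
    proof -
      define r where "r = d x0 y"
      have r: "0 \<le> r" by (simp add: r_def d_nonneg)
      have fy: "norm (f y) \<le> Cf * decay 1 x0 g y"
        by (rule test_bound_size) fact
      have absorb: "r powr h * decay 1 x0 g y \<le> decay 1 x0 (g - h) y"
        using decay_absorb_powr[of 1 h x0 y g] h by (simp add: r_def)
      \<comment> \<open>The gain \<open>t powr (- h)\<close> comes from here: the decay of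
        \<open>f\<close> absorbs \<open>r powr h\<close> and keeps the positive exponent
        \<open>g - h\<close>.\<close>
      have f_r: "(r / t) powr h * norm (f y) \<le> Cf * (t powr (- h) * decay 1 x0 (g - h) y)"
      proof -
        have "(r / t) powr h * norm (f y) \<le> (r / t) powr h * (Cf * decay 1 x0 g y)"
          using fy by (intro mult_left_mono) auto
        also have "\<dots> = Cf * t powr (- h) * (r powr h * decay 1 x0 g y)"
          using r t by (simp add: powr_divide powr_minus field_simps)
        also have "\<dots> \<le> Cf * t powr (- h) * decay 1 x0 (g - h) y"
          using absorb Cf by (intro mult_left_mono) auto
        finally show ?thesis by (simp add: mult.assoc)
      qed
      show ?thesis
      proof (cases "r \<le> t")
        \<comment> \<open>In the range of the kernel regularity; as \<open>r / t <= 1\<close> and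
          \<open>h <= \<eta>\<close>, the exponent \<open>\<eta>\<close> may be lowered to
          \<open>h\<close>.\<close>
        case True
        have "norm (Q k x y - Q k x x0) \<le> (r / t) powr \<eta> * (CK * D)"
        proof -
          have "norm (Q k x x0 - Q k x y) \<le> (r / t) powr \<eta> * E k x0 x"
            using reg[of x0 y k x] True by (simp add: r_def t_def)
          also have "\<dots> \<le> (r / t) powr \<eta> * (CK * D)"
            using order_trans[OF E(1)[of k x0 x, folded t_def] mult_left_mono[OF N_h(1)[of x0 x], of CK]] CK
            by (intro mult_left_mono) (auto simp: D_def)
          finally show ?thesis by (simp add: norm_minus_commute)
        qed
        also have "\<dots> \<le> (r / t) powr h * (CK * D)"
          using True t r h CK D by (intro mult_right_mono powr_mono') auto
        finally have "norm (f y) * norm (Q k x y - Q k x x0) \<le> norm (f y) * ((r / t) powr h * (CK * D))"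
          by (intro mult_left_mono) auto
        also have "\<dots> = ((r / t) powr h * norm (f y)) * (CK * D)"
          by (simp add: mult_ac)
        also have "\<dots> \<le> Cf * (t powr (- h) * decay 1 x0 (g - h) y) * (CK * D)"
          using f_r CK D by (intro mult_right_mono) auto
        also have "\<dots> = t powr (- h) * D * (Cf * CK * decay 1 x0 (g - h) y)"
          by (simp add: mult_ac)
        also have "\<dots> \<le> t powr (- h) * D * (k1 * decay 1 x0 (g - h) y + k2 * decay t x 1 y)"
        proof (intro mult_left_mono)
          have "Cf * CK * decay 1 x0 (g - h) y \<le> k1 * decay 1 x0 (g - h) y"
            unfolding k1_def using Cf CK m by (intro mult_right_mono) auto
          then show "Cf * CK * decay 1 x0 (g - h) y \<le> k1 * decay 1 x0 (g - h) y + k2 * decay t x 1 y"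
            using k12 t by (intro add_increasing2) auto
        qed (use D in auto)
        finally show ?thesis by (simp add: norm_mult)
      next
        case False
        then have rt: "t < r" by simp
        have "1 \<le> (r / t) powr h"
          using rt t h by (intro ge_one_powr_ge_zero) auto
        then have "1 * norm (f y) \<le> (r / t) powr h * norm (f y)"
          by (intro mult_right_mono) auto
        then have f_t: "norm (f y) \<le> Cf * (t powr (- h) * decay 1 x0 (g - h) y)"
          using f_r by simp
        then have 1: "norm (f y) * norm (Q k x x0) \<le> t powr (- h) * D * (Cf * CK * decay 1 x0 (g - h) y)"
          using mult_mono[OF f_t Qx0] Cf by (simp add: mult_ac)
        have 2: "norm (f y) * norm (Q k x y) \<le>
            t powr (- h) * D * (Cf * CK * m1 * decay 1 x0 (g - h) y + k2 * decay t x 1 y)"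
        \<comment> \<open>Either \<open>y\<close> is at least about as far from \<open>x0\<close> as
          \<open>x\<close> is, and then \<open>f y\<close> already has the required size while the
          kernel is integrated; or \<open>y\<close> is far from \<open>x\<close>, and then the
          kernel has the required size while \<open>f\<close> is integrated.\<close>
        proof (cases "d x0 x \<le> 2 * A0 * r")
          case True
          have "1 / mass 1 x0 y \<le> mass_const L * (1 / mass t x0 x)"
          proof (rule inverse_mass_compare)
            have "t + d x0 x + d x0 x0 \<le> L * r"
              using True rt by (simp add: L_def algebra_simps)
            also have "\<dots> \<le> L * (1 + r)" using L by (intro mult_left_mono) auto
            finally show "t + d x0 x + d x0 x0 \<le> L * (1 + d x0 y)" by (simp add: r_def)
          qed (use t L in auto)
          moreover have "(1 + r / 1) powr (- g) \<le> L powr h * (t powr (- h) * (1 + d x0 x / t) powr (- h))"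
          proof -
            have "(1 + r / 1) powr (- g) \<le> (1 + r) powr (- h)"
              using r h by (auto intro!: powr_mono)
            also have "\<dots> \<le> (t * (1 + d x0 x / t) / L) powr (- h)"
            proof (intro powr_mono2')
              have "t * (1 + d x0 x / t) = t + d x0 x" using t by (simp add: field_simps)
              also have "\<dots> \<le> L * r" using True rt by (simp add: L_def algebra_simps)
              also have "\<dots> \<le> L * (1 + r)" using L by (intro mult_left_mono) auto
              finally show "t * (1 + d x0 x / t) / L \<le> 1 + r"
                using L by (simp add: divide_le_eq mult.commute)
              show "0 < t * (1 + d x0 x / t) / L"
                using t L d_nonneg[of x0 x] by (intro divide_pos_pos mult_pos_pos add_pos_nonneg) auto
            qed (use h in simp)
            also have "\<dots> = L powr h * (t powr (- h) * (1 + d x0 x / t) powr (- h))"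
            proof -
              have "(t * w / L) powr (- h) = L powr h * (t powr (- h) * w powr (- h))" if "0 < w" for w
                using L t that by (simp add: powr_divide powr_mult powr_minus field_simps)
              then show ?thesis
                using t d_nonneg[of x0 x] by (simp add: add_pos_nonneg)
            qed
            finally show ?thesis .
          qed
          ultimately have "decay 1 x0 g y \<le> (mass_const L * (1 / mass t x0 x)) *
              (L powr h * (t powr (- h) * (1 + d x0 x / t) powr (- h)))"
            unfolding decay_def r_def
            using mass_const_pos[OF L] mass_pos[of t x0 x] t by (intro mult_mono) auto
          also have "\<dots> = m2 * (t powr (- h) * D)"
            by (simp add: m2_def D_def decay_def)
          finally have "norm (f y) \<le> Cf * (m2 * (t powr (- h) * D))"
            using fy Cf by (meson mult_left_mono less_imp_le order_trans)
          moreover have "norm (Q k x y) \<le> CK * decay t x 1 y"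
            using order_trans[OF QE E(1), of k x y] mult_left_mono[OF N_h(2)[of x y], of CK] CK
            unfolding t_def by linarith
          ultimately have "norm (f y) * norm (Q k x y) \<le> (Cf * (m2 * (t powr (- h) * D))) * (CK * decay t x 1 y)"
            using Cf m D by (intro mult_mono) auto
          also have "\<dots> = t powr (- h) * D * (k2 * decay t x 1 y)"
            by (simp add: k2_def mult_ac)
          also have "\<dots> \<le> t powr (- h) * D * (Cf * CK * m1 * decay 1 x0 (g - h) y + k2 * decay t x 1 y)"
            using D Cf CK m by (intro mult_left_mono) auto
          finally show ?thesis .
        next
          case False
          have "d x0 x \<le> A0 * (r + d x y)"
            using d_triangle[of x0 x y] by (simp add: r_def d_sym[of y])
          also have "\<dots> \<le> d x0 x / 2 + A0 * d x y"
            using False A0_pos by (simp add: distrib_left)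
          finally have far: "d x0 x \<le> 2 * A0 * d x y" by simp
          have "decay t x h y \<le> m1 * decay t x0 h x"
            unfolding m1_def
          proof (rule decay_compare)
            have "t + d x0 x + d x x0 \<le> t + 4 * A0 * d x y"
              using far by (simp add: d_sym[of x x0])
            also have "\<dots> \<le> 4 * A0 * t + 4 * A0 * d x y"
              using t A0_ge_1 by (simp add: mult_le_cancel_right1)
            finally show "t + d x0 x + d x x0 \<le> 4 * A0 * (t + d x y)"
              by (simp add: distrib_left)
            have "1 + d x0 x / t \<le> 1 + 2 * A0 * (d x y / t)"
              using far t by (simp add: divide_right_mono)
            also have "\<dots> \<le> 2 * A0 * (1 + d x y / t)"
              using A0_ge_1 by (simp add: distrib_left)
            finally show "1 + d x0 x / t \<le> 2 * A0 * (1 + d x y / t)" .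
          qed (use t A0_ge_1 h in auto)
          then have "CK * decay t x N y \<le> CK * (m1 * D)"
            using N_h(1)[of x y] CK by (intro mult_left_mono) (auto simp: D_def)
          then have "norm (Q k x y) \<le> CK * (m1 * D)"
            using QE[of k x y] E(1)[of k x y] by (simp add: t_def)
          then have "norm (f y) * norm (Q k x y) \<le> (Cf * (t powr (- h) * decay 1 x0 (g - h) y)) * (CK * (m1 * D))"
            using f_t Cf by (intro mult_mono) auto
          also have "\<dots> = t powr (- h) * D * (Cf * CK * m1 * decay 1 x0 (g - h) y)"
            by (simp add: mult_ac)
          also have "\<dots> \<le> t powr (- h) * D * (Cf * CK * m1 * decay 1 x0 (g - h) y + k2 * decay t x 1 y)"
            using D k12 t by (intro mult_left_mono) auto
          finally show ?thesis .
        qed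
        have "norm (f y * (Q k x y - Q k x x0)) \<le> norm (f y) * (norm (Q k x y) + norm (Q k x x0))"
          unfolding norm_mult by (intro mult_left_mono norm_triangle_ineq4) auto
        also have "\<dots> \<le> t powr (- h) * D * (Cf * CK * decay 1 x0 (g - h) y
            + (Cf * CK * m1 * decay 1 x0 (g - h) y + k2 * decay t x 1 y))"
          using 1 2 by (simp add: distrib_left)
        also have "\<dots> \<le> t powr (- h) * D * (k1 * decay 1 x0 (g - h) y + k2 * decay t x 1 y)"
        proof (intro mult_left_mono)
          have "0 \<le> Cf * CK * decay 1 x0 (g - h) y" using Cf CK by simp
          then show "Cf * CK * decay 1 x0 (g - h) y + (Cf * CK * m1 * decay 1 x0 (g - h) y + k2 * decay t x 1 y)
              \<le> k1 * decay 1 x0 (g - h) y + k2 * decay t x 1 y"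
            by (simp add: k1_def algebra_simps)
        qed (use D in auto)
        finally show ?thesis .
      qed
    qed
    have int1: "integrable M (\<lambda>y. f y * Q k x y)"
      by (rule test_fun_mult_closure_integrable[OF f b g kernel_closure])
    have int2: "integrable M (\<lambda>y. f y * Q k x x0)"
      using f_int by simp
    \<comment> \<open>Now the mean value of \<open>f\<close> vanishes, so the value of the kernel at
      \<open>x0\<close> can be subtracted.\<close>
    have "apply_kernel (Q k) (induced f) x = (\<integral>y. f y * (Q k x y - Q k x x0) \<partial>M)"
      using int1 int2 mean by (simp add: apply_kernel_induced right_diff_distrib)
    also have "norm \<dots> \<le> (\<integral>y. t powr (- h) * D * (k1 * decay 1 x0 (g - h) y + k2 * decay t x 1 y) \<partial>M)"
      using int1 int2 decay_integrable[of "g - h" 1 x0] decay_integrable[of 1 t x] t h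
      by (intro norm_integral_le_integral pointwise) (auto simp: right_diff_distrib)
    also have "\<dots> = t powr (- h) * D * (k1 * (\<integral>y. decay 1 x0 (g - h) y \<partial>M) + k2 * (\<integral>y. decay t x 1 y \<partial>M))"
      using decay_integrable[of "g - h" 1 x0] decay_integrable[of 1 t x] t h by simp
    also have "\<dots> \<le> t powr (- h) * D * (k1 * I + k2 * I')"
      using I(2)[of 1 x0] I'(2)[of t x] t k12 D by (intro mult_left_mono add_mono) auto
    finally show ?thesis
      by (simp add: t_def D_def mult_ac)
  qed
  moreover have "0 \<le> k1 * I + k2 * I'"
    using k12 I I' by simp
  ultimately show ?thesis by blast
qed

end

section \<open>Embeddings\<close>

text \<open>The weight cancels the part with \<open>s\<close>, which leaves a two-sided geometric
  sequence of ratio \<open>\<delta> powr e < 1\<close>; it lies in the sequence space for every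
  \<open>q\<close>.\<close>

lemma weighted_lq_norm_geometric_finite:
  assumes \<delta>: "0 < \<delta>" "\<delta> < 1" and q: "0 < q" and e: "0 < e" and C: "0 \<le> C"
    and a: "\<And>k. a k \<le> ennreal (C * \<delta> powr (of_int k * s + e * \<bar>of_int k\<bar>))"
  shows "weighted_lq_norm \<delta> s q a < \<infinity>"
proof -
  define b where "b = (\<lambda>k. ennreal (\<delta> powr (- (of_int k * s))) * a k)"
  define \<rho> where "\<rho> = \<delta> powr e"
  have \<rho>: "0 < \<rho>" "\<rho> < 1"
    using \<delta> e powr_less_mono'[of \<delta> 0 e] by (auto simp: \<rho>_def)
  have b_le: "b k \<le> ennreal (C * \<rho> powr \<bar>of_int k\<bar>)" for k
  proof -
    have "b k \<le> ennreal (\<delta> powr (- (of_int k * s))) * ennreal (C * \<delta> powr (of_int k * s + e * \<bar>of_int k\<bar>))"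
      unfolding b_def by (intro mult_left_mono a) auto
    also have "\<dots> = ennreal (C * (\<delta> powr (- (of_int k * s)) * \<delta> powr (of_int k * s + e * \<bar>of_int k\<bar>)))"
      using C by (simp add: ennreal_mult[symmetric] mult.left_commute)
    also have "\<delta> powr (- (of_int k * s)) * \<delta> powr (of_int k * s + e * \<bar>of_int k\<bar>) = \<rho> powr \<bar>of_int k\<bar>"
      by (simp add: \<rho>_def powr_powr powr_add[symmetric])
    finally show ?thesis .
  qed
  have "Lp_norm (count_space UNIV) q b < \<infinity>"
  proof (cases q)
    case top
    have "b k \<le> ennreal C" for k
    proof -
      have "C * \<rho> powr \<bar>of_int k\<bar> \<le> C * 1"
        using \<rho> C by (intro mult_left_mono powr_le1) auto
      then show ?thesis
        using b_le[of k] by (auto intro: order_trans ennreal_leI)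
    qed
    then have "(SUP k. b k) \<le> ennreal C"
      by (intro SUP_least)
    then show ?thesis
      unfolding top Lp_norm_count_space_infinity[unfolded infinity_ennreal_def]
      by (rule le_less_trans) simp
  next
    case (real r)
    with q have r: "0 < r" by simp
    have "\<rho> powr r < 1"
      using \<rho> r powr_less_mono'[of \<rho> 0 r] by simp
    have "(\<integral>\<^sup>+k. ennreal_powr (b k) r \<partial>count_space UNIV) \<le>
        (\<integral>\<^sup>+k. ennreal (C powr r) * ennreal ((\<rho> powr r) powr \<bar>real_of_int k\<bar>) \<partial>count_space UNIV)"
    proof (intro nn_integral_mono)
      fix k
      have "ennreal_powr (b k) r \<le> ennreal_powr (ennreal (C * \<rho> powr \<bar>of_int k\<bar>)) r"
        using r by (intro ennreal_powr_mono b_le) auto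
      also have "\<dots> = ennreal (C powr r) * ennreal ((\<rho> powr r) powr \<bar>real_of_int k\<bar>)"
        using C by (simp add: ennreal_powr_ennreal powr_mult powr_powr mult.commute flip: ennreal_mult)
      finally show "ennreal_powr (b k) r \<le> ennreal (C powr r) * ennreal ((\<rho> powr r) powr \<bar>real_of_int k\<bar>)" .
    qed
    also have "\<dots> = ennreal (C powr r) * (\<integral>\<^sup>+k. ennreal ((\<rho> powr r) powr \<bar>real_of_int k\<bar>) \<partial>count_space UNIV)"
      by (rule nn_integral_cmult) simp
    also have "\<dots> < \<infinity>"
      using nn_integral_powr_abs_int_finite[of "\<rho> powr r"] \<rho> \<open>\<rho> powr r < 1\<close> by (simp add: ennreal_mult_less_top)
    finally show ?thesis
      using real by (simp add: Lp_norm_finite[OF r])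
  qed
  then show ?thesis
    by (simp add: weighted_lq_norm_eq_Lp_norm[OF q] b_def)
qed

context ATI_space
begin

abbreviation besov :: "real \<Rightarrow> ennreal \<Rightarrow> ennreal \<Rightarrow> (('a \<Rightarrow> complex) \<Rightarrow> complex) set" where
  "besov s p q \<equiv> besov_space M d A0 x0 \<delta> \<eta> Q \<beta> \<gamma> s p q"

abbreviation triebel :: "real \<Rightarrow> ennreal \<Rightarrow> ennreal \<Rightarrow> (('a \<Rightarrow> complex) \<Rightarrow> complex) set" where
  "triebel s p q \<equiv> triebel_space M d A0 x0 \<delta> \<eta> Q \<beta> \<gamma> s p q"

lemma besov_mono:
  assumes "0 < q\<^sub>0" "q\<^sub>0 \<le> q\<^sub>1"
  shows "besov s p q\<^sub>0 \<subseteq> besov s p q\<^sub>1"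
  using assms Lp_norm_count_space_antimono[OF assms]
  by (auto simp: besov_space_def besov_norm_def weighted_lq_norm_eq_Lp_norm intro: le_less_trans)

lemma triebel_mono:
  assumes "0 < q\<^sub>0" "q\<^sub>0 \<le> q\<^sub>1" "p < \<infinity>"
  shows "triebel s p q\<^sub>0 \<subseteq> triebel s p q\<^sub>1"
proof -
  have "triebel_norm M \<delta> Q s p q\<^sub>1 \<phi> \<le> triebel_norm M \<delta> Q s p q\<^sub>0 \<phi>" for \<phi>
    unfolding triebel_norm_def using assms
    by (intro Lp_norm_mono) (auto simp: weighted_lq_norm_eq_Lp_norm intro: Lp_norm_count_space_antimono)
  then show ?thesis
    by (auto simp: triebel_space_def intro: le_less_trans)
qed

text \<open>With the weight inside the Lebesgue norm, the Besov and the Triebel-Lizorkin quantity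
  are the two mixed norms of one and the same family.\<close>

lemma besov_norm_eq:
  assumes "0 < p" "p < \<infinity>" "0 < q" "\<phi> \<in> distrs"
  shows "besov_norm M \<delta> Q s p q \<phi> = Lp_norm (count_space UNIV) q (\<lambda>k. Lp_norm M p
    (\<lambda>x. ennreal (\<delta> powr (- (of_int k * s))) * ennreal (norm (apply_kernel (Q k) \<phi> x))))"
proof -
  obtain r where r: "p = ennreal r" "0 < r"
    using assms by (cases p) auto
  note [measurable] = distribution_kernel_measurable[OF assms(4)]
  show ?thesis
    unfolding besov_norm_def weighted_lq_norm_eq_Lp_norm[OF assms(3)] r(1)
    by (subst Lp_norm_cmult[OF r(2)]) auto
qed

lemma besov_triebel_embedding:
  assumes p: "0 < p" "p < \<infinity>" and q: "0 < q"
  shows "q \<le> p \<Longrightarrow> besov s p q \<subseteq> triebel s p q" and "p \<le> q \<Longrightarrow> triebel s p q \<subseteq> besov s p q"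
proof -
  have meas: "(\<lambda>x. ennreal (\<delta> powr (- (of_int k * s))) * ennreal (norm (apply_kernel (Q k) \<phi> x))) \<in> borel_measurable M"
    if "\<phi> \<in> distrs" for \<phi> k
    using distribution_kernel_measurable[OF that, of k] by measurable
  note swap = mixed_norm_finite_swap[where u = "\<lambda>k x. ennreal (\<delta> powr (- (of_int k * s))) *
      ennreal (norm (apply_kernel (Q k) \<phi> x))" for \<phi>, OF p q meas]
  show "q \<le> p \<Longrightarrow> besov s p q \<subseteq> triebel s p q"
    using swap(1) by (auto simp: besov_space_def triebel_space_def besov_norm_eq[OF p q] triebel_norm_def
        weighted_lq_norm_eq_Lp_norm[OF q])
  show "p \<le> q \<Longrightarrow> triebel s p q \<subseteq> besov s p q"
    using swap(2) by (auto simp: besov_space_def triebel_space_def besov_norm_eq[OF p q] triebel_norm_def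
        weighted_lq_norm_eq_Lp_norm[OF q])
qed

text \<open>For \<open>a >= 0\<close> this is polynomial volume growth. For \<open>a < 0\<close> the
  volume only grows from scale 1 on, so its power is bounded by the value there.\<close>

lemma V_powr_growth:
  "\<exists>K\<ge>0. \<forall>t\<ge>1. V t x powr a \<le> K * t powr (\<omega> * max a 0)"
proof (cases "0 \<le> a")
  case True
  have "V t x powr a \<le> (Cmu * V 1 x) powr a * t powr (\<omega> * max a 0)" if "1 \<le> t" for t
  proof -
    have "V t x \<le> (Cmu * V 1 x) * t powr \<omega>"
      using V_growth[of 1 t x] that by (simp add: mult_ac)
    then have "V t x powr a \<le> ((Cmu * V 1 x) * t powr \<omega>) powr a"
      using True by (intro powr_mono2) auto
    then show ?thesis
      using True Cmu_ge_1 by (simp add: powr_mult powr_powr)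
  qed
  then show ?thesis
    by (intro exI[of _ "(Cmu * V 1 x) powr a"]) auto
next
  case False
  then show ?thesis
    using V_mono V_pos by (intro exI[of _ "V 1 x powr a"]) (auto intro!: powr_mono2')
qed

text \<open>Fine scales give \<open>\<delta>^(k b)\<close> with \<open>b > s\<close>. Coarse scales
  give \<open>\<delta>^(k (\<kappa> - h))\<close>, where \<open>\<kappa>\<close> accounts for the
  volume in the norm of the decay function; after weighting they are summable because
  \<open>s + h - \<kappa>\<close> is positive.\<close>

lemma test_fun_in_besov:
  assumes f: "f \<in> test_funs_mean0 M d A0 x0 b g"
    and p: "0 < p" and q: "0 < q" and b: "max s 0 < b"
    and g: "max (- s + \<omega> * max (enn2real (1 / p) - 1) 0) (\<omega> * max (enn2real (1 / p) - 1) 0) < g" "g < \<eta>"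
  shows "induced f \<in> besov s p q"
proof -
  define \<kappa> where "\<kappa> = \<omega> * max (enn2real (1 / p) - 1) 0"
  have \<kappa>: "0 \<le> \<kappa>" using dim_nonneg by (simp add: \<kappa>_def)
  \<comment> \<open>Strictly below \<open>g\<close>, as the coarse scale estimate demands, yet still
    above both lower bounds imposed on \<open>g\<close>.\<close>
  obtain h where h: "max (- s + \<kappa>) \<kappa> < h" "h < g"
    using dense g unfolding \<kappa>_def by blast
  have pos: "0 < b" "0 < h" "0 < g" "h \<le> \<eta>" "\<kappa> < g" "\<kappa> < h" "s < b" "0 < s + h - \<kappa>"
    using b h g \<kappa> by auto
  have f': "f \<in> test_funs M d A0 x0 b g" "(\<integral>y. f y \<partial>M) = 0"
    using f by (auto simp: test_funs_mean0_def)
  have distr: "induced f \<in> distrs"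
    by (rule induced_in_distributions[OF f'(1)]) fact+
  have meas: "(\<lambda>x. ennreal (norm (apply_kernel (Q k) (induced f) x))) \<in> borel_measurable M" for k
    using distribution_kernel_measurable[OF distr, of k] by measurable
  define a where "a k = Lp_norm M p (\<lambda>x. ennreal (norm (apply_kernel (Q k) (induced f) x)))" for k
  \<comment> \<open>The smaller of the two geometric gains, so that one bound in
    \<open>\<bar>k\<bar>\<close> serves both directions.\<close>
  define e where "e = min (b - s) (s + h - \<kappa>)"
  have e: "0 < e" "e \<le> b - s" "e \<le> s + h - \<kappa>" using pos by (auto simp: e_def)
  have powi: "\<delta> powi k = \<delta> powr of_int k" for k
    using delta_pos by (simp add: powr_real_of_int')
  obtain C1 where C1: "0 \<le> C1" "\<forall>k\<ge>0. \<forall>x. norm (apply_kernel (Q k) (induced f) x)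
      \<le> C1 * (\<delta> powi k) powr b * decay 1 x0 g x"
    using kernel_action_fine_scale[OF f'(1) pos(1,3)] by (elim exE conjE) (rule that)
  obtain C2 where C2: "0 \<le> C2" "\<forall>k\<le>0. \<forall>x. norm (apply_kernel (Q k) (induced f) x)
      \<le> C2 * (\<delta> powi k) powr (- h) * decay (\<delta> powi k) x0 h x"
    using kernel_action_coarse_scale[OF f' pos(1,2) h(2) pos(4)] by (elim exE conjE) (rule that)
  obtain L1 where L1: "0 \<le> L1" "\<forall>t>0. \<forall>x. \<forall>c\<ge>0. \<forall>f\<in>borel_measurable M.
      (\<forall>y. f y \<le> ennreal (c * decay t x g y)) \<longrightarrow> Lp_norm M p f \<le> ennreal (L1 * c * V t x powr (enn2real (1 / p) - 1))"
    using Lp_norm_decay[OF p pos(5)[unfolded \<kappa>_def]] by (elim exE conjE) (rule that)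
  obtain L2 where L2: "0 \<le> L2" "\<forall>t>0. \<forall>x. \<forall>c\<ge>0. \<forall>f\<in>borel_measurable M.
      (\<forall>y. f y \<le> ennreal (c * decay t x h y)) \<longrightarrow> Lp_norm M p f \<le> ennreal (L2 * c * V t x powr (enn2real (1 / p) - 1))"
    using Lp_norm_decay[OF p pos(6)[unfolded \<kappa>_def]] by (elim exE conjE) (rule that)
  note C1 = C1[rule_format] and C2 = C2[rule_format] and L1 = L1[rule_format] and L2 = L2[rule_format]
  obtain K where K: "0 \<le> K" "\<And>t. 1 \<le> t \<Longrightarrow> V t x0 powr (enn2real (1 / p) - 1) \<le> K * t powr \<kappa>"
    using V_powr_growth[of x0 "enn2real (1 / p) - 1"] unfolding \<kappa>_def by blast
  define A1 where "A1 = L1 * C1 * V 1 x0 powr (enn2real (1 / p) - 1)"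
  define A2 where "A2 = L2 * C2 * K"
  have A12: "0 \<le> A1" "0 \<le> A2" using L1 L2 C1 C2 K by (auto simp: A1_def A2_def)
  have "a k \<le> ennreal (max A1 A2 * \<delta> powr (of_int k * s + e * \<bar>of_int k\<bar>))" for k
  proof (cases "0 \<le> k")
    case True
    have "a k \<le> ennreal (L1 * (C1 * (\<delta> powi k) powr b) * V 1 x0 powr (enn2real (1 / p) - 1))"
      unfolding a_def by (rule L1(2)[OF _ _ meas ennreal_leI[OF C1(2)[OF True]]]) (use C1 in auto)
    also have "L1 * (C1 * (\<delta> powi k) powr b) * V 1 x0 powr (enn2real (1 / p) - 1) = A1 * \<delta> powr (of_int k * b)"
      by (simp add: A1_def powi powr_powr mult_ac)
    also have "\<dots> \<le> max A1 A2 * \<delta> powr (of_int k * s + e * \<bar>of_int k\<bar>)"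
    proof (intro mult_mono powr_mono')
      have "of_int k * e \<le> of_int k * (b - s)"
        using e True by (intro mult_left_mono) auto
      then show "of_int k * s + e * \<bar>of_int k\<bar> \<le> of_int k * b"
        using True by (simp add: algebra_simps)
    qed (use A12 delta_pos delta_less_1 in auto)
    finally show ?thesis by (auto intro: ennreal_leI)
  next
    case False
    have "1 \<le> inverse \<delta> ^ nat (- k)"
      using delta_pos delta_less_1 by (intro one_le_power) (simp add: one_le_inverse)
    then have t: "1 \<le> \<delta> powi k"
      using False delta_pos by (auto simp: power_int_def)
    have "a k \<le> ennreal (L2 * (C2 * (\<delta> powi k) powr (- h)) * V (\<delta> powi k) x0 powr (enn2real (1 / p) - 1))"
      unfolding a_def by (rule L2(2)[OF _ _ meas ennreal_leI[OF C2(2)]]) (use C2 False t in auto)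
    also have "\<dots> \<le> ennreal (A2 * \<delta> powr (of_int k * (\<kappa> - h)))"
    proof (intro ennreal_leI)
      have "L2 * (C2 * (\<delta> powi k) powr (- h)) * V (\<delta> powi k) x0 powr (enn2real (1 / p) - 1)
          \<le> L2 * (C2 * (\<delta> powi k) powr (- h)) * (K * (\<delta> powi k) powr \<kappa>)"
        using K(2)[OF t] L2(1) C2(1) by (intro mult_left_mono) auto
      also have "\<dots> = A2 * ((\<delta> powi k) powr \<kappa> * (\<delta> powi k) powr (- h))"
        by (simp add: A2_def)
      also have "(\<delta> powi k) powr \<kappa> * (\<delta> powi k) powr (- h) = \<delta> powr (of_int k * (\<kappa> - h))"
        by (simp add: powi powr_powr powr_add[symmetric] right_diff_distrib)
      finally show "L2 * (C2 * (\<delta> powi k) powr (- h)) * V (\<delta> powi k) x0 powr (enn2real (1 / p) - 1)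
          \<le> A2 * \<delta> powr (of_int k * (\<kappa> - h))" .
    qed
    also have "A2 * \<delta> powr (of_int k * (\<kappa> - h)) \<le> max A1 A2 * \<delta> powr (of_int k * s + e * \<bar>of_int k\<bar>)"
    proof (intro mult_mono powr_mono')
      have "of_int (- k) * e \<le> of_int (- k) * (s + h - \<kappa>)"
        using e False by (intro mult_left_mono) auto
      then show "of_int k * s + e * \<bar>of_int k\<bar> \<le> of_int k * (\<kappa> - h)"
        using False by (simp add: algebra_simps)
    qed (use A12 delta_pos delta_less_1 in auto)
    finally show ?thesis by (auto intro: ennreal_leI)
  qed
  then have "weighted_lq_norm \<delta> s q a < \<infinity>"
    by (rule weighted_lq_norm_geometric_finite[OF delta_pos delta_less_1 q e(1), rotated])
       (use A12 in \<open>simp add: max.coboundedI1\<close>)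
  then show ?thesis
    using distr by (simp add: besov_space_def besov_norm_def a_def[abs_def])
qed

end

theorem proposition3p13:
  fixes d :: "'a \<Rightarrow> 'a \<Rightarrow> real" and M :: "'a measure" and A0 Cmu :: real
    and c0 C0 \<delta> :: real and A :: "int \<Rightarrow> 'i set" and z :: "int \<Rightarrow> 'i \<Rightarrow> 'a"
    and \<eta> \<beta> \<gamma> s :: real and Q :: "int \<Rightarrow> 'a \<Rightarrow> 'a \<Rightarrow> complex" and x0 :: 'a
  assumes "homogeneous_type_space d A0 M Cmu"
    and "emeasure M (space M) = \<infinity>"
    and "reference_points d A0 c0 C0 \<delta> A z"
    and "\<eta> \<in> {0<..<1}"
    and "exp_ATI M d \<delta> (new_points A z) \<eta> Q"
    and "\<beta> \<in> {0<..<\<eta>}" and "\<gamma> \<in> {0<..<\<eta>}"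
    and "s \<in> {- min \<beta> \<gamma> <..< min \<beta> \<gamma>}"
  shows
    "let \<omega> = upper_dim Cmu;
         p\<^sub>0 = ennreal (index_bound \<omega> s (min \<beta> \<gamma>));
         B = besov_space M d A0 x0 \<delta> \<eta> Q \<beta> \<gamma> s;
         F = triebel_space M d A0 x0 \<delta> \<eta> Q \<beta> \<gamma> s;
         G = (\<lambda>\<beta>' \<gamma>'. induced_distribution M d A0 x0 \<eta> \<beta> \<gamma> ` test_funs_mean0 M d A0 x0 \<beta>' \<gamma>')
     in
       (\<forall>p q\<^sub>0 q\<^sub>1. 0 < q\<^sub>0 \<longrightarrow> q\<^sub>0 \<le> q\<^sub>1 \<longrightarrow> p \<in> {p\<^sub>0<..\<infinity>} \<longrightarrow> B p q\<^sub>0 \<subseteq> B p q\<^sub>1) \<and>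
       (\<forall>p q\<^sub>0 q\<^sub>1. p\<^sub>0 < q\<^sub>0 \<longrightarrow> q\<^sub>0 \<le> q\<^sub>1 \<longrightarrow> p \<in> {p\<^sub>0<..<\<infinity>} \<longrightarrow> F p q\<^sub>0 \<subseteq> F p q\<^sub>1) \<and>
       (\<forall>p q. p \<in> {p\<^sub>0<..<\<infinity>} \<longrightarrow> q \<in> {p\<^sub>0<..\<infinity>} \<longrightarrow>
          B p (min p q) \<subseteq> F p q \<and> F p q \<subseteq> B p (max p q)) \<and>
       (\<forall>\<beta>' \<gamma>' p q. \<beta>' \<in> {max s 0<..<\<eta>} \<longrightarrow>
          \<gamma>' \<in> {max (- s + \<omega> * max (enn2real (1 / p) - 1) 0) (\<omega> * max (enn2real (1 / p) - 1) 0)<..<\<eta>} \<longrightarrow>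
          (q \<in> {0<..\<infinity>} \<longrightarrow> p \<in> {p\<^sub>0<..\<infinity>} \<longrightarrow> G \<beta>' \<gamma>' \<subseteq> B p q) \<and>
          (q \<in> {p\<^sub>0<..\<infinity>} \<longrightarrow> p \<in> {p\<^sub>0<..<\<infinity>} \<longrightarrow> G \<beta>' \<gamma>' \<subseteq> F p q))"
proof -
  interpret ATI_space d A0 M Cmu c0 C0 \<delta> A z \<eta> \<beta> \<gamma> Q x0
    using assms by (auto intro!: ATI_space.intro homogeneous_space_with_points.intro ATI_space_axioms.intro)
  define p\<^sub>0 where "p\<^sub>0 = ennreal (index_bound \<omega> s (min \<beta> \<gamma>))"
  have pos: "0 < p" if "p\<^sub>0 < p" for p
    using that by (rule le_less_trans[OF zero_le])
  \<comment> \<open>Through \<open>triebel s p (min p q)\<close>: the exchange of norms requires an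
    ordered pair of exponents, and monotonicity in the second index then reaches \<open>q\<close>.
    The other inclusion passes through \<open>max p q\<close> in the same way.\<close>
  have besov_sub: "besov s p (min p q) \<subseteq> triebel s p q" if "0 < p" "p < \<infinity>" "0 < q" for p q
    using besov_triebel_embedding(1)[of p "min p q" s] triebel_mono[of "min p q" q p s] that by auto
  have triebel_sub: "triebel s p q \<subseteq> besov s p (max p q)" if "0 < p" "p < \<infinity>" "0 < q" for p q
    using besov_triebel_embedding(2)[of p "max p q" s] triebel_mono[of q "max p q" p s] that
    by (auto simp: less_max_iff_disj)
  have test_besov: "induced ` test_funs_mean0 M d A0 x0 b g \<subseteq> besov s p q"
    if "0 < p" "0 < q" "b \<in> {max s 0<..<\<eta>}"
      "g \<in> {max (- s + \<omega> * max (enn2real (1 / p) - 1) 0) (\<omega> * max (enn2real (1 / p) - 1) 0)<..<\<eta>}" for b g p q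
    using that by (auto intro!: test_fun_in_besov)
  have test_triebel: "induced ` test_funs_mean0 M d A0 x0 b g \<subseteq> triebel s p q"
    if "0 < p" "p < \<infinity>" "0 < q" "b \<in> {max s 0<..<\<eta>}"
      "g \<in> {max (- s + \<omega> * max (enn2real (1 / p) - 1) 0) (\<omega> * max (enn2real (1 / p) - 1) 0)<..<\<eta>}" for b g p q
    by (rule order_trans[OF test_besov besov_sub]) (use that in auto)
  show ?thesis
    unfolding Let_def p\<^sub>0_def[symmetric]
  proof (intro conjI allI impI)
    fix p q\<^sub>0 q\<^sub>1 :: ennreal
    show "0 < q\<^sub>0 \<Longrightarrow> q\<^sub>0 \<le> q\<^sub>1 \<Longrightarrow> besov s p q\<^sub>0 \<subseteq> besov s p q\<^sub>1"
      by (rule besov_mono)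
    show "p\<^sub>0 < q\<^sub>0 \<Longrightarrow> q\<^sub>0 \<le> q\<^sub>1 \<Longrightarrow> p \<in> {p\<^sub>0<..<\<infinity>} \<Longrightarrow> triebel s p q\<^sub>0 \<subseteq> triebel s p q\<^sub>1"
      using pos by (intro triebel_mono) auto
  next
    fix p q assume "p \<in> {p\<^sub>0<..<\<infinity>}" "q \<in> {p\<^sub>0<..\<infinity>}"
    then show "besov s p (min p q) \<subseteq> triebel s p q" "triebel s p q \<subseteq> besov s p (max p q)"
      using pos by (auto intro!: besov_sub[THEN subsetD] triebel_sub[THEN subsetD])
  next
    fix b g p q
    assume bg: "b \<in> {max s 0<..<\<eta>}"
      "g \<in> {max (- s + \<omega> * max (enn2real (1 / p) - 1) 0) (\<omega> * max (enn2real (1 / p) - 1) 0)<..<\<eta>}"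
    show "induced ` test_funs_mean0 M d A0 x0 b g \<subseteq> besov s p q" if "q \<in> {0<..\<infinity>}" "p \<in> {p\<^sub>0<..\<infinity>}"
      using that pos bg by (intro test_besov) auto
    show "induced ` test_funs_mean0 M d A0 x0 b g \<subseteq> triebel s p q" if "q \<in> {p\<^sub>0<..\<infinity>}" "p \<in> {p\<^sub>0<..<\<infinity>}"
      using that pos bg by (intro test_triebel) auto
  qed
qed

end
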